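(* Let the pressure $p$ satisfy $p \in C^1(0,\infty)\cap C[0,\infty)$, $p(0)=0$, $p'(\varrho)>0$ for all $\varrho>0$, and $p$ convex in $[0,\infty)$. Let $\tilde\varrho=\tilde\varrho(x_1/t)$, $\tilde{\mathbf u}=[\tilde u^1(x_1/t),0]$ be the self-similar solution to the Riemann problem with data $\varrho_L,\varrho_R,u^1_L,u^1_R$ (see context) consisting of rarefaction waves (so that it is locally Lipschitz for $t>0$) and such that $$\operatorname*{ess\,inf}_{(0,T)\times\mathbb R}\tilde\varrho>0 .$$ Let $[\varrho,\mathbf u]$ be a bounded admissible weak solution in $(0,T)\times\Omega$, in the sense of the context (continuity equation, momentum equation and energy inequality with the given initial data and boundary fluxes), such that $\varrho\ge 0$ a.e. in $(0,T)\times\Omega$. Then $$\varrho=\tilde\varrho,\qquad \mathbf u=\tilde{\mathbf u}\qquad\text{a.e. in }(0,T)\times\Omega,$$ where $[\tilde\varrho,\tilde{\mathbf u}]$ is extended as constant in the variable $x_2$.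
   Context: **Equations and data.** The compressible (barotropic) Euler system in two space dimensions is $$\partial_t\varrho+\operatorname{div}_x(\varrho\mathbf u)=0,\qquad \partial_t(\varrho\mathbf u)+\operatorname{div}_x(\varrho\mathbf u\otimes\mathbf u)+\nabla_x p(\varrho)=0,$$ with unknown density $\varrho(t,x)$ and velocity $\mathbf u(t,x)=[u^1,u^2]$. Given constants $\varrho_L,\varrho_R,u^1_L,u^1_R$, put $u^2_L=u^2_R=0$, $\mathbf u_L=[u^1_L,0]$, $\mathbf u_R=[u^1_R,0]$. The Riemann initial data are $\varrho_0(x)=\varrho_L$, $\mathbf u_0(x)=\mathbf u_L$ for $x_1\le 0$ and $\varrho_0(x)=\varrho_R$, $\mathbf u_0(x)=\mathbf u_R$ for $x_1>0$. Set $$H(\varrho)=\varrho\int_1^\varrho \frac{p(z)}{z^2}\,dz$$ (with $H(0)=0$ by continuous extension). **Self-similar rarefaction solution.** The self-similar solution $[\tilde\varrho(x_1/t),\tilde u^1(x_1/t)]$ of the Riemann problem solves the one-dimensional system $\partial_t\tilde\varrho+\partial_{x_1}(\tilde\varrho\tilde u^1)=0$, $\partial_t(\tilde\varrho\tilde u^1)+\partial_{x_1}(\tilde\varrho(\tilde u^1)^2+p(\tilde\varrho))=0$ for $t>0$, $x_1\in\mathbb R$, with initial data $(\varrho_L,u^1_L)$ for $x_1\le0$ and $(\varrho_R,u^1_R)$ for $x_1>0$. "Consisting of rarefaction waves" means that it is made of at most three constant states connected only by (centred) rarefaction waves, with no shocks; in particular it is locally Lipschitz for $t>0$. **Domain.**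 $T>0$ is fixed and $\Omega=(-a,a)\times\mathcal T^1$, where $\mathcal T^1$ is the one-dimensional flat torus (periodicity in $x_2$) and $a>0$ is sufficiently large to accommodate the far-field conditions on $(0,T)$, i.e. such that the self-similar solution equals $(\varrho_L,u^1_L)$ for $x_1\le -a$ and $(\varrho_R,u^1_R)$ for $x_1\ge a$ for all $t\in(0,T)$. **Bounded admissible weak solution.** A pair $[\varrho,\mathbf u]$ of bounded measurable functions on $(0,T)\times\Omega$ (with $\varrho$ and $\varrho\mathbf u$ identified with their weakly continuous in time representatives, so that $\varrho(\tau,\cdot)$ and $\varrho\mathbf u(\tau,\cdot)$ make sense for every $\tau\in[0,T]$) such that: (1) for all $0\le\tau\le T$ and all $\varphi\in C^1([0,T]\times\overline\Omega)$, $$\int_\Omega[\varrho(\tau,x)\varphi(\tau,x)-\varrho_0(x)\varphi(0,x)]\,dx+\int_0^\tau\!\!\int_{\mathcal T^1}\varrho_Ru^1_R\,\varphi(t,a,x_2)\,dx_2dt-\int_0^\tau\!\!\int_{\mathcal T^1}\varrho_Lu^1_L\,\varphi(t,-a,x_2)\,dx_2dt$$ $$=\int_0^\tau\!\!\int_\Omega[\varrho\,\partial_t\varphi+\varrho\mathbf u\cdot\nabla_x\varphi]\,dx\,dt;$$ (2) for all $0\le\tau\le T$ and all $\varphi=[\varphi^1,\varphi^2]\in C^1([0,T]\times\overline\Omega;\mathbb R^2)$, $$\int_\Omega[\varrho\mathbf u(\tau,x)\cdot\varphi(\tau,x)-\varrho_0\mathbf u_0(x)\cdot\varphi(0,x)]\,dx+\int_0^\tau\!\!\int_{\mathcal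 T^1}\varrho_Ru^1_R\mathbf u_R\cdot\varphi(t,a,x_2)\,dx_2dt-\int_0^\tau\!\!\int_{\mathcal T^1}\varrho_Lu^1_L\mathbf u_L\cdot\varphi(t,-a,x_2)\,dx_2dt$$ $$+\int_0^\tau\!\!\int_{\mathcal T^1}p(\varrho_R)\varphi^1(t,a,x_2)\,dx_2dt-\int_0^\tau\!\!\int_{\mathcal T^1}p(\varrho_L)\varphi^1(t,-a,x_2)\,dx_2dt$$ $$=\int_0^\tau\!\!\int_\Omega[\varrho\mathbf u\cdot\partial_t\varphi+\varrho\,(\mathbf u\otimes\mathbf u):\nabla_x\varphi+p(\varrho)\operatorname{div}_x\varphi]\,dx\,dt;$$ (3) for a.a. $\tau\in(0,T)$, $$\int_\Omega\Big[\tfrac12\varrho|\mathbf u|^2+H(\varrho)\Big](\tau,x)\,dx-\int_\Omega\Big[\tfrac12\varrho_0|\mathbf u_0|^2+H(\varrho_0)\Big]dx$$ $$+\int_0^\tau\!\!\int_{\mathcal T^1}\Big[\tfrac12\varrho_R|\mathbf u_R|^2+H(\varrho_R)+p(\varrho_R)\Big]u^1_R\,dx_2dt-\int_0^\tau\!\!\int_{\mathcal T^1}\Big[\tfrac12\varrho_L|\mathbf u_L|^2+H(\varrho_L)+p(\varrho_L)\Big]u^1_L\,dx_2dt\le 0.$$ *)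

theory Defs
  imports "HOL-Analysis.Analysis" "HOL-Probability.Essential_Supremum"
begin

text \<open>
  Points of space are pairs \<open>(x1, x2)\<close>, points of space-time are \<open>(t, x1, x2)\<close>. The flat torus of
  circumference \<open>l\<close> is represented by the cell \<open>{0..<l}\<close>: the unknowns are functions on the cell,
  while test functions are \<open>l\<close>-periodic in \<open>x2\<close>, so that no boundary term appears at \<open>x2 = 0, l\<close>.
  All integrals and null sets refer to Lebesgue measure.
\<close>

subsection \<open>Pressure and pressure potential\<close>

definition admissible_pressure :: "(real \<Rightarrow> real) \<Rightarrow> bool" where
  "admissible_pressure p \<longleftrightarrow>
     continuous_on {0..} p \<and>
     (\<forall>z>0. p differentiable (at z)) \<and> continuous_on {0<..} (deriv p) \<and>
     p 0 = 0 \<and> (\<forall>z>0. deriv p z > 0) \<and> convex_on {0..} p"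

text \<open>The interval integral is oriented. The leading factor yields the convention \<open>H p 0 = 0\<close>.\<close>

definition H :: "(real \<Rightarrow> real) \<Rightarrow> real \<Rightarrow> real" where
  "H p r = r * (LBINT z=ereal 1..ereal r. p z / z^2)"

definition energy :: "(real \<Rightarrow> real) \<Rightarrow> real \<Rightarrow> real \<times> real \<Rightarrow> real" where
  "energy p r v = 1/2 * r * (norm v)^2 + H p r"

subsection \<open>The one-dimensional Riemann problem and rarefaction waves\<close>

definition riemann_data :: "'a \<Rightarrow> 'a \<Rightarrow> real \<Rightarrow> 'a" where
  "riemann_data L R x1 = (if x1 \<le> 0 then L else R)"

definition balance_at :: "(real \<Rightarrow> real \<Rightarrow> real) \<Rightarrow> (real \<Rightarrow> real \<Rightarrow> real) \<Rightarrow> real \<Rightarrow> real \<Rightarrow> bool" where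
  "balance_at q f t x \<longleftrightarrow>
     (\<exists>d e. ((\<lambda>s. q s x) has_real_derivative d) (at t) \<and>
            ((\<lambda>y. f t y) has_real_derivative e) (at x) \<and> d + e = 0)"

text \<open>
  The notion of solution appropriate for functions that are locally Lipschitz for \<open>t > 0\<close>:
  the equations hold almost everywhere and the initial data are attained as \<open>t \<rightarrow> 0+\<close>.
\<close>

definition solves_riemann_1d ::
  "(real \<Rightarrow> real) \<Rightarrow> real \<Rightarrow> real \<Rightarrow> real \<Rightarrow> real \<Rightarrow>
   (real \<Rightarrow> real \<Rightarrow> real) \<Rightarrow> (real \<Rightarrow> real \<Rightarrow> real) \<Rightarrow> bool" where
  "solves_riemann_1d p rhoL rhoR uL uR rho u \<longleftrightarrow>
     (AE (t, x) in lebesgue_on ({0<..} \<times> UNIV).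
        balance_at rho (\<lambda>t x. rho t x * u t x) t x \<and>
        balance_at (\<lambda>t x. rho t x * u t x) (\<lambda>t x. rho t x * (u t x)^2 + p (rho t x)) t x) \<and>
     (AE x in lebesgue.
        ((\<lambda>t. rho t x) \<longlongrightarrow> riemann_data rhoL rhoR x) (at_right 0) \<and>
        ((\<lambda>t. u t x) \<longlongrightarrow> riemann_data uL uR x) (at_right 0))"

definition self_similar :: "(real \<Rightarrow> real) \<Rightarrow> real \<Rightarrow> real \<Rightarrow> real" where
  "self_similar W t x = W (x / t)"

text \<open>
  A self-similar solution with profiles \<open>R\<close>, \<open>U\<close> that consists of the constant states
  \<open>(rhoL, uL)\<close>, \<open>(rhoM, uM)\<close>, \<open>(rhoR, uR)\<close> joined by a centred 1-wave and a centred 2-wave: within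
  a centred rarefaction wave each ray \<open>x / t = \<xi>\<close> is a characteristic of its family, i.e. \<open>\<xi>\<close> equals
  the characteristic speed \<open>u - c\<close> or \<open>u + c\<close>, where \<open>c\<close> is the sound speed, \<open>c^2 = p'(rho)\<close>.
  Either wave may be trivial (empty interval). Lipschitz continuity of the profiles
  excludes shocks; as they are constant outside a bounded interval, it amounts to local
  Lipschitz continuity of the solution for \<open>t > 0\<close>. The definition is meant for positive densities.
\<close>

definition rarefaction_solution ::
  "(real \<Rightarrow> real) \<Rightarrow> real \<Rightarrow> real \<Rightarrow> real \<Rightarrow> real \<Rightarrow> (real \<Rightarrow> real) \<Rightarrow> (real \<Rightarrow> real) \<Rightarrow> bool" where
  "rarefaction_solution p rhoL rhoR uL uR R U \<longleftrightarrow>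
     solves_riemann_1d p rhoL rhoR uL uR (self_similar R) (self_similar U) \<and>
     (\<exists>C. C-lipschitz_on UNIV R \<and> C-lipschitz_on UNIV U) \<and>
     (\<exists>\<xi>1 \<xi>2 \<xi>3 \<xi>4 rhoM uM. \<xi>1 \<le> \<xi>2 \<and> \<xi>2 \<le> \<xi>3 \<and> \<xi>3 \<le> \<xi>4 \<and>
        (\<forall>\<xi>. \<xi> \<le> \<xi>1 \<longrightarrow> R \<xi> = rhoL \<and> U \<xi> = uL) \<and>
        (\<forall>\<xi>. \<xi>1 < \<xi> \<and> \<xi> < \<xi>2 \<longrightarrow> U \<xi> - sqrt (deriv p (R \<xi>)) = \<xi>) \<and>
        (\<forall>\<xi>. \<xi>2 \<le> \<xi> \<and> \<xi> \<le> \<xi>3 \<longrightarrow> R \<xi> = rhoM \<and> U \<xi> = uM) \<and>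
        (\<forall>\<xi>. \<xi>3 < \<xi> \<and> \<xi> < \<xi>4 \<longrightarrow> U \<xi> + sqrt (deriv p (R \<xi>)) = \<xi>) \<and>
        (\<forall>\<xi>. \<xi>4 \<le> \<xi> \<longrightarrow> R \<xi> = rhoR \<and> U \<xi> = uR))"

definition essinf :: "'a measure \<Rightarrow> ('a \<Rightarrow> real) \<Rightarrow> ereal" where
  "essinf M f = - esssup M (\<lambda>x. - ereal (f x))"

subsection \<open>Bounded admissible weak solutions\<close>

definition Omega :: "real \<Rightarrow> real \<Rightarrow> (real \<times> real) set" where
  "Omega a l = {-a<..<a} \<times> {0..<l}"

text \<open>
  \<open>f\<close> is a member of \<open>C^1([0,T] \<times> closure \<Omega>)\<close> with space-time gradient \<open>G\<close>: \<open>fst (G z)\<close> is the time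
  derivative and \<open>snd (G z)\<close> the spatial gradient, one-sided at the boundary.
\<close>

definition C1_test ::
  "real \<Rightarrow> real \<Rightarrow> real \<Rightarrow> (real \<times> real \<times> real \<Rightarrow> real) \<Rightarrow>
   (real \<times> real \<times> real \<Rightarrow> real \<times> real \<times> real) \<Rightarrow> bool" where
  "C1_test T a l f G \<longleftrightarrow>
     (let S = {0..T} \<times> {-a..a} \<times> UNIV in
        (\<forall>z\<in>S. (f has_derivative (\<lambda>h. G z \<bullet> h)) (at z within S)) \<and>
        continuous_on S G \<and>
        (\<forall>t x1 x2. f (t, x1, x2 + l) = f (t, x1, x2)))"

text \<open>
  \<open>g\<close> is the weakly continuous in time representative of \<open>f\<close>: every \<open>g t\<close>, \<open>0 \<le> t \<le> T\<close>, is an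
  essentially bounded function on \<open>D\<close>, it coincides with \<open>f t\<close> for almost all \<open>t\<close>, and
  \<open>t \<mapsto> g t\<close> is weakly(-star) continuous.
\<close>

definition weakly_continuous_rep ::
  "real \<Rightarrow> 'a::euclidean_space set \<Rightarrow> (real \<Rightarrow> 'a \<Rightarrow> 'b::euclidean_space) \<Rightarrow> (real \<Rightarrow> 'a \<Rightarrow> 'b) \<Rightarrow> bool" where
  "weakly_continuous_rep T D f g \<longleftrightarrow>
     (\<forall>t\<in>{0..T}. g t \<in> borel_measurable (lebesgue_on D) \<and>
        (\<exists>C. AE x in lebesgue_on D. norm (g t x) \<le> C)) \<and>
     (AE t in lebesgue_on {0<..<T}. AE x in lebesgue_on D. g t x = f t x) \<and>
     (\<forall>\<psi>::'a \<Rightarrow> real. set_integrable lebesgue D \<psi> \<longrightarrow>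
        continuous_on {0..T} (\<lambda>t. LINT x:D|lebesgue. \<psi> x *\<^sub>R g t x))"

text \<open>In the weak formulations below, \<open>r\<close> and \<open>m\<close> stand for \<open>rho\<close> and \<open>rho u\<close> evaluated at single times.\<close>

definition weak_continuity_eq ::
  "real \<Rightarrow> real \<Rightarrow> real \<Rightarrow> real \<Rightarrow> real \<Rightarrow> real \<Rightarrow> real \<Rightarrow>
   (real \<Rightarrow> real \<times> real \<Rightarrow> real) \<Rightarrow> (real \<Rightarrow> real \<times> real \<Rightarrow> real \<times> real) \<Rightarrow>
   (real \<Rightarrow> real \<times> real \<Rightarrow> real) \<Rightarrow> bool" where
  "weak_continuity_eq T a l rhoL rhoR uL uR rho u r \<longleftrightarrow>
     (\<forall>\<tau>\<in>{0..T}. \<forall>\<phi> G. C1_test T a l \<phi> G \<longrightarrow>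
        (LINT x:Omega a l|lebesgue. r \<tau> x * \<phi> (\<tau>, x) - riemann_data rhoL rhoR (fst x) * \<phi> (0, x))
        + (LINT (t, x2):{0..\<tau>} \<times> {0..<l}|lebesgue. rhoR * uR * \<phi> (t, a, x2))
        - (LINT (t, x2):{0..\<tau>} \<times> {0..<l}|lebesgue. rhoL * uL * \<phi> (t, -a, x2))
        = (LINT (t, x):{0..\<tau>} \<times> Omega a l|lebesgue.
             rho t x * fst (G (t, x)) + (rho t x *\<^sub>R u t x) \<bullet> snd (G (t, x))))"

text \<open>
  The test field is \<open>\<phi> = (\<phi>1, \<phi>2)\<close> with gradients \<open>G1\<close>, \<open>G2\<close>. The convective term is written out as
  \<open>(u \<otimes> u) : \<nabla>\<phi> = u1 (u \<cdot> \<nabla>\<phi>1) + u2 (u \<cdot> \<nabla>\<phi>2)\<close>.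
\<close>

definition weak_momentum_eq ::
  "(real \<Rightarrow> real) \<Rightarrow> real \<Rightarrow> real \<Rightarrow> real \<Rightarrow> real \<Rightarrow> real \<Rightarrow> real \<Rightarrow> real \<Rightarrow>
   (real \<Rightarrow> real \<times> real \<Rightarrow> real) \<Rightarrow> (real \<Rightarrow> real \<times> real \<Rightarrow> real \<times> real) \<Rightarrow>
   (real \<Rightarrow> real \<times> real \<Rightarrow> real \<times> real) \<Rightarrow> bool" where
  "weak_momentum_eq p T a l rhoL rhoR uL uR rho u m \<longleftrightarrow>
     (\<forall>\<tau>\<in>{0..T}. \<forall>\<phi>1 \<phi>2 G1 G2. C1_test T a l \<phi>1 G1 \<and> C1_test T a l \<phi>2 G2 \<longrightarrow>
        (LINT x:Omega a l|lebesgue.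
            m \<tau> x \<bullet> (\<phi>1 (\<tau>, x), \<phi>2 (\<tau>, x))
            - (riemann_data rhoL rhoR (fst x) *\<^sub>R riemann_data (uL, 0) (uR, 0) (fst x))
                \<bullet> (\<phi>1 (0, x), \<phi>2 (0, x)))
        + (LINT (t, x2):{0..\<tau>} \<times> {0..<l}|lebesgue.
             ((rhoR * uR) *\<^sub>R (uR, 0)) \<bullet> (\<phi>1 (t, a, x2), \<phi>2 (t, a, x2)))
        - (LINT (t, x2):{0..\<tau>} \<times> {0..<l}|lebesgue.
             ((rhoL * uL) *\<^sub>R (uL, 0)) \<bullet> (\<phi>1 (t, -a, x2), \<phi>2 (t, -a, x2)))
        + (LINT (t, x2):{0..\<tau>} \<times> {0..<l}|lebesgue. p rhoR * \<phi>1 (t, a, x2))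
        - (LINT (t, x2):{0..\<tau>} \<times> {0..<l}|lebesgue. p rhoL * \<phi>1 (t, -a, x2))
        = (LINT (t, x):{0..\<tau>} \<times> Omega a l|lebesgue.
             (rho t x *\<^sub>R u t x) \<bullet> (fst (G1 (t, x)), fst (G2 (t, x)))
             + rho t x * (fst (u t x) * (u t x \<bullet> snd (G1 (t, x)))
                        + snd (u t x) * (u t x \<bullet> snd (G2 (t, x))))
             + p (rho t x) * (fst (snd (G1 (t, x))) + snd (snd (G2 (t, x))))))"

definition energy_inequality ::
  "(real \<Rightarrow> real) \<Rightarrow> real \<Rightarrow> real \<Rightarrow> real \<Rightarrow> real \<Rightarrow> real \<Rightarrow> real \<Rightarrow> real \<Rightarrow>
   (real \<Rightarrow> real \<times> real \<Rightarrow> real) \<Rightarrow> (real \<Rightarrow> real \<times> real \<Rightarrow> real \<times> real) \<Rightarrow> bool" where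
  "energy_inequality p T a l rhoL rhoR uL uR rho u \<longleftrightarrow>
     (AE \<tau> in lebesgue_on {0<..<T}.
        (LINT x:Omega a l|lebesgue. energy p (rho \<tau> x) (u \<tau> x))
        - (LINT x:Omega a l|lebesgue.
             energy p (riemann_data rhoL rhoR (fst x)) (riemann_data (uL, 0) (uR, 0) (fst x)))
        + (LINT (t, x2):{0..\<tau>} \<times> {0..<l}|lebesgue. (energy p rhoR (uR, 0) + p rhoR) * uR)
        - (LINT (t, x2):{0..\<tau>} \<times> {0..<l}|lebesgue. (energy p rhoL (uL, 0) + p rhoL) * uL)
        \<le> 0)"

definition bounded_admissible_weak_solution ::
  "(real \<Rightarrow> real) \<Rightarrow> real \<Rightarrow> real \<Rightarrow> real \<Rightarrow> real \<Rightarrow> real \<Rightarrow> real \<Rightarrow> real \<Rightarrow>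
   (real \<Rightarrow> real \<times> real \<Rightarrow> real) \<Rightarrow> (real \<Rightarrow> real \<times> real \<Rightarrow> real \<times> real) \<Rightarrow> bool" where
  "bounded_admissible_weak_solution p T a l rhoL rhoR uL uR rho u \<longleftrightarrow>
     (\<lambda>(t, x). rho t x) \<in> borel_measurable (lebesgue_on ({0<..<T} \<times> Omega a l)) \<and>
     (\<lambda>(t, x). u t x) \<in> borel_measurable (lebesgue_on ({0<..<T} \<times> Omega a l)) \<and>
     (\<exists>C. AE (t, x) in lebesgue_on ({0<..<T} \<times> Omega a l). \<bar>rho t x\<bar> \<le> C \<and> norm (u t x) \<le> C) \<and>
     (\<exists>r m. weakly_continuous_rep T (Omega a l) rho r \<and>
            weakly_continuous_rep T (Omega a l) (\<lambda>t x. rho t x *\<^sub>R u t x) m \<and>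
            weak_continuity_eq T a l rhoL rhoR uL uR rho u r \<and>
            weak_momentum_eq p T a l rhoL rhoR uL uR rho u m) \<and>
     energy_inequality p T a l rhoL rhoR uL uR rho u"

end

theory Submission
  imports Defs
begin

text \<open>
  The proof is the relative energy method of weak-strong uniqueness. Let \<open>R\<close>, \<open>U\<close> be the profiles of the
  rarefaction wave and measure the distance of a state \<open>(r, v)\<close> from the wave by the relative energy
  \<open>1/2 r \<bar>v - (U, 0)\<bar>\<^sup>2 + H(r) - H'(R) (r - R) - H(R)\<close>. By strict convexity of \<open>H\<close> it is nonnegative, and
  since \<open>R > 0\<close> it vanishes only if the states are equal (\<open>relative_energy_eq_0_iff\<close>). It differs from
  the energy by terms that are linear in density and momentum (\<open>relative_energy_expand\<close>), so its
  evolution follows from the energy inequality and from the weak formulation with \<open>U\<^sup>2/2 - H'(R)\<close> and \<open>U\<close>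
  as test functions. Since the wave solves the Euler system, the time derivative of its integral is at
  most the integral of

    \<open>- \<partial>x U * (r (v1 - U)\<^sup>2 + p(r) - p(R) - p'(R) (r - R))\<close>

  (\<open>entropy_production_identity\<close>). The bracket is nonnegative because the pressure is convex, and
  \<open>\<partial>x U\<close> is nonnegative because rarefaction waves are expansive (\<open>velocity_profile_expansive\<close>). Thus the
  integral of the relative energy does not increase, and as it starts from zero the weak solution
  coincides with the wave.

  Two difficulties prevent the direct use of these test functions. First, the profiles are only Lipschitz
  continuous. Their Steklov averages are continuously differentiable with derivatives that are bounded and
  converge almost everywhere, so the weak formulation extends to them (\<open>balance_law_lipschitz\<close>). The same
  device gives the fundamental theorem of calculus for Lipschitz profiles, if it is formulated as a balance
  law too. Almost everywhere differentiability of the profiles is part of the assumption that the wave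
  solves the equations almost everywhere. Second, the wave is discontinuous at \<open>t = 0\<close>. The wave is therefore
  shifted in time, i.e. functions of \<open>x1 / (t + \<epsilon>)\<close> are used. The shifted wave solves the same equations, is
  Lipschitz continuous up to \<open>t = 0\<close>, and has the right constant states at the walls as long as
  \<open>t + \<epsilon> < T\<close>. The inequality \<open>relative_energy_inequality\<close> then compares the relative energy at time \<open>\<tau>\<close>
  with an initial value that tends to zero with \<open>\<epsilon>\<close>.
\<close>

section \<open>Lebesgue integrals and null sets on product spaces\<close>

lemma set_integrable_lborel_bounded:
  fixes f :: "'a::euclidean_space \<Rightarrow> real"
  assumes "S \<in> sets borel" "bounded S" "f \<in> borel_measurable borel" "\<And>x. x \<in> S \<Longrightarrow> \<bar>f x\<bar> \<le> K"
  shows "set_integrable lborel S f"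
  unfolding set_integrable_def
proof (rule integrableI_bounded_set[of S _ _ K])
  show "emeasure lborel S < \<infinity>"
    using assms(2) by (rule emeasure_bounded_finite)
qed (use assms in \<open>auto simp: indicator_def\<close>)

lemma set_integral_tendsto_bounded:
  fixes f :: "nat \<Rightarrow> 'a::euclidean_space \<Rightarrow> real"
  assumes S: "S \<in> sets borel" "bounded S"
    and meas: "\<And>n. f n \<in> borel_measurable borel" "g \<in> borel_measurable borel"
    and lim: "AE x in lborel. x \<in> S \<longrightarrow> (\<lambda>n. f n x) \<longlonglongrightarrow> g x"
    and bound: "\<And>n x. x \<in> S \<Longrightarrow> \<bar>f n x\<bar> \<le> K"
  shows "(\<lambda>n. LINT x:S|lborel. f n x) \<longlonglongrightarrow> (LINT x:S|lborel. g x)"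
  unfolding set_lebesgue_integral_def
proof (rule integral_dominated_convergence[where w = "\<lambda>x. indicator S x *\<^sub>R K"])
  show "integrable lborel (\<lambda>x. indicator S x *\<^sub>R K)"
    using set_integrable_lborel_bounded[OF S, of "\<lambda>_. K" "\<bar>K\<bar>"]
    by (simp add: set_integrable_def)
  show "AE x in lborel. (\<lambda>n. indicator S x *\<^sub>R f n x) \<longlonglongrightarrow> indicator S x *\<^sub>R g x"
    using lim by eventually_elim (auto simp: indicator_def)
qed (use assms in \<open>auto simp: indicator_def\<close>)

lemma set_integral_lborel_Times:
  fixes f :: "'a::euclidean_space \<times> 'b::euclidean_space \<Rightarrow> real"
  assumes "set_integrable lborel (A \<times> B) f"
  shows "(LINT z:A \<times> B|lborel. f z) = (LINT x:A|lborel. LINT y:B|lborel. f (x, y))"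
    and "(LINT z:A \<times> B|lborel. f z) = (LINT y:B|lborel. LINT x:A|lborel. f (x, y))"
proof -
  let ?g = "\<lambda>x y. indicator A x * (indicator B y * f (x, y))"
  have g: "(\<lambda>(x, y). ?g x y) = (\<lambda>z. indicator (A \<times> B) z *\<^sub>R f z)"
    by (auto simp: fun_eq_iff indicator_def)
  have "integrable (lborel \<Otimes>\<^sub>M lborel) (\<lambda>(x, y). ?g x y)"
    using assms unfolding g set_integrable_def by (simp add: lborel_prod)
  then have fubini:
    "integral\<^sup>L (lborel \<Otimes>\<^sub>M lborel) (\<lambda>(x, y). ?g x y) = (LBINT x. LBINT y. ?g x y)"
    "integral\<^sup>L (lborel \<Otimes>\<^sub>M lborel) (\<lambda>(x, y). ?g x y) = (LBINT y. LBINT x. ?g x y)"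
    using lborel_pair.integral_fst[of ?g] lborel_pair.integral_snd[of ?g] by simp_all
  have "(LBINT x. ?g x y) = (LBINT x. indicator B y * (indicator A x * f (x, y)))" for y
    by (simp only: mult.left_commute)
  then have swap: "(LBINT x. ?g x y) = indicator B y * (LBINT x. indicator A x * f (x, y))" for y
    by (simp only: integral_mult_right_zero)
  have prod: "(LINT z:A \<times> B|lborel. f z) = integral\<^sup>L (lborel \<Otimes>\<^sub>M lborel) (\<lambda>(x, y). ?g x y)"
    unfolding g set_lebesgue_integral_def by (simp add: lborel_prod)
  show "(LINT z:A \<times> B|lborel. f z) = (LINT x:A|lborel. LINT y:B|lborel. f (x, y))"
    unfolding prod unfolding fubini(1) set_lebesgue_integral_def real_scaleR_def
    by (simp only: integral_mult_right_zero)
  show "(LINT z:A \<times> B|lborel. f z) = (LINT y:B|lborel. LINT x:A|lborel. f (x, y))"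
    unfolding prod unfolding fubini(2) set_lebesgue_integral_def real_scaleR_def swap ..
qed

lemma AE_lborel_scale:
  assumes "AE x in lborel. P x" and "c \<noteq> (0::real)"
  shows "AE x in lborel. P (x / c)"
proof -
  have "negligible {x. \<not> P x}"
    using assms(1) by (simp add: AE_completion_iff[where M = lborel, symmetric] completion.AE_iff_null_sets
        negligible_iff_null_sets)
  then have "negligible ((*) c ` {x. \<not> P x})"
    by (rule negligible_differentiable_image_negligible[rotated])
      (auto intro!: derivative_intros)
  also have "(*) c ` {x. \<not> P x} = {x. \<not> P (x / c)}"
    using assms(2) by (auto simp: image_iff intro!: exI[of _ "_ / c"])
  finally show ?thesis
    by (simp add: AE_completion_iff[where M = lborel, symmetric] completion.AE_iff_null_sets
        negligible_iff_null_sets)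
qed

lemma borel_measurable_fst_borel [measurable (raw)]:
  fixes f :: "'c \<Rightarrow> 'a::second_countable_topology \<times> 'b::second_countable_topology"
  assumes "f \<in> borel_measurable M"
  shows "(\<lambda>x. fst (f x)) \<in> borel_measurable M"
  using assms by (simp add: borel_prod[symmetric])

lemma borel_measurable_snd_borel [measurable (raw)]:
  fixes f :: "'c \<Rightarrow> 'a::second_countable_topology \<times> 'b::second_countable_topology"
  assumes "f \<in> borel_measurable M"
  shows "(\<lambda>x. snd (f x)) \<in> borel_measurable M"
  using assms by (simp add: borel_prod[symmetric])

lemma AE_lborel_pairI:
  fixes P :: "'a::euclidean_space \<times> 'b::euclidean_space \<Rightarrow> bool"
  assumes "{z. P z} \<in> sets borel" and "AE x in lborel. AE y in lborel. P (x, y)"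
  shows "AE z in lborel. P z"
proof -
  have "AE z in lborel \<Otimes>\<^sub>M lborel. P z"
  proof (rule lborel_pair.AE_pair_measure)
    show "{x \<in> space (lborel \<Otimes>\<^sub>M lborel). P x} \<in> sets (lborel \<Otimes>\<^sub>M lborel)"
      unfolding lborel_prod using assms(1) by simp
  qed (rule assms(2))
  then show ?thesis
    unfolding lborel_prod .
qed

lemma AE_lborel_fst_neq:
  "AE z in (lborel :: (real \<times> 'b::euclidean_space) measure). fst z \<noteq> c"
proof (rule AE_lborel_pairI)
  have "AE t in lborel. t \<noteq> c"
    by (rule AE_lborel_singleton)
  then show "AE t in lborel. AE y in (lborel :: 'b measure). fst (t, y) \<noteq> c"
    by eventually_elim simp
qed measurable

text \<open>
  For null sets, completeness does no harm in one direction of Fubini's theorem: a null set is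
  contained in a Borel null set, whose slices are almost all null.
\<close>

lemma AE_lebesgue_on_slices:
  fixes A :: "'a::euclidean_space set" and B :: "'b::euclidean_space set"
  assumes "AE z in lebesgue_on (A \<times> B). P z" and [measurable]: "A \<in> sets borel" "B \<in> sets borel"
  shows "AE x in lborel. x \<in> A \<longrightarrow> (AE y in lborel. y \<in> B \<longrightarrow> P (x, y))"
proof -
  have "A \<times> B \<in> sets borel"
    by (rule borel_Times) measurable
  then have "AE z in lborel. z \<in> A \<times> B \<longrightarrow> P z"
    using assms(1) by (simp add: AE_restrict_space_iff AE_completion_iff)
  then have "AE z in lborel \<Otimes>\<^sub>M lborel. z \<in> A \<times> B \<longrightarrow> P z"
    unfolding lborel_prod .
  from lborel_pair.AE_pair[OF this] show ?thesis
    by eventually_elim auto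
qed

lemma AE_lborel_greaterThanLessThan_ex:
  fixes a b :: real
  assumes "AE t in lborel. t \<in> {a<..<b} \<longrightarrow> P t" and "a < b"
  shows "\<exists>t\<in>{a<..<b}. P t"
proof (rule ccontr)
  assume neg: "\<not> ?thesis"
  from assms(1) have "AE t in lborel. t \<notin> {a<..<b}"
    by eventually_elim (use neg in blast)
  then have "emeasure lborel {a<..<b} = 0"
    by (subst (asm) AE_iff_measurable[of "{a<..<b}"]) auto
  then show False
    using assms(2) by (simp add: ennreal_eq_0_iff)
qed

lemma borel_measurable_lebesgue_AE_cong:
  fixes f g :: "'a::euclidean_space \<Rightarrow> 'b::topological_space"
  assumes g: "g \<in> borel_measurable lebesgue" and ae: "AE x in lborel. f x = g x"
  shows "f \<in> borel_measurable lebesgue"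
proof (rule borel_measurableI)
  fix A :: "'b set" assume "open A"
  then have A: "g -` A \<inter> space lebesgue \<in> sets lebesgue"
    using g by (intro measurable_sets) auto
  have "AE x in lebesgue. x \<in> g -` A \<inter> space lebesgue \<longleftrightarrow> x \<in> f -` A \<inter> space lebesgue"
    using AE_completion[OF ae] by eventually_elim auto
  then show "f -` A \<inter> space lebesgue \<in> sets lebesgue"
    by (rule completion.in_sets_AE[OF _ A]) simp
qed

text \<open>
  Statements about a weak solution concern Lebesgue measurable functions and the completed measure.
  A Borel function that agrees with the integrand almost everywhere moves the integral to
  \<open>lborel\<close>, where the product of the factors is again \<open>lborel\<close> and Fubini's theorem applies.
\<close>

lemma set_integral_lebesgue_eq_lborel:
  fixes f g :: "'a::euclidean_space \<Rightarrow> real"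
  assumes g: "g \<in> borel_measurable borel" and S [measurable]: "S \<in> sets borel"
    and ae: "AE x in lborel. x \<in> S \<longrightarrow> f x = g x"
  shows "(LINT x:S|lebesgue. f x) = (LINT x:S|lborel. g x)"
proof -
  let ?f = "\<lambda>x. indicator S x *\<^sub>R f x" and ?g = "\<lambda>x. indicator S x *\<^sub>R g x"
  have g': "?g \<in> borel_measurable lborel"
    using g by simp
  have eq: "AE x in lborel. ?f x = ?g x"
    using ae by eventually_elim (simp add: indicator_def)
  have g'': "?g \<in> borel_measurable lebesgue"
    using g' by (rule measurable_completion)
  have "integral\<^sup>L lebesgue ?f = integral\<^sup>L lebesgue ?g"
    by (rule integral_cong_AE[OF borel_measurable_lebesgue_AE_cong[OF g'' eq] g'' AE_completion[OF eq]])
  also have "\<dots> = integral\<^sup>L lborel ?g"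
    using g' by (rule integral_completion)
  finally show ?thesis
    by (simp only: set_lebesgue_integral_def)
qed

lemma bounded_borel_representative:
  fixes f :: "'a::euclidean_space \<Rightarrow> real"
  assumes f: "f \<in> borel_measurable (lebesgue_on S)" and S: "S \<in> sets borel"
    and bound: "AE z in lebesgue_on S. b \<le> f z \<and> f z \<le> c" and bc: "b \<le> c"
  obtains g where "g \<in> borel_measurable borel" "\<And>z. b \<le> g z" "\<And>z. g z \<le> c"
    and "AE z in lborel. z \<in> S \<longrightarrow> f z = g z"
proof -
  have S': "S \<in> sets lebesgue"
    using S by simp
  have "(\<lambda>z. if z \<in> S then f z else 0) \<in> borel_measurable lebesgue"
    using f borel_measurable_if[OF S'] by blast
  then obtain g where g: "g \<in> borel_measurable lborel"
    "AE z in lborel. (if z \<in> S then f z else 0) = g z"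
    using completion_ex_borel_measurable_real by blast
  have "AE z in lborel. z \<in> S \<longrightarrow> b \<le> f z \<and> f z \<le> c"
    using bound S' by (simp add: AE_restrict_space_iff AE_completion_iff imp_conjR)
  with g(2) have "AE z in lborel. z \<in> S \<longrightarrow> f z = max b (min c (g z))"
    by eventually_elim auto
  then show ?thesis
    using g(1) bc by (intro that[of "\<lambda>z. max b (min c (g z))"]) auto
qed

section \<open>Lipschitz functions and their Steklov averages\<close>

definition forward_quotient :: "(real \<Rightarrow> real) \<Rightarrow> nat \<Rightarrow> real \<Rightarrow> real" where
  "forward_quotient F n x = real (Suc n) * (F (x + 1 / real (Suc n)) - F x)"

text \<open>
  A limit of forward quotients is a Borel function, and it equals the derivative wherever that exists.
  For a Lipschitz function that is differentiable almost everywhere it serves as the derivative in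
  integrals; its values elsewhere are arbitrary.
\<close>

definition slope :: "(real \<Rightarrow> real) \<Rightarrow> real \<Rightarrow> real" where
  "slope F x = lim (\<lambda>n. forward_quotient F n x)"

lemma forward_quotient_tendsto:
  assumes "(F has_real_derivative D) (at x)"
  shows "(\<lambda>n. forward_quotient F n x) \<longlonglongrightarrow> D"
proof -
  have "((\<lambda>h. (F (x + h) - F x) / h) \<longlongrightarrow> D) (at 0)"
    using assms by (simp add: DERIV_def)
  moreover have "filterlim (\<lambda>n. 1 / real (Suc n)) (at 0) sequentially"
    unfolding filterlim_at
    using LIMSEQ_inverse_real_of_nat by (auto simp: inverse_eq_divide)
  ultimately have "(\<lambda>n. (F (x + 1 / real (Suc n)) - F x) / (1 / real (Suc n))) \<longlonglongrightarrow> D"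
    by (rule filterlim_compose)
  then show ?thesis
    by (simp add: forward_quotient_def mult.commute)
qed

lemma slope_eq:
  assumes "(F has_real_derivative D) (at x)"
  shows "slope F x = D"
  unfolding slope_def using forward_quotient_tendsto[OF assms] by (rule limI)

lemma continuous_on_forward_quotient:
  assumes "continuous_on UNIV F"
  shows "continuous_on UNIV (forward_quotient F n)"
  unfolding forward_quotient_def
  by (intro continuous_intros continuous_on_compose2[OF assms]) auto

lemma borel_measurable_slope:
  assumes "continuous_on UNIV F"
  shows "slope F \<in> borel_measurable borel"
  unfolding slope_def
  by (intro borel_measurable_lim_metric borel_measurable_continuous_onI
        continuous_on_forward_quotient assms)

lemma abs_forward_quotient_le:
  assumes "L-lipschitz_on UNIV F"
  shows "\<bar>forward_quotient F n x\<bar> \<le> L"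
proof -
  have "\<bar>F (x + 1 / real (Suc n)) - F x\<bar> \<le> L * (1 / real (Suc n))"
    using lipschitz_onD[OF assms, of "x + 1 / real (Suc n)" x] by (simp add: dist_real_def)
  then have "real (Suc n) * \<bar>F (x + 1 / real (Suc n)) - F x\<bar> \<le> L"
    by (simp add: field_simps)
  then show ?thesis
    by (simp add: forward_quotient_def abs_mult)
qed

text \<open>
  The average of \<open>F\<close> over \<open>[x, x + 1/(n+1)]\<close> is continuously differentiable, and its derivative is
  the forward quotient of \<open>F\<close>. Hence the derivatives of these averages are bounded by the Lipschitz
  constant and converge wherever \<open>F\<close> is differentiable, which is what dominated convergence needs.
\<close>

lemma steklov_average:
  assumes F: "L-lipschitz_on UNIV F"
  obtains Fn where "\<And>n x. (Fn n has_real_derivative forward_quotient F n x) (at x)"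
    and "\<And>n x. \<bar>Fn n x - F x\<bar> \<le> L / real (Suc n)"
proof -
  have cont: "continuous_on UNIV F"
    using F by (rule lipschitz_on_continuous_on)
  then have "isCont F x" for x
    by (simp add: continuous_on_eq_continuous_at)
  then obtain G where G: "\<And>x. (G has_vector_derivative F x) (at x)"
    using einterval_antiderivative[of "-\<infinity>" "\<infinity>" F] by auto
  then have G': "(G has_real_derivative F x) (at x)" for x
    by (simp add: has_real_derivative_iff_has_vector_derivative)
  define Fn where "Fn n x = real (Suc n) * (G (x + 1 / real (Suc n)) - G x)" for n x
  show ?thesis
  proof
    fix n x
    have "((\<lambda>y. G (y + 1 / real (Suc n))) has_real_derivative F (x + 1 / real (Suc n))) (at x)"
      using G'[of "x + 1 / real (Suc n)"] by (simp add: DERIV_shift)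
    then show "(Fn n has_real_derivative forward_quotient F n x) (at x)"
      unfolding Fn_def forward_quotient_def
      by (intro DERIV_cmult DERIV_diff G')
    have "\<exists>z. x < z \<and> z < x + 1 / real (Suc n) \<and>
        G (x + 1 / real (Suc n)) - G x = (x + 1 / real (Suc n) - x) * F z"
      by (rule MVT2) (auto intro: G')
    then obtain z where z: "x < z" "z < x + 1 / real (Suc n)"
      "G (x + 1 / real (Suc n)) - G x = (1 / real (Suc n)) * F z"
      by auto
    then have "Fn n x = F z"
      by (simp add: Fn_def del: of_nat_Suc)
    moreover have "\<bar>F z - F x\<bar> \<le> L * \<bar>z - x\<bar>"
      using lipschitz_onD[OF F, of z x] by (simp add: dist_real_def)
    moreover have "L * \<bar>z - x\<bar> \<le> L * (1 / real (Suc n))"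
      using z lipschitz_on_nonneg[OF F] by (intro mult_left_mono) auto
    ultimately show "\<bar>Fn n x - F x\<bar> \<le> L / real (Suc n)"
      by simp
  qed
qed

lemma continuous_on_Icc_bounded:
  fixes f :: "real \<Rightarrow> real"
  assumes "continuous_on {b..c} f"
  obtains K where "\<And>x. x \<in> {b..c} \<Longrightarrow> \<bar>f x\<bar> \<le> K"
proof -
  have "bounded (f ` {b..c})"
    using assms by (intro compact_imp_bounded compact_continuous_image) auto
  then obtain K where K: "\<forall>y\<in>f ` {b..c}. norm y \<le> K"
    unfolding bounded_iff by blast
  show ?thesis
    by (rule that[of K]) (use K in simp)
qed

lemma lipschitz_on_compose_deriv_bounded:
  fixes F g g' :: "real \<Rightarrow> real"
  assumes F: "L-lipschitz_on UNIV F" and range: "\<And>x. F x \<in> {c..d}"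
    and g: "\<And>y. y \<in> {c..d} \<Longrightarrow> (g has_real_derivative g' y) (at y)"
    and g': "continuous_on {c..d} g'"
  obtains B where "B-lipschitz_on UNIV (\<lambda>x. g (F x))"
proof -
  obtain K where K: "\<And>y. y \<in> {c..d} \<Longrightarrow> \<bar>g' y\<bar> \<le> K"
    using continuous_on_Icc_bounded[OF g'] by blast
  have "K \<ge> 0"
    using K[OF range[of 0]] by linarith
  have "K-lipschitz_on {c..d} g"
  proof (rule bounded_derivative_imp_lipschitz)
    show "(g has_derivative (*) (g' y)) (at y within {c..d})" if "y \<in> {c..d}" for y
      using g[OF that] by (simp add: has_field_derivative_def has_derivative_at_withinI)
    show "onorm ((*) (g' y)) \<le> K" if "y \<in> {c..d}" for y
      using K[OF that] by (intro onorm_le) (auto simp: abs_mult mult_right_mono)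
  qed (auto simp: \<open>K \<ge> 0\<close>)
  then have "(K * L)-lipschitz_on UNIV (\<lambda>x. g (F x))"
    using F range by (intro lipschitz_on_compose2) (auto intro: lipschitz_on_subset)
  then show ?thesis ..
qed

lemma lipschitz_on_mult_bounded:
  fixes F G :: "real \<Rightarrow> real"
  assumes F: "L-lipschitz_on UNIV F" and G: "K-lipschitz_on UNIV G"
    and "\<And>x. \<bar>F x\<bar> \<le> B" and "\<And>x. \<bar>G x\<bar> \<le> B"
  shows "(B * L + B * K)-lipschitz_on UNIV (\<lambda>x. F x * G x)"
proof (rule lipschitz_onI)
  fix x y
  have "F x * G x - F y * G y = G x * (F x - F y) + F y * (G x - G y)"
    by (simp add: algebra_simps)
  then have "\<bar>F x * G x - F y * G y\<bar> \<le> \<bar>G x\<bar> * \<bar>F x - F y\<bar> + \<bar>F y\<bar> * \<bar>G x - G y\<bar>"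
    by (metis abs_mult abs_triangle_ineq)
  also have "\<dots> \<le> B * (L * \<bar>x - y\<bar>) + B * (K * \<bar>x - y\<bar>)"
    using lipschitz_onD[OF F, of x y] lipschitz_onD[OF G, of x y] assms(3,4)[of x] assms(3)[of y]
    by (intro add_mono mult_mono) (auto simp: dist_real_def)
  finally show "dist (F x * G x) (F y * G y) \<le> (B * L + B * K) * dist x y"
    by (simp add: dist_real_def algebra_simps)
next
  have "B \<ge> 0"
    using assms(3)[of 0] by linarith
  then show "0 \<le> B * L + B * K"
    using lipschitz_on_nonneg[OF F] lipschitz_on_nonneg[OF G] by simp
qed

text \<open>
  The class of profiles that are admitted as test functions of the similarity variable.
\<close>

definition bounded_lipschitz :: "(real \<Rightarrow> real) \<Rightarrow> bool" where
  "bounded_lipschitz F \<longleftrightarrow> (\<exists>L. L-lipschitz_on UNIV F) \<and> (\<exists>K. \<forall>x. \<bar>F x\<bar> \<le> K)"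

lemma bounded_lipschitz_mult:
  assumes "bounded_lipschitz F" "bounded_lipschitz G"
  shows "bounded_lipschitz (\<lambda>x. F x * G x)"
proof -
  obtain L K where F: "L-lipschitz_on UNIV F" "\<And>x. \<bar>F x\<bar> \<le> K"
    using assms(1) by (auto simp: bounded_lipschitz_def)
  obtain L' K' where G: "L'-lipschitz_on UNIV G" "\<And>x. \<bar>G x\<bar> \<le> K'"
    using assms(2) by (auto simp: bounded_lipschitz_def)
  have "\<bar>F x\<bar> \<le> max K K'" "\<bar>G x\<bar> \<le> max K K'" for x
    using F(2) G(2) by (simp_all add: le_max_iff_disj)
  then have "(max K K' * L + max K K' * L')-lipschitz_on UNIV (\<lambda>x. F x * G x)"
    by (rule lipschitz_on_mult_bounded[OF F(1) G(1)])
  moreover have "\<bar>F x * G x\<bar> \<le> K * K'" for x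
    unfolding abs_mult using order_trans[OF abs_ge_zero F(2)]
    by (intro mult_mono F G) auto
  ultimately show ?thesis
    by (auto simp: bounded_lipschitz_def)
qed

lemma bounded_lipschitz_diff:
  assumes "bounded_lipschitz F" "bounded_lipschitz G"
  shows "bounded_lipschitz (\<lambda>x. F x - G x)"
proof -
  obtain L K where F: "L-lipschitz_on UNIV F" "\<And>x. \<bar>F x\<bar> \<le> K"
    using assms(1) by (auto simp: bounded_lipschitz_def)
  obtain L' K' where G: "L'-lipschitz_on UNIV G" "\<And>x. \<bar>G x\<bar> \<le> K'"
    using assms(2) by (auto simp: bounded_lipschitz_def)
  have "(L + L')-lipschitz_on UNIV (\<lambda>x. F x - G x)"
    by (rule lipschitz_on_diff[OF F(1) G(1)])
  moreover have "\<bar>F x - G x\<bar> \<le> K + K'" for x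
    using F(2)[of x] G(2)[of x] by linarith
  ultimately show ?thesis
    unfolding bounded_lipschitz_def by blast
qed

lemma bounded_lipschitz_compose:
  fixes F g g' :: "real \<Rightarrow> real"
  assumes F: "L-lipschitz_on UNIV F" and range: "\<And>x. F x \<in> {c..d}"
    and g: "\<And>y. y \<in> {c..d} \<Longrightarrow> (g has_real_derivative g' y) (at y)"
    and g': "continuous_on {c..d} g'"
  shows "bounded_lipschitz (\<lambda>x. g (F x))"
proof -
  obtain B where B: "B-lipschitz_on UNIV (\<lambda>x. g (F x))"
    by (rule lipschitz_on_compose_deriv_bounded[OF F range g g'])
  have "continuous_on {c..d} g"
    by (intro continuous_at_imp_continuous_on ballI DERIV_isCont[OF g])
  then obtain K where "\<And>y. y \<in> {c..d} \<Longrightarrow> \<bar>g y\<bar> \<le> K"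
    using continuous_on_Icc_bounded by blast
  then have "\<bar>g (F x)\<bar> \<le> K" for x
    using range .
  with B show ?thesis
    unfolding bounded_lipschitz_def by blast
qed

lemma borel_measurable_bounded_lipschitz:
  "bounded_lipschitz F \<Longrightarrow> F \<in> borel_measurable borel"
  unfolding bounded_lipschitz_def
  by (auto intro: borel_measurable_continuous_onI lipschitz_on_continuous_on)

section \<open>Balance laws tested along rays\<close>

text \<open>
  The similarity variable \<open>x1 / (t + \<epsilon>)\<close> of a solution that is started at time \<open>- \<epsilon>\<close>. The shift makes
  functions of this variable regular up to \<open>t = 0\<close>, where functions of \<open>x1 / t\<close> jump.
\<close>

definition ray :: "real \<Rightarrow> real \<times> real \<times> real \<Rightarrow> real" where
  "ray \<epsilon> z = fst (snd z) / (fst z + \<epsilon>)"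

lemma borel_measurable_ray [measurable]: "ray \<epsilon> \<in> borel_measurable borel"
  unfolding ray_def by measurable

text \<open>
  At every fixed time the similarity variable is a multiple of \<open>x1\<close>, so preimages of null sets are
  null in each time slice. This transfers almost everywhere properties of profiles to space-time.
\<close>

lemma AE_ray:
  assumes P: "AE x in lborel. P x" and \<epsilon>: "\<epsilon> > 0"
  shows "AE z in lborel. fst z \<ge> 0 \<longrightarrow> P (ray \<epsilon> z)"
proof -
  obtain N where N: "{x. \<not> P x} \<subseteq> N" "N \<in> null_sets lborel"
    using P by (auto simp: eventually_ae_filter)
  then have [measurable]: "N \<in> sets borel"
    by auto
  have ae: "AE x in lborel. x \<notin> N"
    using N(2) by (rule AE_not_in)
  have "AE z in lborel. fst z \<ge> 0 \<longrightarrow> ray \<epsilon> z \<notin> N"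
  proof (rule AE_lborel_pairI)
    have slice: "AE y in (lborel :: (real \<times> real) measure). fst y / (t + \<epsilon>) \<notin> N" if "t \<ge> 0" for t
    proof (rule AE_lborel_pairI)
      have "AE x in lborel. x / (t + \<epsilon>) \<notin> N"
        using ae by (rule AE_lborel_scale) (use that \<epsilon> in simp)
      then show "AE x in lborel. AE y in (lborel :: real measure). fst (x, y) / (t + \<epsilon>) \<notin> N"
        by eventually_elim simp
    qed measurable
    have "AE y in lborel. 0 \<le> fst (t, y) \<longrightarrow> ray \<epsilon> (t, y) \<notin> N" for t
      using slice[of t] by (cases "t \<ge> 0") (simp_all add: ray_def)
    then show "AE t in lborel. AE y in lborel. 0 \<le> fst (t, y) \<longrightarrow> ray \<epsilon> (t, y) \<notin> N"
      by (rule AE_I2)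
  qed measurable
  then show ?thesis
    by eventually_elim (use N(1) in auto)
qed

text \<open>
  A scalar balance law \<open>\<partial>t \<alpha> + \<partial>x \<beta> = 0\<close> in weak form, tested with \<open>F (x1 / (t + \<epsilon>))\<close>. The functions
  \<open>A\<close>, \<open>B\<close> are the density at the times \<open>\<tau>\<close> and \<open>0\<close>, the numbers \<open>cL\<close>, \<open>cR\<close> the fluxes at \<open>x1 = - a\<close> and
  \<open>x1 = a\<close>. By the chain rule the time and space derivatives of the test function are
  \<open>- ray \<epsilon> z * F' (ray \<epsilon> z) / (t + \<epsilon>)\<close> and \<open>F' (ray \<epsilon> z) / (t + \<epsilon>)\<close>, which gives the integrand on the
  right. The derivative is a separate argument because it exists only almost everywhere for the
  profiles of interest.
\<close>

definition balance_law ::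
  "real \<Rightarrow> real \<Rightarrow> real \<Rightarrow> real \<Rightarrow> (real \<times> real \<Rightarrow> real) \<Rightarrow> (real \<times> real \<Rightarrow> real) \<Rightarrow> real \<Rightarrow> real \<Rightarrow>
   (real \<times> real \<times> real \<Rightarrow> real) \<Rightarrow> (real \<times> real \<times> real \<Rightarrow> real) \<Rightarrow> (real \<Rightarrow> real) \<Rightarrow> (real \<Rightarrow> real) \<Rightarrow> bool"
where
  "balance_law \<tau> a l \<epsilon> A B cL cR \<alpha> \<beta> F F' \<longleftrightarrow>
     (LINT x:Omega a l|lborel. A x * F (fst x / (\<tau> + \<epsilon>)) - B x * F (fst x / \<epsilon>))
     + (LINT y:{0..\<tau>} \<times> {0..<l}|lborel. cR * F (a / (fst y + \<epsilon>)))
     - (LINT y:{0..\<tau>} \<times> {0..<l}|lborel. cL * F (- a / (fst y + \<epsilon>)))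
     = (LINT z:{0..\<tau>} \<times> Omega a l|lborel.
          (\<beta> z - ray \<epsilon> z * \<alpha> z) * (F' (ray \<epsilon> z) / (fst z + \<epsilon>)))"

lemma Omega_borel [measurable]: "Omega a l \<in> sets borel"
  unfolding Omega_def by (intro borel_Times) auto

lemma bounded_Omega: "bounded (Omega a l)"
  unfolding Omega_def by (intro bounded_Times) auto

lemma slab_borel [measurable]: "{0..\<tau>::real} \<times> Omega a l \<in> sets borel"
  by (intro borel_Times) auto

lemma bounded_slab: "bounded ({0..\<tau>::real} \<times> Omega a l)"
  by (intro bounded_Times bounded_Omega) auto

lemma wall_borel [measurable]: "{0..\<tau>::real} \<times> {0..<l::real} \<in> sets borel"
  by (intro borel_Times) auto

lemma bounded_wall: "bounded ({0..\<tau>::real} \<times> {0..<l::real})"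
  by (intro bounded_Times) auto

lemma ray_bound:
  assumes "z \<in> {0..\<tau>} \<times> Omega a l" "\<epsilon> > 0"
  shows "\<bar>ray \<epsilon> z\<bar> \<le> a / \<epsilon>"
proof -
  have z: "0 \<le> fst z" "\<bar>fst (snd z)\<bar> \<le> a"
    using assms(1) by (auto simp: Omega_def mem_Times_iff)
  then have "\<bar>fst (snd z)\<bar> / (fst z + \<epsilon>) \<le> a / \<epsilon>"
    using assms(2) by (intro frac_le) auto
  then show ?thesis
    using z(1) assms(2) by (simp add: ray_def abs_divide)
qed

text \<open>
  The profiles of a rarefaction wave have corners, so they are not test functions themselves. The law
  holds for their Steklov averages and passes to the limit term by term by dominated convergence.
\<close>

lemma balance_law_lipschitz:
  assumes pos: "\<epsilon> > 0"
    and meas [measurable]: "A \<in> borel_measurable borel" "B \<in> borel_measurable borel"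
      "\<alpha> \<in> borel_measurable borel" "\<beta> \<in> borel_measurable borel"
    and bound: "\<And>x. \<bar>A x\<bar> \<le> C" "\<And>x. \<bar>B x\<bar> \<le> C" "\<And>z. \<bar>\<alpha> z\<bar> \<le> C" "\<And>z. \<bar>\<beta> z\<bar> \<le> C"
    and law: "\<And>F F'. (\<And>x. (F has_real_derivative F' x) (at x)) \<Longrightarrow> continuous_on UNIV F' \<Longrightarrow>
      balance_law \<tau> a l \<epsilon> A B cL cR \<alpha> \<beta> F F'"
    and lip: "bounded_lipschitz F"
    and diff: "AE x in lborel. \<exists>D. (F has_real_derivative D) (at x)"
  shows "balance_law \<tau> a l \<epsilon> A B cL cR \<alpha> \<beta> F (slope F)"
proof -
  obtain L K where F: "L-lipschitz_on UNIV F" "\<And>x. \<bar>F x\<bar> \<le> K"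
    using lip by (auto simp: bounded_lipschitz_def)
  obtain Fn where Fn': "\<And>n x. (Fn n has_real_derivative forward_quotient F n x) (at x)"
    and close: "\<And>n x. \<bar>Fn n x - F x\<bar> \<le> L / real (Suc n)"
    using steklov_average[OF F(1)] by blast
  have L: "L \<ge> 0"
    using F(1) by (rule lipschitz_on_nonneg)
  have C: "C \<ge> 0"
    using bound(1)[of undefined] by linarith
  have cont: "continuous_on UNIV F"
    using F(1) by (rule lipschitz_on_continuous_on)
  have [measurable]: "F \<in> borel_measurable borel"
    using cont by (rule borel_measurable_continuous_onI)
  have Fn_meas: "Fn n \<in> borel_measurable borel" for n
    by (intro borel_measurable_continuous_onI continuous_at_imp_continuous_on ballI DERIV_isCont[OF Fn'])
  have fq_meas: "forward_quotient F n \<in> borel_measurable borel" for n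
    by (intro borel_measurable_continuous_onI continuous_on_forward_quotient cont)
  have [measurable]: "slope F \<in> borel_measurable borel"
    using cont by (rule borel_measurable_slope)
  have lim: "(\<lambda>n. Fn n x) \<longlonglongrightarrow> F x" for x
  proof (rule LIM_zero_cancel, rule Lim_null_comparison)
    show "\<forall>\<^sub>F n in sequentially. norm (Fn n x - F x) \<le> L * inverse (real (Suc n))"
      using close unfolding divide_inverse real_norm_def by (intro always_eventually allI)
    show "(\<lambda>n. L * inverse (real (Suc n))) \<longlonglongrightarrow> 0"
      using tendsto_mult_right_zero[OF LIMSEQ_inverse_real_of_nat] .
  qed
  have Fn_bound: "\<bar>Fn n x\<bar> \<le> K + L" for n x
  proof -
    have "L / real (Suc n) \<le> L / 1"
      by (rule divide_left_mono) (use L in simp_all)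
    then show ?thesis
      using close[of n x] F(2)[of x] by linarith
  qed
  have KL: "K + L \<ge> 0"
    using Fn_bound[of 0 0] by linarith
  have "balance_law \<tau> a l \<epsilon> A B cL cR \<alpha> \<beta> (Fn n) (forward_quotient F n)" for n
    using Fn' by (rule law) (rule continuous_on_forward_quotient[OF cont])
  note approx = this[unfolded balance_law_def]
  have init: "(\<lambda>n. LINT x:Omega a l|lborel. A x * Fn n (fst x / (\<tau> + \<epsilon>)) - B x * Fn n (fst x / \<epsilon>))
      \<longlonglongrightarrow> (LINT x:Omega a l|lborel. A x * F (fst x / (\<tau> + \<epsilon>)) - B x * F (fst x / \<epsilon>))"
  proof (rule set_integral_tendsto_bounded)
    show "AE x in lborel. x \<in> Omega a l \<longrightarrow>
        (\<lambda>n. A x * Fn n (fst x / (\<tau> + \<epsilon>)) - B x * Fn n (fst x / \<epsilon>))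
          \<longlonglongrightarrow> A x * F (fst x / (\<tau> + \<epsilon>)) - B x * F (fst x / \<epsilon>)"
      by (rule AE_I2, rule impI, rule tendsto_diff; rule tendsto_mult[OF tendsto_const lim])
    show "\<bar>A x * Fn n (fst x / (\<tau> + \<epsilon>)) - B x * Fn n (fst x / \<epsilon>)\<bar> \<le> C * (K + L) + C * (K + L)" for n x
    proof -
      have "\<bar>A x * Fn n (fst x / (\<tau> + \<epsilon>))\<bar> \<le> C * (K + L)"
        unfolding abs_mult by (intro mult_mono bound Fn_bound C) auto
      moreover have "\<bar>B x * Fn n (fst x / \<epsilon>)\<bar> \<le> C * (K + L)"
        unfolding abs_mult by (intro mult_mono bound Fn_bound C) auto
      ultimately show ?thesis
        by linarith
    qed
    show "(\<lambda>x. A x * Fn n (fst x / (\<tau> + \<epsilon>)) - B x * Fn n (fst x / \<epsilon>)) \<in> borel_measurable borel" for n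
    proof -
      note [measurable] = Fn_meas[of n]
      show ?thesis by measurable
    qed
  qed (measurable, rule bounded_Omega, measurable)
  have wall: "(\<lambda>n. LINT y:{0..\<tau>} \<times> {0..<l}|lborel. c * Fn n (b / (fst y + \<epsilon>)))
      \<longlonglongrightarrow> (LINT y:{0..\<tau>} \<times> {0..<l}|lborel. c * F (b / (fst y + \<epsilon>)))" for b c
  proof (rule set_integral_tendsto_bounded)
    show "AE x in lborel. x \<in> {0..\<tau>} \<times> {0..<l} \<longrightarrow>
        (\<lambda>n. c * Fn n (b / (fst x + \<epsilon>))) \<longlonglongrightarrow> c * F (b / (fst x + \<epsilon>))"
      by (rule AE_I2, rule impI, rule tendsto_mult[OF tendsto_const lim])
    show "\<bar>c * Fn n (b / (fst y + \<epsilon>))\<bar> \<le> \<bar>c\<bar> * (K + L)" for n and y :: "real \<times> real"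
      unfolding abs_mult by (intro mult_left_mono Fn_bound) auto
    show "(\<lambda>y::real \<times> real. c * Fn n (b / (fst y + \<epsilon>))) \<in> borel_measurable borel" for n
    proof -
      note [measurable] = Fn_meas[of n]
      show ?thesis by measurable
    qed
  qed (measurable, rule bounded_wall, measurable)
  have bulk: "(\<lambda>n. LINT z:{0..\<tau>} \<times> Omega a l|lborel.
        (\<beta> z - ray \<epsilon> z * \<alpha> z) * (forward_quotient F n (ray \<epsilon> z) / (fst z + \<epsilon>)))
      \<longlonglongrightarrow> (LINT z:{0..\<tau>} \<times> Omega a l|lborel.
        (\<beta> z - ray \<epsilon> z * \<alpha> z) * (slope F (ray \<epsilon> z) / (fst z + \<epsilon>)))"
  proof (rule set_integral_tendsto_bounded)
    have "AE x in lborel. (\<lambda>n. forward_quotient F n x) \<longlonglongrightarrow> slope F x"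
      using diff
    proof eventually_elim
      case (elim x)
      then obtain D where D: "(F has_real_derivative D) (at x)" ..
      show ?case
        using forward_quotient_tendsto[OF D] by (simp add: slope_eq[OF D])
    qed
    then have "AE z in lborel. fst z \<ge> 0 \<longrightarrow>
        (\<lambda>n. forward_quotient F n (ray \<epsilon> z)) \<longlonglongrightarrow> slope F (ray \<epsilon> z)"
      using pos by (rule AE_ray)
    then show "AE z in lborel. z \<in> {0..\<tau>} \<times> Omega a l \<longrightarrow>
        (\<lambda>n. (\<beta> z - ray \<epsilon> z * \<alpha> z) * (forward_quotient F n (ray \<epsilon> z) / (fst z + \<epsilon>)))
          \<longlonglongrightarrow> (\<beta> z - ray \<epsilon> z * \<alpha> z) * (slope F (ray \<epsilon> z) / (fst z + \<epsilon>))"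
    proof eventually_elim
      case (elim z)
      show ?case
      proof
        assume "z \<in> {0..\<tau>} \<times> Omega a l"
        then have "fst z \<ge> 0"
          by (auto simp: mem_Times_iff)
        with elim pos show "(\<lambda>n. (\<beta> z - ray \<epsilon> z * \<alpha> z) * (forward_quotient F n (ray \<epsilon> z) / (fst z + \<epsilon>)))
          \<longlonglongrightarrow> (\<beta> z - ray \<epsilon> z * \<alpha> z) * (slope F (ray \<epsilon> z) / (fst z + \<epsilon>))"
          by (intro tendsto_intros) auto
      qed
    qed
    show "\<bar>(\<beta> z - ray \<epsilon> z * \<alpha> z) * (forward_quotient F n (ray \<epsilon> z) / (fst z + \<epsilon>))\<bar>
        \<le> (C + a / \<epsilon> * C) * (L / \<epsilon>)" if z: "z \<in> {0..\<tau>} \<times> Omega a l" for n z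
    proof -
      have t: "fst z \<ge> 0"
        using z by (auto simp: mem_Times_iff)
      have a: "0 \<le> a / \<epsilon>"
        using ray_bound[OF z pos] by linarith
      have "\<bar>ray \<epsilon> z * \<alpha> z\<bar> \<le> a / \<epsilon> * C"
        unfolding abs_mult by (intro mult_mono ray_bound[OF z pos] bound a) auto
      then have "\<bar>\<beta> z - ray \<epsilon> z * \<alpha> z\<bar> \<le> C + a / \<epsilon> * C"
        using bound(4)[of z] by linarith
      moreover have "\<bar>forward_quotient F n (ray \<epsilon> z) / (fst z + \<epsilon>)\<bar> \<le> L / \<epsilon>"
        unfolding abs_divide using t pos L abs_forward_quotient_le[OF F(1)]
        by (intro frac_le) auto
      moreover have "0 \<le> C + a / \<epsilon> * C"
        by (intro add_nonneg_nonneg mult_nonneg_nonneg a C)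
      ultimately show ?thesis
        unfolding abs_mult by (intro mult_mono) (auto simp only: abs_ge_zero)
    qed
    show "(\<lambda>z. (\<beta> z - ray \<epsilon> z * \<alpha> z) * (forward_quotient F n (ray \<epsilon> z) / (fst z + \<epsilon>))) \<in> borel_measurable borel" for n
    proof -
      note [measurable] = fq_meas[of n]
      show ?thesis by measurable
    qed
  qed (measurable, rule bounded_slab, measurable)
  show ?thesis
    unfolding balance_law_def
    by (rule LIMSEQ_unique[OF tendsto_diff[OF tendsto_add[OF init wall] wall]], unfold approx)
      (rule bulk)
qed

lemma set_integrable_ray_slope:
  assumes pos: "\<epsilon> > 0"
    and w: "w \<in> borel_measurable borel" "\<And>z. z \<in> {0..\<tau>} \<times> Omega a l \<Longrightarrow> \<bar>w z\<bar> \<le> C"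
    and lip: "bounded_lipschitz F" and diff: "AE x in lborel. \<exists>D. (F has_real_derivative D) (at x)"
  shows "set_integrable lborel ({0..\<tau>} \<times> Omega a l) (\<lambda>z. w z * (slope F (ray \<epsilon> z) / (fst z + \<epsilon>)))"
proof -
  obtain L where F: "L-lipschitz_on UNIV F"
    using lip by (auto simp: bounded_lipschitz_def)
  have L: "L \<ge> 0"
    using F by (rule lipschitz_on_nonneg)
  have [measurable]: "slope F \<in> borel_measurable borel"
    using F by (intro borel_measurable_slope lipschitz_on_continuous_on)
  note [measurable] = w(1)
  show ?thesis
    unfolding set_integrable_def
  proof (rule integrableI_bounded_set[of "{0..\<tau>} \<times> Omega a l" _ _ "C * (L / \<epsilon>)"])
    show "emeasure lborel ({0..\<tau>} \<times> Omega a l) < \<infinity>"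
      using bounded_slab by (rule emeasure_bounded_finite)
    show "(\<lambda>z. indicator ({0..\<tau>} \<times> Omega a l) z *\<^sub>R (w z * (slope F (ray \<epsilon> z) / (fst z + \<epsilon>))))
        \<in> borel_measurable lborel"
      using slab_borel by simp
    have "AE x in lborel. \<bar>slope F x\<bar> \<le> L"
      using diff
    proof eventually_elim
      case (elim x)
      then obtain D where D: "(F has_real_derivative D) (at x)" ..
      have "(\<lambda>n. \<bar>forward_quotient F n x\<bar>) \<longlonglongrightarrow> \<bar>D\<bar>"
        by (intro tendsto_rabs forward_quotient_tendsto D)
      then have "\<bar>D\<bar> \<le> L"
        by (rule LIMSEQ_le_const2) (use abs_forward_quotient_le[OF F] in blast)
      then show ?case
        by (simp add: slope_eq[OF D])
    qed
    from AE_ray[OF this pos]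
    show "AE z in lborel. z \<in> {0..\<tau>} \<times> Omega a l \<longrightarrow>
        norm (indicator ({0..\<tau>} \<times> Omega a l) z *\<^sub>R (w z * (slope F (ray \<epsilon> z) / (fst z + \<epsilon>)))) \<le> C * (L / \<epsilon>)"
    proof (eventually_elim, intro impI)
      fix z :: "real \<times> real \<times> real"
      assume s: "0 \<le> fst z \<longrightarrow> \<bar>slope F (ray \<epsilon> z)\<bar> \<le> L" and z: "z \<in> {0..\<tau>} \<times> Omega a l"
      have t: "fst z \<ge> 0"
        using z by (auto simp: mem_Times_iff)
      then have "\<bar>slope F (ray \<epsilon> z) / (fst z + \<epsilon>)\<bar> \<le> L / \<epsilon>"
        unfolding abs_divide using s pos L by (intro frac_le) auto
      then have "\<bar>w z * (slope F (ray \<epsilon> z) / (fst z + \<epsilon>))\<bar> \<le> C * (L / \<epsilon>)"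
        unfolding abs_mult using w(2)[OF z] by (intro mult_mono) auto
      then show "norm (indicator ({0..\<tau>} \<times> Omega a l) z *\<^sub>R (w z * (slope F (ray \<epsilon> z) / (fst z + \<epsilon>))))
          \<le> C * (L / \<epsilon>)"
        using z by simp
    qed
  qed (auto simp: indicator_def)
qed

lemma ray_has_derivative:
  assumes "(F has_real_derivative D) (at (ray \<epsilon> z))" and "fst z + \<epsilon> > 0"
  shows "((\<lambda>z. F (ray \<epsilon> z)) has_derivative
    (\<lambda>h. (- ray \<epsilon> z * (D / (fst z + \<epsilon>)), D / (fst z + \<epsilon>), 0) \<bullet> h)) (at z within S)"
proof -
  have "(ray \<epsilon> has_derivative (\<lambda>h. (- ray \<epsilon> z * fst h + fst (snd h)) / (fst z + \<epsilon>))) (at z within S)"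
    unfolding ray_def using assms(2)
    by (auto intro!: derivative_eq_intros simp: field_simps)
  then have "((\<lambda>z. F (ray \<epsilon> z)) has_derivative
      (\<lambda>h. ((- ray \<epsilon> z * fst h + fst (snd h)) / (fst z + \<epsilon>)) * D)) (at z within S)"
    by (rule DERIV_compose_FDERIV[where f = F and g = "ray \<epsilon>", OF assms(1)])
  also have "(\<lambda>h. ((- ray \<epsilon> z * fst h + fst (snd h)) / (fst z + \<epsilon>)) * D)
      = (\<lambda>h. (- ray \<epsilon> z * (D / (fst z + \<epsilon>)), D / (fst z + \<epsilon>), 0) \<bullet> h)"
    by (auto simp: fun_eq_iff inner_prod_def add_divide_distrib diff_divide_distrib algebra_simps)
  finally show ?thesis .
qed

lemma C1_test_ray:
  assumes F: "\<And>x. (F has_real_derivative F' x) (at x)" "continuous_on UNIV F'" and pos: "\<epsilon> > 0"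
  shows "C1_test T a l (\<lambda>z. F (ray \<epsilon> z))
    (\<lambda>z. (- ray \<epsilon> z * (F' (ray \<epsilon> z) / (fst z + \<epsilon>)), F' (ray \<epsilon> z) / (fst z + \<epsilon>), 0))"
  unfolding C1_test_def Let_def
proof (intro conjI ballI allI)
  let ?S = "{0..T} \<times> {-a..a} \<times> (UNIV :: real set)"
  show "((\<lambda>z. F (ray \<epsilon> z)) has_derivative
      (\<lambda>h. (- ray \<epsilon> z * (F' (ray \<epsilon> z) / (fst z + \<epsilon>)), F' (ray \<epsilon> z) / (fst z + \<epsilon>), 0) \<bullet> h))
      (at z within ?S)" if "z \<in> ?S" for z
    using that pos by (intro ray_has_derivative F) (auto simp: mem_Times_iff)
  have ne: "fst z + \<epsilon> \<noteq> 0" if "z \<in> ?S" for z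
    using that pos by (auto simp: mem_Times_iff)
  have [continuous_intros]: "continuous_on ?S (ray \<epsilon>)"
    unfolding ray_def by (intro continuous_intros ballI ne)
  show "continuous_on ?S
      (\<lambda>z. (- ray \<epsilon> z * (F' (ray \<epsilon> z) / (fst z + \<epsilon>)), F' (ray \<epsilon> z) / (fst z + \<epsilon>), 0))"
    by (intro continuous_intros ballI ne continuous_on_compose2[OF F(2)]) auto
  show "F (ray \<epsilon> (t, x1, x2 + l)) = F (ray \<epsilon> (t, x1, x2))" for t x1 x2
    by (simp add: ray_def)
qed

lemma set_integrable_ray_derivative:
  assumes F': "continuous_on UNIV F'" and pos: "\<epsilon> > 0"
    and w: "w \<in> borel_measurable borel" "\<And>z. z \<in> {0..\<tau>} \<times> Omega a l \<Longrightarrow> \<bar>w z\<bar> \<le> C"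
  shows "set_integrable lborel ({0..\<tau>} \<times> Omega a l) (\<lambda>z. w z * (F' (ray \<epsilon> z) / (fst z + \<epsilon>)))"
proof -
  obtain K where "\<And>y. y \<in> {-a/\<epsilon>..a/\<epsilon>} \<Longrightarrow> \<bar>F' y\<bar> \<le> K"
    using continuous_on_Icc_bounded[OF continuous_on_subset[OF F' subset_UNIV]] by blast
  then have K: "\<bar>F' (ray \<epsilon> z)\<bar> \<le> K" if "z \<in> {0..\<tau>} \<times> Omega a l" for z
    using ray_bound[OF that pos] by (simp add: abs_le_iff)
  note [measurable] = w(1) borel_measurable_continuous_onI[OF F']
  show ?thesis
  proof (rule set_integrable_lborel_bounded)
    fix z assume z: "z \<in> {0..\<tau>} \<times> Omega a l"
    have "fst z \<ge> 0"
      using z by (auto simp: mem_Times_iff)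
    then have "\<bar>F' (ray \<epsilon> z) / (fst z + \<epsilon>)\<bar> \<le> K / \<epsilon>"
      unfolding abs_divide using K[OF z] pos by (intro frac_le) auto
    then show "\<bar>w z * (F' (ray \<epsilon> z) / (fst z + \<epsilon>))\<bar> \<le> C * (K / \<epsilon>)"
      unfolding abs_mult using w(2)[OF z] by (intro mult_mono) auto
  qed (measurable, rule bounded_slab, measurable)
qed

text \<open>
  The law with \<open>\<alpha> = 1\<close>, \<open>\<beta> = 0\<close>: the fundamental theorem of calculus in time, integrated over the domain.
  Written in this form it extends to Lipschitz profiles in the same way as the equations of motion.
\<close>

lemma balance_law_time:
  assumes F: "\<And>x. (F has_real_derivative F' x) (at x)" "continuous_on UNIV F'"
    and pos: "\<epsilon> > 0" and \<tau>: "\<tau> \<ge> 0"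
  shows "balance_law \<tau> a l \<epsilon> (\<lambda>_. 1) (\<lambda>_. 1) 0 0 (\<lambda>_. 1) (\<lambda>_. 0) F F'"
proof -
  let ?g = "\<lambda>z. - ray \<epsilon> z * (F' (ray \<epsilon> z) / (fst z + \<epsilon>))"
  have "(LINT t:{0..\<tau>}|lborel. ?g (t, x)) = F (fst x / (\<tau> + \<epsilon>)) - F (fst x / \<epsilon>)" for x :: "real \<times> real"
  proof -
    have "(LBINT t. indicator {0..\<tau>} t *\<^sub>R ?g (t, x))
        = F (fst x / (\<tau> + \<epsilon>)) - F (fst x / (0 + \<epsilon>))"
    proof (rule integral_FTC_atLeastAtMost[OF \<tau>])
      fix t assume t: "0 \<le> t" "t \<le> \<tau>"
      have "((\<lambda>t. F (fst x / (t + \<epsilon>))) has_real_derivative ?g (t, x)) (at t within {0..\<tau>})"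
      proof -
        have "((\<lambda>t. fst x / (t + \<epsilon>)) has_real_derivative - (fst x / (t + \<epsilon>)) / (t + \<epsilon>)) (at t within {0..\<tau>})"
          using t pos by (auto intro!: derivative_eq_intros)
        from DERIV_chain2[OF F(1) this] show ?thesis
          by (simp add: ray_def mult.commute)
      qed
      then show "((\<lambda>t. F (fst x / (t + \<epsilon>))) has_vector_derivative ?g (t, x)) (at t within {0..\<tau>})"
        by (simp add: has_real_derivative_iff_has_vector_derivative)
    next
      show "continuous_on {0..\<tau>} (\<lambda>t. ?g (t, x))"
        unfolding ray_def fst_conv snd_conv using pos
        by (intro continuous_intros continuous_on_compose2[OF F(2)]) auto
    qed
    then show ?thesis
      by (simp add: set_lebesgue_integral_def)
  qed
  moreover have "set_integrable lborel ({0..\<tau>} \<times> Omega a l) ?g"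
    by (rule set_integrable_ray_derivative[OF F(2) pos _ , where C = "a / \<epsilon>"])
      (use ray_bound[OF _ pos] in \<open>simp_all only: abs_minus_cancel\<close>, measurable)
  ultimately show ?thesis
    unfolding balance_law_def by (simp add: set_integral_lborel_Times(2))
qed

text \<open>
  The law with \<open>\<alpha> = 0\<close>, \<open>\<beta> = 1\<close>: the fundamental theorem of calculus in \<open>x1\<close>.
\<close>

lemma balance_law_space:
  assumes F: "\<And>x. (F has_real_derivative F' x) (at x)" "continuous_on UNIV F'"
    and pos: "\<epsilon> > 0" and a: "a > 0"
  shows "balance_law \<tau> a l \<epsilon> (\<lambda>_. 0) (\<lambda>_. 0) 1 1 (\<lambda>_. 0) (\<lambda>_. 1) F F'"
proof -
  let ?g = "\<lambda>z. 1 * (F' (ray \<epsilon> z) / (fst z + \<epsilon>))"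
  let ?w = "\<lambda>b y. 1 * F (b / (fst y + \<epsilon>))"
  have int: "set_integrable lborel ({0..\<tau>} \<times> Omega a l) ?g"
    by (rule set_integrable_ray_derivative[OF F(2) pos, where C = 1]) auto
  have [measurable]: "F \<in> borel_measurable borel"
    by (intro borel_measurable_continuous_onI continuous_at_imp_continuous_on ballI DERIV_isCont[OF F(1)])
  have "continuous_on {-a/\<epsilon>..a/\<epsilon>} F"
    by (intro continuous_at_imp_continuous_on ballI DERIV_isCont[OF F(1)])
  then obtain K where "\<And>x. x \<in> {-a/\<epsilon>..a/\<epsilon>} \<Longrightarrow> \<bar>F x\<bar> \<le> K"
    using continuous_on_Icc_bounded by blast
  then have K: "\<bar>F x\<bar> \<le> K" if "\<bar>x\<bar> \<le> a / \<epsilon>" for x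
    using that by (simp add: abs_le_iff)
  have wall: "set_integrable lborel ({0..\<tau>} \<times> {0..<l}) (?w b)" if "\<bar>b\<bar> \<le> a" for b
  proof (rule set_integrable_lborel_bounded[OF wall_borel bounded_wall])
    show "\<bar>?w b y\<bar> \<le> K" if "y \<in> {0..\<tau>} \<times> {0..<l}" for y :: "real \<times> real"
    proof -
      have "fst y \<ge> 0"
        using that by (auto simp: mem_Times_iff)
      then have "\<bar>b / (fst y + \<epsilon>)\<bar> \<le> a / \<epsilon>"
        unfolding abs_divide using \<open>\<bar>b\<bar> \<le> a\<close> pos by (intro frac_le) auto
      then show ?thesis
        using K by simp
    qed
  qed measurable
  have slice: "(LINT x:Omega a l|lborel. ?g (t, x))
      = (LINT y:{0..<l}|lborel. ?w a (t, y) - ?w (- a) (t, y))" if t: "t \<in> {0..\<tau>}" for t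
  proof -
    have "set_integrable lborel ({-a<..<a} \<times> {0..<l}) (\<lambda>x. ?g (t, x))"
    proof -
      obtain M where "\<And>y. y \<in> {-a/\<epsilon>..a/\<epsilon>} \<Longrightarrow> \<bar>F' y\<bar> \<le> M"
        using continuous_on_Icc_bounded[OF continuous_on_subset[OF F(2) subset_UNIV]] by blast
      then have M: "\<bar>F' y\<bar> \<le> M" if "\<bar>y\<bar> \<le> a / \<epsilon>" for y
        using that by (simp add: abs_le_iff)
      have "\<bar>?g (t, x)\<bar> \<le> M / \<epsilon>" if "x \<in> {-a<..<a} \<times> {0..<l}" for x :: "real \<times> real"
      proof -
        have "\<bar>ray \<epsilon> (t, x)\<bar> \<le> a / \<epsilon>"
          using t that by (intro ray_bound[OF _ pos, where l = l and \<tau> = \<tau>]) (auto simp: Omega_def)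
        then have "\<bar>F' (ray \<epsilon> (t, x)) / (t + \<epsilon>)\<bar> \<le> M / \<epsilon>"
          unfolding abs_divide using t pos M order_trans[OF abs_ge_zero M] by (intro frac_le) auto
        then show ?thesis
          by simp
      qed
      moreover note [measurable] = borel_measurable_continuous_onI[OF F(2)]
      have "(\<lambda>x. ?g (t, x)) \<in> borel_measurable borel"
        unfolding ray_def by simp
      ultimately show ?thesis
        by (intro set_integrable_lborel_bounded) (auto intro: bounded_Times borel_Times)
    qed
    then have "(LINT x:Omega a l|lborel. ?g (t, x))
        = (LINT y:{0..<l}|lborel. LINT x:{-a<..<a}|lborel. ?g (t, x, y))"
      unfolding Omega_def by (rule set_integral_lborel_Times(2))
    also have "\<dots> = (LINT y:{0..<l}|lborel. ?w a (t, y) - ?w (- a) (t, y))"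
    proof -
      have "(LINT x:{-a<..<a}|lborel. ?g (t, x, y)) = ?w a (t, y) - ?w (- a) (t, y)" for y
      proof -
        have "(LINT x:{-a<..<a}|lborel. ?g (t, x, y)) = (LBINT x=ereal (- a)..ereal a. ?g (t, x, y))"
          using a by (subst interval_integral_Ioo) simp_all
        also have "\<dots> = F (a / (t + \<epsilon>)) - F (- a / (t + \<epsilon>))"
        proof (rule interval_integral_FTC_finite)
          let ?I = "{min (- a) a..max (- a) a}"
          show "continuous_on ?I (\<lambda>x. ?g (t, x, y))"
            unfolding ray_def fst_conv snd_conv using pos t
            by (intro continuous_intros continuous_on_compose2[OF F(2)]) auto
          fix x
          have "((\<lambda>x. x / (t + \<epsilon>)) has_real_derivative 1 / (t + \<epsilon>)) (at x within ?I)"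
            using pos t by (auto intro!: derivative_eq_intros)
          from DERIV_chain2[OF F(1) this]
          show "((\<lambda>x. F (x / (t + \<epsilon>))) has_vector_derivative ?g (t, x, y)) (at x within ?I)"
            by (simp add: ray_def has_real_derivative_iff_has_vector_derivative)
        qed
        finally show ?thesis
          by simp
      qed
      then show ?thesis
        by (simp only:)
    qed
    finally show ?thesis .
  qed
  have "(LINT z:{0..\<tau>} \<times> Omega a l|lborel. ?g z)
      = (LINT t:{0..\<tau>}|lborel. LINT x:Omega a l|lborel. ?g (t, x))"
    using int by (rule set_integral_lborel_Times(1))
  also have "\<dots> = (LINT t:{0..\<tau>}|lborel. LINT y:{0..<l}|lborel. ?w a (t, y) - ?w (- a) (t, y))"
    by (intro set_lebesgue_integral_cong allI impI slice) auto
  also have "\<dots> = (LINT y:{0..\<tau>} \<times> {0..<l}|lborel. ?w a y - ?w (- a) y)"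
    using a by (intro set_integral_lborel_Times(1)[symmetric] set_integral_diff(1) wall) auto
  also have "\<dots> = (LINT y:{0..\<tau>} \<times> {0..<l}|lborel. ?w a y) - (LINT y:{0..\<tau>} \<times> {0..<l}|lborel. ?w (- a) y)"
    using a by (intro set_integral_diff(2) wall) auto
  finally show ?thesis
    unfolding balance_law_def by simp
qed

section \<open>Pressure potential and relative energy\<close>

text \<open>
  The derivative \<open>H'\<close> of the pressure potential (\<open>H_deriv\<close> below), in a form that avoids the integral:
  \<open>r H' - H = p\<close>.
\<close>

definition potential_slope :: "(real \<Rightarrow> real) \<Rightarrow> real \<Rightarrow> real" where
  "potential_slope p r = (H p r + p r) / r"

text \<open>
  The kinetic energy of the velocity difference plus the Bregman distance of the convex function \<open>H\<close>.
\<close>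

definition relative_energy :: "(real \<Rightarrow> real) \<Rightarrow> real \<Rightarrow> real \<times> real \<Rightarrow> real \<Rightarrow> real \<Rightarrow> real" where
  "relative_energy p r v R U =
     1/2 * r * (norm (v - (U, 0)))^2 + (H p r - potential_slope p R * (r - R) - H p R)"

locale barotropic =
  fixes p :: "real \<Rightarrow> real"
  assumes adm: "admissible_pressure p"
begin

lemma pressure_deriv: "z > 0 \<Longrightarrow> (p has_real_derivative deriv p z) (at z)"
  using adm by (auto simp: admissible_pressure_def DERIV_deriv_iff_real_differentiable)

lemma deriv_pos: "z > 0 \<Longrightarrow> deriv p z > 0"
  using adm by (auto simp: admissible_pressure_def)

lemma continuous_on_pressure: "continuous_on {0..} p"
  using adm by (auto simp: admissible_pressure_def)

lemma continuous_on_deriv_pressure: "continuous_on {0<..} (deriv p)"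
  using adm by (auto simp: admissible_pressure_def)

lemma pressure_0: "p 0 = 0"
  using adm by (auto simp: admissible_pressure_def)

text \<open>
  Convexity of the pressure enters twice: through this inequality, which gives the sign of the entropy
  production, and through monotonicity of the sound speed, which makes rarefaction waves expansive.
\<close>

lemma pressure_tangent:
  assumes "z > 0" "r \<ge> 0"
  shows "p r \<ge> p z + deriv p z * (r - z)"
proof -
  have "p r - p z \<ge> deriv p z * (r - z)"
  proof (rule convex_on_imp_above_tangent[of "{0..}"])
    show "(p has_real_derivative deriv p z) (at z within {0..})"
      using pressure_deriv[OF assms(1)] by (rule has_field_derivative_at_within)
  qed (use adm assms in \<open>auto simp: admissible_pressure_def\<close>)
  then show ?thesis
    by linarith
qed

lemma deriv_pressure_mono:
  assumes "0 < x" "x \<le> y"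
  shows "deriv p x \<le> deriv p y"
proof (cases "x = y")
  case False
  then have "x < y"
    using assms by simp
  have "deriv p x * (y - x) \<le> deriv p y * (y - x)"
    using pressure_tangent[of x y] pressure_tangent[of y x] assms by (simp add: algebra_simps)
  then show ?thesis
    using \<open>x < y\<close> by simp
qed simp

lemma pressure_pos:
  assumes "r > 0"
  shows "p r > 0"
proof -
  obtain d z where z: "0 < z" "z < r" "DERIV p z :> d" "p r - p 0 = (r - 0) * d"
    using MVT[of 0 r p] assms continuous_on_subset[OF continuous_on_pressure]
      pressure_deriv real_differentiable_def
    by (metis atLeastAtMost_iff atLeast_iff subsetI)
  have "d = deriv p z"
    using z(3) by (simp add: DERIV_imp_deriv)
  then show ?thesis
    using z deriv_pos[of z] assms pressure_0 by simp
qed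

lemma potential_integral_deriv:
  assumes r: "r > 0"
  shows "((\<lambda>r. LBINT z=ereal 1..ereal r. p z / z^2) has_real_derivative p r / r^2) (at r)"
proof -
  define c where "c = min 1 r / 2"
  define d where "d = max 1 r + 1"
  have c: "0 < c" "c < 1" "c < r" "1 < d" "r < d"
    using r by (auto simp: c_def d_def)
  have "((\<lambda>r. LBINT z=ereal 1..ereal r. p z / z^2) has_vector_derivative p r / r^2) (at r within {c..d})"
  proof (rule interval_integral_FTC2)
    show "continuous_on {c..d} (\<lambda>z. p z / z^2)"
      using c by (intro continuous_intros continuous_on_subset[OF continuous_on_pressure]) auto
  qed (use c in auto)
  moreover have "at r within {c..d} = at r"
    using c by (intro at_within_interior) auto
  ultimately show ?thesis
    by (simp add: has_real_derivative_iff_has_vector_derivative)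
qed

lemma H_deriv:
  assumes r: "r > 0"
  shows "(H p has_real_derivative potential_slope p r) (at r)"
proof -
  have "((\<lambda>r. r * (LBINT z=ereal 1..ereal r. p z / z^2)) has_real_derivative
      1 * (LBINT z=ereal 1..ereal r. p z / z^2) + p r / r^2 * r) (at r)"
    by (intro DERIV_mult potential_integral_deriv r DERIV_ident)
  moreover have "1 * (LBINT z=ereal 1..ereal r. p z / z^2) + p r / r^2 * r = potential_slope p r"
    using r by (simp add: potential_slope_def H_def field_simps power2_eq_square)
  ultimately show ?thesis
    by (simp add: H_def[abs_def])
qed

lemma potential_slope_deriv:
  assumes r: "r > 0"
  shows "(potential_slope p has_real_derivative deriv p r / r) (at r)"
proof -
  have "((\<lambda>r. (H p r + p r) / r) has_real_derivative
      ((potential_slope p r + deriv p r) * r - (H p r + p r) * 1) / (r * r)) (at r)"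
    using r by (intro DERIV_divide DERIV_add H_deriv pressure_deriv DERIV_ident) auto
  moreover have "((potential_slope p r + deriv p r) * r - (H p r + p r) * 1) / (r * r) = deriv p r / r"
    using r by (simp add: potential_slope_def field_simps)
  ultimately show ?thesis
    by (simp add: potential_slope_def[abs_def])
qed

lemma potential_slope_strict_mono:
  assumes "0 < x" "x < y"
  shows "potential_slope p x < potential_slope p y"
  using assms(2)
proof (rule DERIV_pos_imp_increasing)
  fix z assume "x \<le> z" "z \<le> y"
  then have "z > 0"
    using assms by simp
  then show "\<exists>d. DERIV (potential_slope p) z :> d \<and> 0 < d"
    using potential_slope_deriv deriv_pos by (intro exI[of _ "deriv p z / z"]) auto
qed

lemma H_0: "H p 0 = 0"
  by (simp add: H_def)

text \<open>
  For \<open>r > 0\<close> this is strict monotonicity of \<open>H'\<close> and the mean value theorem. At vacuum \<open>H'\<close> may be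
  unbounded, but there the left-hand side is \<open>R H'(R) - H(R) = p(R)\<close>, which is positive.
\<close>

lemma H_strictly_above_tangent:
  assumes r: "r \<ge> 0" and R: "R > 0" and ne: "r \<noteq> R"
  shows "H p r - potential_slope p R * (r - R) - H p R > 0"
proof -
  consider "r = 0" | "0 < r" "r < R" | "R < r"
    using r ne by linarith
  then show ?thesis
  proof cases
    case 1
    have "potential_slope p R * R - H p R = p R"
      using R by (simp add: potential_slope_def)
    then show ?thesis
      using 1 pressure_pos[OF R] by (simp add: H_0)
  next
    case 2
    have "\<exists>z. r < z \<and> z < R \<and> H p R - H p r = (R - r) * potential_slope p z"
      using 2 by (intro MVT2) (auto intro!: H_deriv)
    then obtain z where z: "r < z" "z < R" "H p R - H p r = (R - r) * potential_slope p z"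
      by blast
    then have "(R - r) * potential_slope p z < (R - r) * potential_slope p R"
      using 2 potential_slope_strict_mono[of z R] by (intro mult_strict_left_mono) auto
    then show ?thesis
      using z(3) by (simp add: algebra_simps)
  next
    case 3
    have "\<exists>z. R < z \<and> z < r \<and> H p r - H p R = (r - R) * potential_slope p z"
      using 3 R by (intro MVT2) (auto intro!: H_deriv)
    then obtain z where z: "R < z" "z < r" "H p r - H p R = (r - R) * potential_slope p z"
      by blast
    then have "(r - R) * potential_slope p R < (r - R) * potential_slope p z"
      using 3 R potential_slope_strict_mono[of R z] by (intro mult_strict_left_mono) auto
    then show ?thesis
      using z(3) by (simp add: algebra_simps)
  qed
qed

lemma H_above_tangent:
  assumes "r \<ge> 0" "R > 0"
  shows "H p r - potential_slope p R * (r - R) - H p R \<ge> 0"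
  using H_strictly_above_tangent[OF assms] by (cases "r = R") auto

lemma relative_energy_nonneg:
  assumes "r \<ge> 0" "R > 0"
  shows "relative_energy p r v R U \<ge> 0"
  using H_above_tangent[OF assms] assms by (simp add: relative_energy_def)

lemma relative_energy_eq_0_iff:
  assumes "r \<ge> 0" "R > 0"
  shows "relative_energy p r v R U = 0 \<longleftrightarrow> r = R \<and> v = (U, 0)"
proof
  assume eq: "relative_energy p r v R U = 0"
  have "1/2 * r * (norm (v - (U, 0)))^2 \<ge> 0"
    using assms by simp
  then have "H p r - potential_slope p R * (r - R) - H p R \<le> 0"
    using eq by (simp add: relative_energy_def)
  then have "r = R"
    using H_strictly_above_tangent[OF assms] by force
  then show "r = R \<and> v = (U, 0)"
    using eq assms by (simp add: relative_energy_def)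
qed (simp add: relative_energy_def)

text \<open>
  Expanding the squares, the relative energy is the energy plus terms that are linear in the density
  and in the momentum. The coefficients of these terms are the test functions for the continuity and
  momentum equations, and the remaining term is the pressure of the reference state.
\<close>

lemma relative_energy_expand:
  assumes "R > 0"
  shows "relative_energy p r v R U =
    energy p r v - r * fst v * U + r * (U^2 / 2 - potential_slope p R) + p R"
proof -
  have "(norm w)^2 = (fst w)^2 + (snd w)^2" for w :: "real \<times> real"
    by (simp add: norm_prod_def)
  then have "(norm (v - (U, 0)))^2 = (norm v)^2 - 2 * fst v * U + U^2"
    by (simp add: power2_diff)
  note norm = this
  have "potential_slope p R * R = H p R + p R"
    using assms by (simp add: potential_slope_def)
  then show ?thesis
    unfolding relative_energy_def energy_def norm by (simp add: algebra_simps)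
qed

text \<open>
  The tangent at \<open>r = 1\<close> bounds \<open>H\<close> from below, and monotonicity of \<open>H(r) / r\<close> bounds it from above.
\<close>

lemma H_bounded:
  obtains K where "\<And>r. 0 \<le> r \<Longrightarrow> r \<le> C \<Longrightarrow> \<bar>H p r\<bar> \<le> K"
proof -
  let ?J = "\<lambda>r. LBINT z=ereal 1..ereal r. p z / z^2"
  define D where "D = max C 1"
  have lower: "- p 1 \<le> H p r" if "0 \<le> r" for r
  proof -
    have [simp]: "H p 1 = 0"
      by (simp add: H_def interval_integral_endpoints_same)
    have "p 1 * (r - 1) \<le> H p r"
      using H_above_tangent[of r 1] that by (simp add: potential_slope_def)
    moreover have "- p 1 \<le> p 1 * (r - 1)"
      using that pressure_pos[of 1] by (simp add: algebra_simps)
    ultimately show ?thesis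
      by linarith
  qed
  have upper: "H p r \<le> D * ?J D" if r: "0 < r" "r \<le> D" for r
  proof -
    have mono: "?J x \<le> ?J y" if "0 < x" "x \<le> y" for x y
      using that(2)
    proof (rule DERIV_nonneg_imp_nondecreasing)
      fix z assume "x \<le> z" "z \<le> y"
      then have "z > 0"
        using that by simp
      then show "\<exists>d. DERIV ?J z :> d \<and> 0 \<le> d"
        using potential_integral_deriv pressure_pos[of z]
        by (intro exI[of _ "p z / z^2"]) auto
    qed
    have "0 \<le> ?J D"
      using mono[of 1 D] by (simp add: D_def interval_integral_endpoints_same)
    have "r * ?J r \<le> r * ?J D"
      using r by (intro mult_left_mono mono) auto
    also have "\<dots> \<le> D * ?J D"
      using r \<open>0 \<le> ?J D\<close> by (intro mult_right_mono)
    finally show ?thesis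
      by (simp add: H_def)
  qed
  show ?thesis
  proof (rule that[of "\<bar>D * ?J D\<bar> + p 1"])
    fix r assume "0 \<le> r" "r \<le> C"
    then have "H p r \<le> \<bar>D * ?J D\<bar>"
      using upper[of r] by (cases "r = 0") (force simp: H_0 D_def)+
    then show "\<bar>H p r\<bar> \<le> \<bar>D * ?J D\<bar> + p 1"
      using lower[OF \<open>0 \<le> r\<close>] pressure_pos[of 1] by linarith
  qed
qed

lemma borel_measurable_H:
  "(\<lambda>r. H p (max 0 r)) \<in> borel_measurable borel"
proof -
  have "continuous_on {0<..} (H p)"
    by (intro continuous_at_imp_continuous_on ballI DERIV_isCont[OF H_deriv]) auto
  then have "(\<lambda>r. indicator {0<..} r *\<^sub>R H p r) \<in> borel_measurable borel"
    by (intro borel_measurable_continuous_on_indicator) auto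
  also have "(\<lambda>r. indicator {0<..} r *\<^sub>R H p r) = (\<lambda>r. H p (max 0 r))"
    by (auto simp: fun_eq_iff indicator_def max_def H_0)
  finally show ?thesis .
qed

lemma borel_measurable_pressure:
  "(\<lambda>r. p (max 0 r)) \<in> borel_measurable borel"
  by (intro borel_measurable_continuous_onI continuous_on_compose2[OF continuous_on_pressure]
      continuous_intros) auto

end

section \<open>Entropy production of a rarefaction wave\<close>

locale rarefaction = barotropic p for p +
  fixes T a rhoL rhoR uL uR :: real and R U :: "real \<Rightarrow> real"
  assumes T: "T > 0" and a: "a > 0"
    and sol: "rarefaction_solution p rhoL rhoR uL uR R U"
    and no_vacuum: "essinf (lebesgue_on ({0<..<T} \<times> UNIV)) (\<lambda>(t, x1). self_similar R t x1) > 0"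
    and far_left: "\<forall>t\<in>{0<..<T}. \<forall>x1. x1 \<le> -a \<longrightarrow> self_similar R t x1 = rhoL \<and> self_similar U t x1 = uL"
    and far_right: "\<forall>t\<in>{0<..<T}. \<forall>x1. x1 \<ge> a \<longrightarrow> self_similar R t x1 = rhoR \<and> self_similar U t x1 = uR"
begin

lemma profiles_lipschitz:
  obtains L where "L-lipschitz_on UNIV R" "L-lipschitz_on UNIV U"
proof -
  have "\<exists>C. C-lipschitz_on UNIV R \<and> C-lipschitz_on UNIV U"
    using sol unfolding rarefaction_solution_def by (elim conjE)
  then show ?thesis
    using that by blast
qed

lemma continuous_profiles: "continuous_on UNIV R" "continuous_on UNIV U"
proof -
  obtain L where L: "L-lipschitz_on UNIV R" "L-lipschitz_on UNIV U"
    by (rule profiles_lipschitz)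
  show "continuous_on UNIV R" "continuous_on UNIV U"
    using L by (auto intro: lipschitz_on_continuous_on)
qed

text \<open>
  The bound holds on almost every ray within one time slice, and continuity extends it to all rays.
\<close>

lemma density_lower_bound:
  obtains c where "c > 0" "\<And>\<xi>. c \<le> R \<xi>"
proof -
  let ?M = "lebesgue_on ({0<..<T} \<times> (UNIV :: real set))"
  let ?f = "\<lambda>(t, x1). self_similar R t x1"
  obtain c where c: "0 < ereal c" "ereal c < essinf ?M ?f"
    using ereal_dense2[OF no_vacuum] by blast
  have "AE z in ?M. - ereal (?f z) \<le> esssup ?M (\<lambda>z. - ereal (?f z))"
    by (rule esssup_AE)
  then have "AE z in ?M. c \<le> ?f z"
  proof eventually_elim
    case (elim z)
    then have "essinf ?M ?f \<le> ereal (?f z)"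
      unfolding essinf_def by (rule ereal_uminus_le_reorder[THEN iffD1])
    with c(2) have "ereal c < ereal (?f z)"
      by (rule less_le_trans)
    then show ?case
      by simp
  qed
  then have slices: "AE t in lborel. t \<in> {0<..<T} \<longrightarrow> (AE x in lborel. x \<in> UNIV \<longrightarrow> c \<le> ?f (t, x))"
    by (rule AE_lebesgue_on_slices) auto
  obtain t where t: "t \<in> {0<..<T}" "AE x in lborel. x \<in> UNIV \<longrightarrow> c \<le> ?f (t, x)"
    using AE_lborel_greaterThanLessThan_ex[OF slices T] by (elim bexE)
  have closed: "closed {x. c \<le> R (x / t)}"
    by (intro closed_Collect_le continuous_on_const
        continuous_on_compose2[OF continuous_profiles(1), of UNIV "\<lambda>x. x / t"])
      (use t in \<open>auto intro!: continuous_intros\<close>)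
  have "AE x in lebesgue. x \<in> {x. c \<le> R (x / t)}"
    using t(2) by (simp add: AE_completion_iff self_similar_def)
  then have all: "c \<le> R (x / t)" for x
    using mem_closed_if_AE_lebesgue[OF closed] by blast
  show ?thesis
  proof
    show "c > 0"
      using c by simp
    show "c \<le> R \<xi>" for \<xi>
      using all[of "\<xi> * t"] t by simp
  qed
qed

lemma density_pos: "R \<xi> > 0"
proof -
  obtain c where "c > 0" "\<And>\<xi>. c \<le> R \<xi>"
    using density_lower_bound by blast
  then show ?thesis
    by (rule less_le_trans)
qed

lemma wave_structure:
  obtains x1 x2 x3 x4 rhoM uM where "x1 \<le> x2" "x2 \<le> x3" "x3 \<le> x4"
    and "\<forall>\<xi>. \<xi> \<le> x1 \<longrightarrow> R \<xi> = rhoL \<and> U \<xi> = uL"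
    and "\<forall>\<xi>. x1 < \<xi> \<and> \<xi> < x2 \<longrightarrow> U \<xi> - sqrt (deriv p (R \<xi>)) = \<xi>"
    and "\<forall>\<xi>. x2 \<le> \<xi> \<and> \<xi> \<le> x3 \<longrightarrow> R \<xi> = rhoM \<and> U \<xi> = uM"
    and "\<forall>\<xi>. x3 < \<xi> \<and> \<xi> < x4 \<longrightarrow> U \<xi> + sqrt (deriv p (R \<xi>)) = \<xi>"
    and "\<forall>\<xi>. x4 \<le> \<xi> \<longrightarrow> R \<xi> = rhoR \<and> U \<xi> = uR"
  using sol unfolding rarefaction_solution_def by (elim conjE exE) (rule that)

lemma bounded_if_constant_outside:
  fixes W :: "real \<Rightarrow> real"
  assumes "continuous_on UNIV W" "\<And>\<xi>. \<xi> \<le> x1 \<Longrightarrow> W \<xi> = w1" "\<And>\<xi>. x2 \<le> \<xi> \<Longrightarrow> W \<xi> = w2"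
  obtains K where "\<And>\<xi>. \<bar>W \<xi>\<bar> \<le> K"
proof -
  obtain K where K: "\<And>y. y \<in> {x1..x2} \<Longrightarrow> \<bar>W y\<bar> \<le> K"
    using continuous_on_Icc_bounded[OF continuous_on_subset[OF assms(1) subset_UNIV]] by blast
  show ?thesis
  proof
    fix \<xi>
    consider "\<xi> \<le> x1" | "x2 \<le> \<xi>" | "\<xi> \<in> {x1..x2}"
      by (meson atLeastAtMost_iff linear)
    then show "\<bar>W \<xi>\<bar> \<le> max K (max \<bar>w1\<bar> \<bar>w2\<bar>)"
      using K assms(2,3) by cases (auto simp: le_max_iff_disj)
  qed
qed

lemma profiles_bounded:
  obtains K where "\<And>\<xi>. \<bar>R \<xi>\<bar> \<le> K" "\<And>\<xi>. \<bar>U \<xi>\<bar> \<le> K"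
proof -
  obtain x1 x2 x3 x4 rhoM uM where x:
    "\<forall>\<xi>. \<xi> \<le> x1 \<longrightarrow> R \<xi> = rhoL \<and> U \<xi> = uL" "\<forall>\<xi>. x4 \<le> \<xi> \<longrightarrow> R \<xi> = rhoR \<and> U \<xi> = uR"
    by (rule wave_structure)
  obtain K1 where "\<And>\<xi>. \<bar>R \<xi>\<bar> \<le> K1"
    by (rule bounded_if_constant_outside[OF continuous_profiles(1), of x1 rhoL x4 rhoR])
      (use x in blast)+
  moreover obtain K2 where "\<And>\<xi>. \<bar>U \<xi>\<bar> \<le> K2"
    by (rule bounded_if_constant_outside[OF continuous_profiles(2), of x1 uL x4 uR])
      (use x in blast)+
  ultimately show ?thesis
    by (intro that[of "max K1 K2"]) (simp_all add: le_max_iff_disj)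
qed

text \<open>
  Along the ray \<open>x = \<xi> t\<close> a self-similar conservation law \<open>\<partial>t W + \<partial>x V = 0\<close> reads \<open>- \<xi> W' + V' = 0\<close>.
  Differentiability of the profiles comes for free: for \<open>\<xi> \<noteq> 0\<close> the profile \<open>W\<close> is recovered from the
  time dependence at a fixed point, since \<open>\<xi> t / (\<xi> t / \<eta>) = \<eta>\<close>.
\<close>

lemma balance_at_self_similar:
  assumes bal: "balance_at (self_similar W) (self_similar V) t (\<xi> * t)" and t: "t > 0" and \<xi>: "\<xi> \<noteq> 0"
  shows "\<exists>W' V'. (W has_real_derivative W') (at \<xi>) \<and> (V has_real_derivative V') (at \<xi>) \<and> V' = \<xi> * W'"
proof -
  from bal obtain d e where
    d: "((\<lambda>s. W (\<xi> * t / s)) has_real_derivative d) (at t)" and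
    e: "((\<lambda>y. V (y / t)) has_real_derivative e) (at (\<xi> * t))" and
    sum: "d + e = 0"
    by (auto simp: balance_at_def self_similar_def)
  have "((\<lambda>\<eta>. \<xi> * t / \<eta>) has_real_derivative - t / \<xi>) (at \<xi>)"
    using \<xi> by (auto intro!: derivative_eq_intros simp: field_simps power2_eq_square)
  moreover have "((\<lambda>s. W (\<xi> * t / s)) has_real_derivative d) (at (\<xi> * t / \<xi>))"
    using d \<xi> by simp
  ultimately have "((\<lambda>\<eta>. W (\<xi> * t / (\<xi> * t / \<eta>))) has_real_derivative d * (- t / \<xi>)) (at \<xi>)"
    by (intro DERIV_chain2[where f = "\<lambda>s. W (\<xi> * t / s)"])
  then have W: "(W has_real_derivative d * (- t / \<xi>)) (at \<xi>)"
    by (rule has_field_derivative_transform_within_open[where S = "- {0}"]) (use t \<xi> in auto)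
  have "((\<lambda>\<eta>. \<eta> * t) has_real_derivative t) (at \<xi>)"
    by (auto intro!: derivative_eq_intros)
  then have "((\<lambda>\<eta>. V (\<eta> * t / t)) has_real_derivative e * t) (at \<xi>)"
    by (rule DERIV_chain2[where f = "\<lambda>y. V (y / t)" and g = "\<lambda>\<eta>. \<eta> * t", OF e])
  then have V: "(V has_real_derivative e * t) (at \<xi>)"
    using t by simp
  have "e = - d"
    using sum by linarith
  then have "e * t = \<xi> * (d * (- t / \<xi>))"
    using \<xi> by simp
  with W V show ?thesis
    by (intro exI conjI)
qed

text \<open>
  The Euler system in the similarity variable: mass balance, and momentum balance minus \<open>U\<close> times mass
  balance. The equations hold almost everywhere in the plane, so they hold almost everywhere on one
  line \<open>t = const\<close>, and rescaling this line gives almost every \<open>\<xi>\<close>.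
\<close>

lemma profile_equations:
  "AE \<xi> in lborel. \<exists>R' U'. (R has_real_derivative R') (at \<xi>) \<and> (U has_real_derivative U') (at \<xi>) \<and>
     (U \<xi> - \<xi>) * R' + R \<xi> * U' = 0 \<and> R \<xi> * (U \<xi> - \<xi>) * U' + deriv p (R \<xi>) * R' = 0"
proof -
  let ?bal = "\<lambda>t x. balance_at (self_similar R) (self_similar (\<lambda>\<xi>. R \<xi> * U \<xi>)) t x \<and>
        balance_at (self_similar (\<lambda>\<xi>. R \<xi> * U \<xi>)) (self_similar (\<lambda>\<xi>. R \<xi> * (U \<xi>)^2 + p (R \<xi>))) t x"
  have "AE z in lebesgue_on ({0<..} \<times> UNIV). ?bal (fst z) (snd z)"
    using sol by (simp add: rarefaction_solution_def solves_riemann_1d_def self_similar_def[abs_def]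
        case_prod_unfold)
  then have "AE t in lborel. t \<in> {0<..} \<longrightarrow> (AE x in lborel. x \<in> UNIV \<longrightarrow> ?bal (fst (t, x)) (snd (t, x)))"
    by (rule AE_lebesgue_on_slices) auto
  then have slices: "AE t in lborel. t \<in> {0<..<1} \<longrightarrow> (AE x in lborel. ?bal t x)"
    by eventually_elim simp
  obtain t where "t \<in> {0<..<1}" and ae: "AE x in lborel. ?bal t x"
    using AE_lborel_greaterThanLessThan_ex[OF slices zero_less_one] by (elim bexE)
  then have t: "t > 0"
    by simp
  have "AE \<xi> in lborel. ?bal t (\<xi> / (1 / t))"
    using ae by (rule AE_lborel_scale) (use t in simp)
  moreover have "AE \<xi> in lborel. \<xi> \<noteq> (0::real)"
    by (rule AE_lborel_singleton)
  ultimately show ?thesis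
  proof eventually_elim
    case (elim \<xi>)
    then have bal: "?bal t (\<xi> * t)"
      by simp
    obtain R' M' where R': "(R has_real_derivative R') (at \<xi>)"
      and M': "((\<lambda>\<xi>. R \<xi> * U \<xi>) has_real_derivative M') (at \<xi>)" and mass: "M' = \<xi> * R'"
      using balance_at_self_similar[of R "\<lambda>\<xi>. R \<xi> * U \<xi>"] bal t elim by blast
    obtain N' F' where N': "((\<lambda>\<xi>. R \<xi> * U \<xi>) has_real_derivative N') (at \<xi>)"
      and F': "((\<lambda>\<xi>. R \<xi> * (U \<xi>)^2 + p (R \<xi>)) has_real_derivative F') (at \<xi>)" and mom: "F' = \<xi> * N'"
      using balance_at_self_similar[of "\<lambda>\<xi>. R \<xi> * U \<xi>" "\<lambda>\<xi>. R \<xi> * (U \<xi>)^2 + p (R \<xi>)"] bal t elim by blast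
    define U' where "U' = (M' * R \<xi> - R \<xi> * U \<xi> * R') / (R \<xi> * R \<xi>)"
    have "((\<lambda>\<xi>. R \<xi> * U \<xi> / R \<xi>) has_real_derivative U') (at \<xi>)"
      unfolding U'_def using density_pos[of \<xi>] by (intro DERIV_divide M' R') auto
    moreover have "(\<lambda>\<xi>. R \<xi> * U \<xi> / R \<xi>) = U"
      using density_pos by (simp add: fun_eq_iff less_imp_neq[THEN not_sym])
    ultimately have U': "(U has_real_derivative U') (at \<xi>)"
      by simp
    have M: "M' = R' * U \<xi> + U' * R \<xi>"
      by (rule DERIV_unique[OF M' DERIV_mult[OF R' U']])
    have N: "N' = M'"
      by (rule DERIV_unique[OF N' M'])
    have "((\<lambda>\<xi>. R \<xi> * (U \<xi>)^2 + p (R \<xi>)) has_real_derivative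
        R' * (U \<xi>)^2 + (2 * U \<xi> * U') * R \<xi> + deriv p (R \<xi>) * R') (at \<xi>)"
      using U' by (intro DERIV_add DERIV_mult R' DERIV_chain2[where f = p and g = R and x = \<xi>, OF pressure_deriv[OF density_pos]])
        (auto intro!: derivative_eq_intros)
    then have F: "F' = R' * (U \<xi>)^2 + (2 * U \<xi> * U') * R \<xi> + deriv p (R \<xi>) * R'"
      by (rule DERIV_unique[OF F'])
    have 1: "(U \<xi> - \<xi>) * R' + R \<xi> * U' = 0"
      using M mass by (simp add: algebra_simps)
    have "R \<xi> * (U \<xi> - \<xi>) * U' + deriv p (R \<xi>) * R' = (F' - \<xi> * M') - U \<xi> * (M' - \<xi> * R')"
      unfolding F M by (simp add: algebra_simps power2_eq_square)
    then have "R \<xi> * (U \<xi> - \<xi>) * U' + deriv p (R \<xi>) * R' = 0"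
      using mass mom N by simp
    with R' U' 1 show ?case
      by blast
  qed
qed

lemma DERIV_const_on_open:
  fixes W :: "real \<Rightarrow> real"
  assumes "(W has_real_derivative D) (at \<xi>)" "open S" "\<xi> \<in> S" "\<And>\<eta>. \<eta> \<in> S \<Longrightarrow> W \<eta> = k"
  shows "D = 0"
proof -
  have "((\<lambda>_. k) has_real_derivative D) (at \<xi>)"
    using assms by (intro has_field_derivative_transform_within_open[OF assms(1-3)]) auto
  then show ?thesis
    using DERIV_const DERIV_unique by blast
qed

lemma sound_speed_mono: "R \<xi> \<le> R \<eta> \<Longrightarrow> sqrt (deriv p (R \<xi>)) \<le> sqrt (deriv p (R \<eta>))"
  using deriv_pressure_mono density_pos by simp

text \<open>
  Rarefaction waves spread: in a 1-wave \<open>U = \<xi> + c\<close>, where \<open>c\<close> is the sound speed. If \<open>U' < 0\<close>, mass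
  balance gives \<open>R' > 0\<close>, so that \<open>c\<close> does not decrease to the right of \<open>\<xi>\<close>, and \<open>U = \<xi> + c\<close> increases
  there, a contradiction. The 2-wave is symmetric with \<open>U = \<xi> - c\<close>. Values to the right of \<open>\<xi>\<close> are
  compared because \<open>c\<close> is only continuous and monotone in the density.
\<close>

lemma velocity_profile_expansive:
  "AE \<xi> in lborel. \<forall>R' U'. (R has_real_derivative R') (at \<xi>) \<longrightarrow> (U has_real_derivative U') (at \<xi>) \<longrightarrow>
     (U \<xi> - \<xi>) * R' + R \<xi> * U' = 0 \<longrightarrow> U' \<ge> 0"
proof -
  obtain x1 x2 x3 x4 rhoM uM where x: "x1 \<le> x2" "x2 \<le> x3" "x3 \<le> x4"
    and left: "\<forall>\<xi>. \<xi> \<le> x1 \<longrightarrow> R \<xi> = rhoL \<and> U \<xi> = uL"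
    and wave1: "\<forall>\<xi>. x1 < \<xi> \<and> \<xi> < x2 \<longrightarrow> U \<xi> - sqrt (deriv p (R \<xi>)) = \<xi>"
    and mid: "\<forall>\<xi>. x2 \<le> \<xi> \<and> \<xi> \<le> x3 \<longrightarrow> R \<xi> = rhoM \<and> U \<xi> = uM"
    and wave2: "\<forall>\<xi>. x3 < \<xi> \<and> \<xi> < x4 \<longrightarrow> U \<xi> + sqrt (deriv p (R \<xi>)) = \<xi>"
    and right: "\<forall>\<xi>. x4 \<le> \<xi> \<longrightarrow> R \<xi> = rhoR \<and> U \<xi> = uR"
    by (rule wave_structure)
  have "AE \<xi> in lborel. \<xi> \<noteq> x1 \<and> \<xi> \<noteq> x2 \<and> \<xi> \<noteq> x3 \<and> \<xi> \<noteq> x4"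
    using AE_lborel_singleton by (intro AE_conjI) auto
  then show ?thesis
  proof (eventually_elim, intro allI impI)
    fix \<xi> R' U'
    assume ne: "\<xi> \<noteq> x1 \<and> \<xi> \<noteq> x2 \<and> \<xi> \<noteq> x3 \<and> \<xi> \<noteq> x4"
      and R': "(R has_real_derivative R') (at \<xi>)" and U': "(U has_real_derivative U') (at \<xi>)"
      and mass: "(U \<xi> - \<xi>) * R' + R \<xi> * U' = 0"
    let ?c = "\<lambda>\<xi>. sqrt (deriv p (R \<xi>))"
    have c: "?c \<xi> > 0"
      using deriv_pos density_pos by simp
    have "\<xi> < x1 \<or> x1 < \<xi> \<and> \<xi> < x2 \<or> x2 < \<xi> \<and> \<xi> < x3 \<or> x3 < \<xi> \<and> \<xi> < x4 \<or> x4 < \<xi>"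
      using ne by linarith
    then consider "\<xi> \<in> {..<x1}" | "\<xi> \<in> {x1<..<x2}" | "\<xi> \<in> {x2<..<x3}" | "\<xi> \<in> {x3<..<x4}" | "\<xi> \<in> {x4<..}"
      by (auto simp del: not_less)
    then show "U' \<ge> 0"
    proof cases
      case 1
      then show ?thesis
        using DERIV_const_on_open[OF U', of "{..<x1}" uL] left by auto
    next
      case 2
      show ?thesis
      proof (rule ccontr)
        assume "\<not> U' \<ge> 0"
        then have neg: "U' < 0"
          by simp
        have "U \<xi> - \<xi> = ?c \<xi>"
          using wave1[rule_format, of \<xi>] 2 by simp
        then have "?c \<xi> * R' = R \<xi> * (- U')"
          using mass by simp
        also have "\<dots> > 0"
          using neg density_pos by (intro mult_pos_pos) auto
        finally have "R' > 0"
          using c by (simp add: zero_less_mult_iff)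
        then obtain d1 where d1: "d1 > 0" "\<And>h. 0 < h \<Longrightarrow> h < d1 \<Longrightarrow> R \<xi> < R (\<xi> + h)"
          using DERIV_pos_inc_right[OF R'] by blast
        obtain d2 where d2: "d2 > 0" "\<And>h. 0 < h \<Longrightarrow> h < d2 \<Longrightarrow> U (\<xi> + h) < U \<xi>"
          using DERIV_neg_dec_right[OF U' neg] by blast
        define h where "h = min (min d1 d2) (x2 - \<xi>) / 2"
        have h: "0 < h" "h < d1" "h < d2" "h < x2 - \<xi>"
          using d1 d2 2 by (auto simp: h_def)
        have "?c \<xi> \<le> ?c (\<xi> + h)"
          using d1(2)[of h] h by (intro sound_speed_mono) auto
        moreover have "U (\<xi> + h) - ?c (\<xi> + h) = \<xi> + h" "U \<xi> - ?c \<xi> = \<xi>"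
          using wave1[rule_format, of "\<xi> + h"] wave1[rule_format, of \<xi>] 2 h by auto
        ultimately show False
          using d2(2)[of h] h by linarith
      qed
    next
      case 3
      then show ?thesis
        using DERIV_const_on_open[OF U', of "{x2<..<x3}" uM] mid by auto
    next
      case 4
      show ?thesis
      proof (rule ccontr)
        assume "\<not> U' \<ge> 0"
        then have neg: "U' < 0"
          by simp
        have "U \<xi> - \<xi> = - ?c \<xi>"
          using wave2[rule_format, of \<xi>] 4 by simp
        then have "?c \<xi> * R' = R \<xi> * U'"
          using mass by simp
        also have "\<dots> < 0"
          using neg density_pos by (intro mult_pos_neg) auto
        finally have "R' < 0"
          using c by (simp add: mult_less_0_iff)
        then obtain d1 where d1: "d1 > 0" "\<And>h. 0 < h \<Longrightarrow> h < d1 \<Longrightarrow> R (\<xi> + h) < R \<xi>"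
          using DERIV_neg_dec_right[OF R'] by blast
        obtain d2 where d2: "d2 > 0" "\<And>h. 0 < h \<Longrightarrow> h < d2 \<Longrightarrow> U (\<xi> + h) < U \<xi>"
          using DERIV_neg_dec_right[OF U' neg] by blast
        define h where "h = min (min d1 d2) (x4 - \<xi>) / 2"
        have h: "0 < h" "h < d1" "h < d2" "h < x4 - \<xi>"
          using d1 d2 4 by (auto simp: h_def)
        have "?c (\<xi> + h) \<le> ?c \<xi>"
          using d1(2)[of h] h by (intro sound_speed_mono) auto
        moreover have "U (\<xi> + h) + ?c (\<xi> + h) = \<xi> + h" "U \<xi> + ?c \<xi> = \<xi>"
          using wave2[rule_format, of "\<xi> + h"] wave2[rule_format, of \<xi>] 4 h by auto
        ultimately show False
          using d2(2)[of h] h by linarith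
      qed
    next
      case 5
      then show ?thesis
        using DERIV_const_on_open[OF U', of "{x4<..}" uR] right by auto
    qed
  qed
qed

text \<open>
  The coefficient of the density in the expansion of the relative energy, which is the test function
  for the continuity equation. Up to the sign it is the derivative of the energy of the rarefaction
  wave with respect to the density at fixed momentum.
\<close>

definition entropy_profile :: "real \<Rightarrow> real" where
  "entropy_profile \<xi> = U \<xi> * U \<xi> / 2 - potential_slope p (R \<xi>)"

definition pressure_profile :: "real \<Rightarrow> real" where
  "pressure_profile \<xi> = p (R \<xi>)"

definition flux_profile :: "real \<Rightarrow> real" where
  "flux_profile \<xi> = p (R \<xi>) * U \<xi>"

lemma bounded_lipschitz_velocity: "bounded_lipschitz U"
proof -
  obtain L where "L-lipschitz_on UNIV U"
    by (rule profiles_lipschitz)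
  moreover obtain K where "\<And>\<xi>. \<bar>U \<xi>\<bar> \<le> K"
    using profiles_bounded by blast
  ultimately show ?thesis
    unfolding bounded_lipschitz_def by blast
qed

lemma bounded_lipschitz_of_density:
  assumes g: "\<And>r. r > 0 \<Longrightarrow> (g has_real_derivative g' r) (at r)" and g': "continuous_on {0<..} g'"
  shows "bounded_lipschitz (\<lambda>\<xi>. g (R \<xi>))"
proof -
  obtain L where L: "L-lipschitz_on UNIV R"
    by (rule profiles_lipschitz)
  obtain K where K: "\<And>\<xi>. \<bar>R \<xi>\<bar> \<le> K"
    using profiles_bounded by blast
  obtain c where c: "c > 0" "\<And>\<xi>. c \<le> R \<xi>"
    using density_lower_bound by blast
  show ?thesis
  proof (rule bounded_lipschitz_compose[OF L, where c = c and d = K and g' = g'])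
    show "R \<xi> \<in> {c..K}" for \<xi>
      using c(2)[of \<xi>] K[of \<xi>] by auto
    show "continuous_on {c..K} g'"
      using c(1) by (intro continuous_on_subset[OF g']) auto
  qed (use c(1) in \<open>auto intro!: g\<close>)
qed

lemma bounded_lipschitz_pressure_profile: "bounded_lipschitz pressure_profile"
  unfolding pressure_profile_def[abs_def]
  by (rule bounded_lipschitz_of_density[OF pressure_deriv continuous_on_deriv_pressure])

lemma bounded_lipschitz_flux_profile: "bounded_lipschitz flux_profile"
  unfolding flux_profile_def[abs_def]
  by (rule bounded_lipschitz_mult[OF bounded_lipschitz_pressure_profile[unfolded pressure_profile_def[abs_def]]
        bounded_lipschitz_velocity])

lemma bounded_lipschitz_entropy_profile: "bounded_lipschitz entropy_profile"
proof -
  have "bounded_lipschitz (\<lambda>\<xi>. potential_slope p (R \<xi>))"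
    by (rule bounded_lipschitz_of_density[OF potential_slope_deriv])
      (auto intro!: continuous_intros continuous_on_deriv_pressure)
  moreover have "bounded_lipschitz (\<lambda>_. 1/2)"
    unfolding bounded_lipschitz_def
    by (intro conjI exI[of _ 0] exI[of _ "1/2"]) (auto simp: lipschitz_on_def)
  ultimately have "bounded_lipschitz (\<lambda>\<xi>. (1/2) * (U \<xi> * U \<xi>) - potential_slope p (R \<xi>))"
    by (intro bounded_lipschitz_diff bounded_lipschitz_mult bounded_lipschitz_velocity)
  then show ?thesis
    by (simp add: entropy_profile_def[abs_def])
qed

text \<open>
  The pointwise algebra behind the relative energy inequality. The left-hand side collects, for the state
  \<open>(r, v)\<close> with pressure \<open>q\<close>, the integrands of the continuity law tested with \<open>U\<^sup>2/2 - H'(R)\<close>, minus the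
  momentum law tested with \<open>U\<close>, plus the time derivative of \<open>p(R)\<close> and the space derivative of
  \<open>p(R) U\<close>. The wave equations turn this sum into \<open>- U'\<close> times a quantity which is nonnegative for
  convex pressure. Besides the two given equations their consequence \<open>(U - \<xi>)\<^sup>2 U' = p'(R) U'\<close> is used,
  i.e. that the wave travels along characteristics.
\<close>

lemma entropy_production_identity:
  fixes r v q R0 U0 R' U' p0 p' \<xi> :: real
  assumes R0: "R0 > 0" and 1: "(U0 - \<xi>) * R' + R0 * U' = 0"
    and 2: "R0 * (U0 - \<xi>) * U' + p' * R' = 0"
  shows "(r * v - \<xi> * r) * (U0 * U' - p' / R0 * R') - ((r * v^2 + q) - \<xi> * (r * v)) * U'
       - \<xi> * (p' * R') + (p' * R' * U0 + p0 * U')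
    = - (r * (v - U0)^2 + (q - p0 - p' * (r - R0))) * U'"
proof -
  have a: "p' / R0 * R' = - ((U0 - \<xi>) * U')"
    using 2 R0 by (simp add: field_simps)
  have b: "(U0 - \<xi>) * (p' * R') = - (p' * R0 * U')"
  proof -
    have "(U0 - \<xi>) * (p' * R') = p' * ((U0 - \<xi>) * R' + R0 * U') - p' * R0 * U'"
      by (simp add: algebra_simps)
    then show ?thesis
      unfolding 1 by simp
  qed
  \<comment> \<open>Multiplied by the density, the two sides differ by a combination of the two wave equations.\<close>
  have c: "(U0 - \<xi>)^2 * U' = p' * U'"
  proof -
    have "R0 * ((U0 - \<xi>)^2 * U') = (U0 - \<xi>) * (R0 * (U0 - \<xi>) * U' + p' * R') - (U0 - \<xi>) * (p' * R')"
      by (simp add: algebra_simps power2_eq_square)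
    also have "\<dots> = R0 * (p' * U')"
      unfolding 2 b by simp
    finally show ?thesis
      using R0 by simp
  qed
  have "(r * v - \<xi> * r) * (U0 * U' - p' / R0 * R') - ((r * v^2 + q) - \<xi> * (r * v)) * U'
       - \<xi> * (p' * R') + (p' * R' * U0 + p0 * U')
    = (r * v - \<xi> * r) * (U0 * U' - p' / R0 * R') - ((r * v^2 + q) - \<xi> * (r * v)) * U'
       + (U0 - \<xi>) * (p' * R') + p0 * U'"
    by (simp add: algebra_simps)
  also have "\<dots> = - (r * (v - U0)^2 + (q - p0 - p' * (r - R0))) * U'
      + r * ((U0 - \<xi>)^2 * U' - p' * U')"
    unfolding a b by (simp add: algebra_simps power2_eq_square)
  finally show ?thesis
    unfolding c by simp
qed

lemma DERIV_profiles:
  assumes R': "(R has_real_derivative R') (at \<xi>)" and U': "(U has_real_derivative U') (at \<xi>)"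
  shows "(pressure_profile has_real_derivative deriv p (R \<xi>) * R') (at \<xi>)"
    and "(flux_profile has_real_derivative deriv p (R \<xi>) * R' * U \<xi> + p (R \<xi>) * U') (at \<xi>)"
    and "(entropy_profile has_real_derivative U \<xi> * U' - deriv p (R \<xi>) / R \<xi> * R') (at \<xi>)"
proof -
  show P: "(pressure_profile has_real_derivative deriv p (R \<xi>) * R') (at \<xi>)"
    unfolding pressure_profile_def[abs_def]
    by (rule DERIV_chain2[where f = p and g = R and x = \<xi>, OF pressure_deriv[OF density_pos] R'])
  have "((\<lambda>\<xi>. pressure_profile \<xi> * U \<xi>) has_real_derivative
      deriv p (R \<xi>) * R' * U \<xi> + U' * pressure_profile \<xi>) (at \<xi>)"
    by (rule DERIV_mult[OF P U'])
  then show "(flux_profile has_real_derivative deriv p (R \<xi>) * R' * U \<xi> + p (R \<xi>) * U') (at \<xi>)"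
    by (simp add: flux_profile_def[abs_def] pressure_profile_def mult.commute)
  have "((\<lambda>\<xi>. U \<xi> * U \<xi> / 2 - potential_slope p (R \<xi>)) has_real_derivative
      (U' * U \<xi> + U' * U \<xi>) / 2 - deriv p (R \<xi>) / R \<xi> * R') (at \<xi>)"
    by (intro DERIV_diff DERIV_cdivide DERIV_mult U'
        DERIV_chain2[where f = "potential_slope p" and g = R and x = \<xi>, OF potential_slope_deriv[OF density_pos] R'])
  then show "(entropy_profile has_real_derivative U \<xi> * U' - deriv p (R \<xi>) / R \<xi> * R') (at \<xi>)"
    by (simp add: entropy_profile_def[abs_def] mult.commute)
qed

lemma entropy_production:
  "AE \<xi> in lborel.
     (\<exists>D. (U has_real_derivative D) (at \<xi>)) \<and> (\<exists>D. (entropy_profile has_real_derivative D) (at \<xi>)) \<and>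
     (\<exists>D. (pressure_profile has_real_derivative D) (at \<xi>)) \<and> (\<exists>D. (flux_profile has_real_derivative D) (at \<xi>)) \<and>
     (\<forall>r v. r \<ge> 0 \<longrightarrow>
        (r * v - \<xi> * r) * slope entropy_profile \<xi> - ((r * v^2 + p r) - \<xi> * (r * v)) * slope U \<xi>
          - \<xi> * slope pressure_profile \<xi> + slope flux_profile \<xi> \<le> 0)"
  using profile_equations velocity_profile_expansive
proof eventually_elim
  case (elim \<xi>)
  then obtain R' U' where R': "(R has_real_derivative R') (at \<xi>)" and U': "(U has_real_derivative U') (at \<xi>)"
    and mass: "(U \<xi> - \<xi>) * R' + R \<xi> * U' = 0"
    and mom: "R \<xi> * (U \<xi> - \<xi>) * U' + deriv p (R \<xi>) * R' = 0"
    by blast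
  then have "U' \<ge> 0"
    using elim(2) by blast
  note derivs = DERIV_profiles[OF R' U']
  have "(r * v - \<xi> * r) * slope entropy_profile \<xi> - ((r * v^2 + p r) - \<xi> * (r * v)) * slope U \<xi>
          - \<xi> * slope pressure_profile \<xi> + slope flux_profile \<xi> \<le> 0" if r: "r \<ge> 0" for r v
  proof -
    have "0 \<le> r * (v - U \<xi>)^2 + (p r - p (R \<xi>) - deriv p (R \<xi>) * (r - R \<xi>))"
      using pressure_tangent[OF density_pos r, of \<xi>] r by (intro add_nonneg_nonneg) auto
    then have "0 \<le> (r * (v - U \<xi>)^2 + (p r - p (R \<xi>) - deriv p (R \<xi>) * (r - R \<xi>))) * U'"
      using \<open>U' \<ge> 0\<close> by (rule mult_nonneg_nonneg)
    then show ?thesis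
      unfolding slope_eq[OF U'] derivs[THEN slope_eq]
        entropy_production_identity[OF density_pos mass mom] by linarith
  qed
  with U' derivs show ?case
    by blast
qed

end

section \<open>Weak solutions tested with self-similar profiles\<close>

text \<open>
  A weak solution together with Borel functions \<open>\<rho>\<close>, \<open>(v1, v2)\<close> that represent its density and velocity
  almost everywhere and obey the bounds everywhere. With these representatives every time slice is
  measurable and bounded.
\<close>

locale weak_solution = rarefaction p T a rhoL rhoR uL uR R U
  for p :: "real \<Rightarrow> real" and T a rhoL rhoR uL uR :: real and R U :: "real \<Rightarrow> real" +
  fixes l C :: real and rho :: "real \<Rightarrow> real \<times> real \<Rightarrow> real"
    and u :: "real \<Rightarrow> real \<times> real \<Rightarrow> real \<times> real"
    and r :: "real \<Rightarrow> real \<times> real \<Rightarrow> real"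
    and m :: "real \<Rightarrow> real \<times> real \<Rightarrow> real \<times> real"
    and \<rho> v1 v2 :: "real \<times> real \<times> real \<Rightarrow> real"
  assumes l: "l > 0"
    and measurable_rep: "\<rho> \<in> borel_measurable borel" "v1 \<in> borel_measurable borel" "v2 \<in> borel_measurable borel"
    and bounds: "\<And>z. 0 \<le> \<rho> z" "\<And>z. \<rho> z \<le> C" "\<And>z. \<bar>v1 z\<bar> \<le> C" "\<And>z. \<bar>v2 z\<bar> \<le> C"
    and rep: "AE z in lborel. z \<in> {0<..<T} \<times> Omega a l \<longrightarrow>
      rho (fst z) (snd z) = \<rho> z \<and> u (fst z) (snd z) = (v1 z, v2 z)"
    and r: "weakly_continuous_rep T (Omega a l) rho r"
    and m: "weakly_continuous_rep T (Omega a l) (\<lambda>t x. rho t x *\<^sub>R u t x) m"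
    and continuity: "weak_continuity_eq T a l rhoL rhoR uL uR rho u r"
    and momentum: "weak_momentum_eq p T a l rhoL rhoR uL uR rho u m"
    and energy_ineq: "energy_inequality p T a l rhoL rhoR uL uR rho u"
begin

lemmas [measurable] = measurable_rep

lemma C_nonneg: "C \<ge> 0"
  using bounds(1,2) order_trans by blast

text \<open>
  The times at which the weakly continuous representatives coincide with the solution and the energy
  inequality holds. Almost every time is regular, and only regular times matter for an assertion that
  holds almost everywhere.
\<close>

definition regular_time :: "real \<Rightarrow> bool" where
  "regular_time \<tau> \<longleftrightarrow> 0 < \<tau> \<and> \<tau> < T \<and>
     (AE x in lborel. x \<in> Omega a l \<longrightarrow> rho \<tau> x = \<rho> (\<tau>, x) \<and> u \<tau> x = (v1 (\<tau>, x), v2 (\<tau>, x))) \<and>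
     (AE x in lborel. x \<in> Omega a l \<longrightarrow> r \<tau> x = \<rho> (\<tau>, x) \<and>
        m \<tau> x = \<rho> (\<tau>, x) *\<^sub>R (v1 (\<tau>, x), v2 (\<tau>, x))) \<and>
     (LINT x:Omega a l|lborel. energy p (\<rho> (\<tau>, x)) (v1 (\<tau>, x), v2 (\<tau>, x)))
       - (LINT x:Omega a l|lborel.
            energy p (riemann_data rhoL rhoR (fst x)) (riemann_data (uL, 0) (uR, 0) (fst x)))
       + (LINT y:{0..\<tau>} \<times> {0..<l}|lborel. (energy p rhoR (uR, 0) + p rhoR) * uR)
       - (LINT y:{0..\<tau>} \<times> {0..<l}|lborel. (energy p rhoL (uL, 0) + p rhoL) * uL) \<le> 0"

lemma borel_measurable_energy:
  assumes [measurable]: "f \<in> borel_measurable M" "g \<in> borel_measurable M" "h \<in> borel_measurable M"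
    and nonneg: "\<And>x. 0 \<le> f x"
  shows "(\<lambda>x. energy p (f x) (g x, h x)) \<in> borel_measurable M"
proof -
  note [measurable] = borel_measurable_H
  have "(\<lambda>x. 1/2 * f x * ((g x)^2 + (h x)^2) + H p (max 0 (f x))) \<in> borel_measurable M"
    by measurable
  also have "(\<lambda>x. 1/2 * f x * ((g x)^2 + (h x)^2) + H p (max 0 (f x))) = (\<lambda>x. energy p (f x) (g x, h x))"
    using nonneg by (simp add: fun_eq_iff energy_def norm_Pair max_absorb2)
  finally show ?thesis .
qed

lemma borel_measurable_riemann_data: "(\<lambda>x::real \<times> real. riemann_data b c (fst x) :: real) \<in> borel_measurable borel"
  unfolding riemann_data_def by measurable

lemma densities_pos: "rhoL > 0" "rhoR > 0"
proof -
  have "R (- a / (T / 2)) = rhoL" "R (a / (T / 2)) = rhoR"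
    using far_left[rule_format, of "T / 2" "- a"] far_right[rule_format, of "T / 2" a] T
    by (simp_all only: self_similar_def) auto
  then show "rhoL > 0" "rhoR > 0"
    using density_pos by metis+
qed

lemma riemann_velocity: "riemann_data (b, 0) (c, 0) s = (riemann_data b c s, 0)"
  by (simp add: riemann_data_def)

lemma AE_regular_time: "AE \<tau> in lborel. \<tau> \<in> {0<..<T} \<longrightarrow> regular_time \<tau>"
proof -
  have "AE z in lborel \<Otimes>\<^sub>M lborel. z \<in> {0<..<T} \<times> Omega a l \<longrightarrow>
      rho (fst z) (snd z) = \<rho> z \<and> u (fst z) (snd z) = (v1 z, v2 z)"
    unfolding lborel_prod by (rule rep)
  from lborel_pair.AE_pair[OF this]
  have slices: "AE \<tau> in lborel. AE x in lborel. (\<tau>, x) \<in> {0<..<T} \<times> Omega a l \<longrightarrow>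
      rho \<tau> x = \<rho> (\<tau>, x) \<and> u \<tau> x = (v1 (\<tau>, x), v2 (\<tau>, x))"
    by simp
  have r': "AE t in lborel. t \<in> {0<..<T} \<longrightarrow> (AE x in lborel. x \<in> Omega a l \<longrightarrow> r t x = rho t x)"
    using r by (simp add: weakly_continuous_rep_def AE_restrict_space_iff AE_completion_iff)
  have m': "AE t in lborel. t \<in> {0<..<T} \<longrightarrow> (AE x in lborel. x \<in> Omega a l \<longrightarrow> m t x = rho t x *\<^sub>R u t x)"
    using m by (simp add: weakly_continuous_rep_def AE_restrict_space_iff AE_completion_iff)
  have e: "AE \<tau> in lborel. \<tau> \<in> {0<..<T} \<longrightarrow>
        (LINT x:Omega a l|lebesgue. energy p (rho \<tau> x) (u \<tau> x))
        - (LINT x:Omega a l|lebesgue.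
             energy p (riemann_data rhoL rhoR (fst x)) (riemann_data (uL, 0) (uR, 0) (fst x)))
        + (LINT (t, x2):{0..\<tau>} \<times> {0..<l}|lebesgue. (energy p rhoR (uR, 0) + p rhoR) * uR)
        - (LINT (t, x2):{0..\<tau>} \<times> {0..<l}|lebesgue. (energy p rhoL (uL, 0) + p rhoL) * uL)
        \<le> 0"
    using energy_ineq by (simp only: energy_inequality_def AE_restrict_space_iff AE_completion_iff)
      (simp add: AE_restrict_space_iff AE_completion_iff)
  have const: "(LINT (t, x2):{0..\<tau>} \<times> {0..<l}|lebesgue. c) = (LINT y:{0..\<tau>} \<times> {0..<l}|lborel. c)"
    for c \<tau> :: real
    by (rule set_integral_lebesgue_eq_lborel) auto
  have init: "(LINT x:Omega a l|lebesgue.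
        energy p (riemann_data rhoL rhoR (fst x)) (riemann_data (uL, 0) (uR, 0) (fst x)))
      = (LINT x:Omega a l|lborel.
        energy p (riemann_data rhoL rhoR (fst x)) (riemann_data (uL, 0) (uR, 0) (fst x)))"
  proof (rule set_integral_lebesgue_eq_lborel)
    show "(\<lambda>x::real \<times> real. energy p (riemann_data rhoL rhoR (fst x)) (riemann_data (uL, 0) (uR, 0) (fst x)))
        \<in> borel_measurable borel"
      unfolding riemann_velocity
      by (rule borel_measurable_energy[OF borel_measurable_riemann_data
            borel_measurable_riemann_data borel_measurable_const])
        (use densities_pos in \<open>simp add: riemann_data_def\<close>)
  qed auto
  from slices r' m' e show ?thesis
  proof (eventually_elim, intro impI)
    fix \<tau> assume \<tau>: "\<tau> \<in> {0<..<T}"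
      and 1: "AE x in lborel. (\<tau>, x) \<in> {0<..<T} \<times> Omega a l \<longrightarrow>
          rho \<tau> x = \<rho> (\<tau>, x) \<and> u \<tau> x = (v1 (\<tau>, x), v2 (\<tau>, x))"
      and 2: "\<tau> \<in> {0<..<T} \<longrightarrow> (AE x in lborel. x \<in> Omega a l \<longrightarrow> r \<tau> x = rho \<tau> x)"
      and 3: "\<tau> \<in> {0<..<T} \<longrightarrow> (AE x in lborel. x \<in> Omega a l \<longrightarrow> m \<tau> x = rho \<tau> x *\<^sub>R u \<tau> x)"
      and 4: "\<tau> \<in> {0<..<T} \<longrightarrow>
        (LINT x:Omega a l|lebesgue. energy p (rho \<tau> x) (u \<tau> x))
        - (LINT x:Omega a l|lebesgue.
             energy p (riemann_data rhoL rhoR (fst x)) (riemann_data (uL, 0) (uR, 0) (fst x)))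
        + (LINT (t, x2):{0..\<tau>} \<times> {0..<l}|lebesgue. (energy p rhoR (uR, 0) + p rhoR) * uR)
        - (LINT (t, x2):{0..\<tau>} \<times> {0..<l}|lebesgue. (energy p rhoL (uL, 0) + p rhoL) * uL)
        \<le> 0"
    have slice: "AE x in lborel. x \<in> Omega a l \<longrightarrow> rho \<tau> x = \<rho> (\<tau>, x) \<and> u \<tau> x = (v1 (\<tau>, x), v2 (\<tau>, x))"
      using 1 \<tau> by simp
    moreover have "AE x in lborel. x \<in> Omega a l \<longrightarrow> r \<tau> x = \<rho> (\<tau>, x) \<and>
        m \<tau> x = \<rho> (\<tau>, x) *\<^sub>R (v1 (\<tau>, x), v2 (\<tau>, x))"
      using slice 2[rule_format, OF \<tau>] 3[rule_format, OF \<tau>] by eventually_elim simp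
    moreover have "(LINT x:Omega a l|lebesgue. energy p (rho \<tau> x) (u \<tau> x))
        = (LINT x:Omega a l|lborel. energy p (\<rho> (\<tau>, x)) (v1 (\<tau>, x), v2 (\<tau>, x)))"
    proof (rule set_integral_lebesgue_eq_lborel)
      show "(\<lambda>x. energy p (\<rho> (\<tau>, x)) (v1 (\<tau>, x), v2 (\<tau>, x))) \<in> borel_measurable borel"
        by (intro borel_measurable_energy bounds) measurable
      show "AE x in lborel. x \<in> Omega a l \<longrightarrow>
          energy p (rho \<tau> x) (u \<tau> x) = energy p (\<rho> (\<tau>, x)) (v1 (\<tau>, x), v2 (\<tau>, x))"
        using slice by eventually_elim simp
    qed auto
    ultimately show "regular_time \<tau>"
      using 4[rule_format, OF \<tau>] \<tau> unfolding regular_time_def const init by simp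
  qed
qed

lemma AE_slab_representative:
  assumes "\<tau> < T"
  shows "AE z in lborel. z \<in> {0..\<tau>} \<times> Omega a l \<longrightarrow>
    rho (fst z) (snd z) = \<rho> z \<and> u (fst z) (snd z) = (v1 z, v2 z)"
  using rep AE_lborel_fst_neq[of 0]
  by eventually_elim (use assms in \<open>auto simp: mem_Times_iff\<close>)

text \<open>
  At a regular time the weakly continuous representative is a slice of \<open>\<rho>\<close>, which turns the weak
  continuity equation, for test functions of the similarity variable, into a scalar balance law.
\<close>

lemma continuity_balance_law:
  assumes \<tau>: "regular_time \<tau>" and pos: "\<epsilon> > 0"
    and F: "\<And>x. (F has_real_derivative F' x) (at x)" "continuous_on UNIV F'"
  shows "balance_law \<tau> a l \<epsilon> (\<lambda>x. \<rho> (\<tau>, x)) (\<lambda>x. riemann_data rhoL rhoR (fst x))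
    (rhoL * uL) (rhoR * uR) \<rho> (\<lambda>z. \<rho> z * v1 z) F F'"
proof -
  let ?\<phi> = "\<lambda>z. F (ray \<epsilon> z)"
  let ?q = "\<lambda>z. F' (ray \<epsilon> z) / (fst z + \<epsilon>)"
  let ?G = "\<lambda>z. (- ray \<epsilon> z * ?q z, ?q z, 0::real)"
  have \<tau>T: "0 < \<tau>" "\<tau> < T"
    using \<tau> by (auto simp: regular_time_def)
  have [measurable]: "F \<in> borel_measurable borel"
    by (intro borel_measurable_continuous_onI continuous_at_imp_continuous_on ballI DERIV_isCont[OF F(1)])
  note [measurable] = borel_measurable_continuous_onI[OF F(2)] borel_measurable_riemann_data
  have "C1_test T a l ?\<phi> ?G"
    using F pos by (rule C1_test_ray)
  then have "(LINT x:Omega a l|lebesgue. r \<tau> x * ?\<phi> (\<tau>, x) - riemann_data rhoL rhoR (fst x) * ?\<phi> (0, x))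
        + (LINT (t, x2):{0..\<tau>} \<times> {0..<l}|lebesgue. rhoR * uR * ?\<phi> (t, a, x2))
        - (LINT (t, x2):{0..\<tau>} \<times> {0..<l}|lebesgue. rhoL * uL * ?\<phi> (t, -a, x2))
        = (LINT (t, x):{0..\<tau>} \<times> Omega a l|lebesgue.
             rho t x * fst (?G (t, x)) + (rho t x *\<^sub>R u t x) \<bullet> snd (?G (t, x)))"
    using continuity[unfolded weak_continuity_eq_def, rule_format, of \<tau> ?\<phi> ?G] \<tau>T by simp
  moreover have "(LINT x:Omega a l|lebesgue. r \<tau> x * ?\<phi> (\<tau>, x) - riemann_data rhoL rhoR (fst x) * ?\<phi> (0, x))
      = (LINT x:Omega a l|lborel. \<rho> (\<tau>, x) * F (fst x / (\<tau> + \<epsilon>)) - riemann_data rhoL rhoR (fst x) * F (fst x / \<epsilon>))"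
  proof (rule set_integral_lebesgue_eq_lborel)
    have "AE x in lborel. x \<in> Omega a l \<longrightarrow> r \<tau> x = \<rho> (\<tau>, x)"
      using \<tau> unfolding regular_time_def by auto
    then show "AE x in lborel. x \<in> Omega a l \<longrightarrow>
        r \<tau> x * ?\<phi> (\<tau>, x) - riemann_data rhoL rhoR (fst x) * ?\<phi> (0, x)
        = \<rho> (\<tau>, x) * F (fst x / (\<tau> + \<epsilon>)) - riemann_data rhoL rhoR (fst x) * F (fst x / \<epsilon>)"
      by eventually_elim (simp add: ray_def)
  qed measurable
  moreover have "(LINT (t, x2):{0..\<tau>} \<times> {0..<l}|lebesgue. c * ?\<phi> (t, b, x2))
      = (LINT y:{0..\<tau>} \<times> {0..<l}|lborel. c * F (b / (fst y + \<epsilon>)))" for b c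
  proof (rule set_integral_lebesgue_eq_lborel)
    show "(\<lambda>y::real \<times> real. c * F (b / (fst y + \<epsilon>))) \<in> borel_measurable borel"
      by measurable
  qed (auto simp: ray_def)
  moreover have "(LINT (t, x):{0..\<tau>} \<times> Omega a l|lebesgue.
             rho t x * fst (?G (t, x)) + (rho t x *\<^sub>R u t x) \<bullet> snd (?G (t, x)))
      = (LINT z:{0..\<tau>} \<times> Omega a l|lborel. (\<rho> z * v1 z - ray \<epsilon> z * \<rho> z) * ?q z)"
  proof (rule set_integral_lebesgue_eq_lborel)
    show "AE z in lborel. z \<in> {0..\<tau>} \<times> Omega a l \<longrightarrow>
        (case z of (t, x) \<Rightarrow> rho t x * fst (?G (t, x)) + (rho t x *\<^sub>R u t x) \<bullet> snd (?G (t, x)))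
        = (\<rho> z * v1 z - ray \<epsilon> z * \<rho> z) * ?q z"
      using AE_slab_representative[OF \<tau>T(2)]
      by eventually_elim (auto simp: inner_prod_def algebra_simps)
  qed measurable
  ultimately show ?thesis
    unfolding balance_law_def by simp
qed

lemma borel_measurable_pressure_density: "(\<lambda>z. p (\<rho> z)) \<in> borel_measurable borel"
proof -
  note [measurable] = borel_measurable_pressure
  have "(\<lambda>z. p (max 0 (\<rho> z))) \<in> borel_measurable borel"
    by measurable
  then show ?thesis
    using bounds(1) by (simp add: max_absorb2)
qed

lemma momentum_balance_law:
  assumes \<tau>: "regular_time \<tau>" and pos: "\<epsilon> > 0"
    and F: "\<And>x. (F has_real_derivative F' x) (at x)" "continuous_on UNIV F'"
  shows "balance_law \<tau> a l \<epsilon> (\<lambda>x. \<rho> (\<tau>, x) * v1 (\<tau>, x))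
    (\<lambda>x. riemann_data rhoL rhoR (fst x) * riemann_data uL uR (fst x))
    (rhoL * uL^2 + p rhoL) (rhoR * uR^2 + p rhoR)
    (\<lambda>z. \<rho> z * v1 z) (\<lambda>z. \<rho> z * (v1 z)^2 + p (\<rho> z)) F F'"
proof -
  let ?\<phi> = "\<lambda>z. F (ray \<epsilon> z)"
  let ?q = "\<lambda>z. F' (ray \<epsilon> z) / (fst z + \<epsilon>)"
  let ?G = "\<lambda>z. (- ray \<epsilon> z * ?q z, ?q z, 0::real)"
  have \<tau>T: "0 < \<tau>" "\<tau> < T"
    using \<tau> by (auto simp: regular_time_def)
  have [measurable]: "F \<in> borel_measurable borel"
    by (intro borel_measurable_continuous_onI continuous_at_imp_continuous_on ballI DERIV_isCont[OF F(1)])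
  note [measurable] = borel_measurable_continuous_onI[OF F(2)] borel_measurable_riemann_data
    borel_measurable_pressure_density
  have c1: "C1_test T a l ?\<phi> ?G"
    using F pos by (rule C1_test_ray)
  have c2: "C1_test T a l (\<lambda>_. 0) (\<lambda>_. (0, 0, 0))"
    using C1_test_ray[of "\<lambda>_. 0" "\<lambda>_. 0" \<epsilon> T a l] pos by simp
  have t: "\<tau> \<in> {0..T}"
    using \<tau>T by simp
  have law: "(LINT x:Omega a l|lebesgue.
            m \<tau> x \<bullet> (?\<phi> (\<tau>, x), 0)
            - (riemann_data rhoL rhoR (fst x) *\<^sub>R riemann_data (uL, 0) (uR, 0) (fst x)) \<bullet> (?\<phi> (0, x), 0::real))
        + (LINT (t, x2):{0..\<tau>} \<times> {0..<l}|lebesgue. ((rhoR * uR) *\<^sub>R (uR, 0)) \<bullet> (?\<phi> (t, a, x2), 0::real))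
        - (LINT (t, x2):{0..\<tau>} \<times> {0..<l}|lebesgue. ((rhoL * uL) *\<^sub>R (uL, 0)) \<bullet> (?\<phi> (t, -a, x2), 0::real))
        + (LINT (t, x2):{0..\<tau>} \<times> {0..<l}|lebesgue. p rhoR * ?\<phi> (t, a, x2))
        - (LINT (t, x2):{0..\<tau>} \<times> {0..<l}|lebesgue. p rhoL * ?\<phi> (t, -a, x2))
        = (LINT (t, x):{0..\<tau>} \<times> Omega a l|lebesgue.
             (rho t x *\<^sub>R u t x) \<bullet> (fst (?G (t, x)), fst (0::real, 0::real, 0::real))
             + rho t x * (fst (u t x) * (u t x \<bullet> snd (?G (t, x)))
                        + snd (u t x) * (u t x \<bullet> snd (0::real, 0::real, 0::real)))
             + p (rho t x) * (fst (snd (?G (t, x))) + snd (snd (0::real, 0::real, 0::real))))"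
    by (rule momentum[unfolded weak_momentum_eq_def, rule_format, OF t conjI[OF c1 c2]])
  have init: "(LINT x:Omega a l|lebesgue.
            m \<tau> x \<bullet> (?\<phi> (\<tau>, x), 0)
            - (riemann_data rhoL rhoR (fst x) *\<^sub>R riemann_data (uL, 0) (uR, 0) (fst x)) \<bullet> (?\<phi> (0, x), 0::real))
      = (LINT x:Omega a l|lborel. \<rho> (\<tau>, x) * v1 (\<tau>, x) * F (fst x / (\<tau> + \<epsilon>))
            - riemann_data rhoL rhoR (fst x) * riemann_data uL uR (fst x) * F (fst x / \<epsilon>))"
  proof (rule set_integral_lebesgue_eq_lborel)
    have "AE x in lborel. x \<in> Omega a l \<longrightarrow> m \<tau> x = \<rho> (\<tau>, x) *\<^sub>R (v1 (\<tau>, x), v2 (\<tau>, x))"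
      using \<tau> unfolding regular_time_def by auto
    then show "AE x in lborel. x \<in> Omega a l \<longrightarrow>
        m \<tau> x \<bullet> (?\<phi> (\<tau>, x), 0)
            - (riemann_data rhoL rhoR (fst x) *\<^sub>R riemann_data (uL, 0) (uR, 0) (fst x)) \<bullet> (?\<phi> (0, x), 0::real)
        = \<rho> (\<tau>, x) * v1 (\<tau>, x) * F (fst x / (\<tau> + \<epsilon>))
            - riemann_data rhoL rhoR (fst x) * riemann_data uL uR (fst x) * F (fst x / \<epsilon>)"
      by eventually_elim (simp add: ray_def inner_prod_def riemann_velocity)
  qed measurable
  have wall: "(LINT (t, x2):{0..\<tau>} \<times> {0..<l}|lebesgue. c * ?\<phi> (t, b, x2))
      = (LINT y:{0..\<tau>} \<times> {0..<l}|lborel. c * F (b / (fst y + \<epsilon>)))" for b c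
  proof (rule set_integral_lebesgue_eq_lborel)
    show "(\<lambda>y::real \<times> real. c * F (b / (fst y + \<epsilon>))) \<in> borel_measurable borel"
      by measurable
  qed (auto simp: ray_def)
  have flux: "(LINT (t, x2):{0..\<tau>} \<times> {0..<l}|lebesgue. ((d * c) *\<^sub>R (c, 0)) \<bullet> (?\<phi> (t, b, x2), 0::real))
      = (LINT y:{0..\<tau>} \<times> {0..<l}|lborel. (d * c^2) * F (b / (fst y + \<epsilon>)))" for b c d
  proof (rule set_integral_lebesgue_eq_lborel)
    show "(\<lambda>y::real \<times> real. d * c^2 * F (b / (fst y + \<epsilon>))) \<in> borel_measurable borel"
      by measurable
  qed (auto simp: ray_def inner_prod_def power2_eq_square)
  have split: "(LINT y:{0..\<tau>} \<times> {0..<l}|lborel. (c + d) * F (b / (fst y + \<epsilon>)))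
      = (LINT y:{0..\<tau>} \<times> {0..<l}|lborel. c * F (b / (fst y + \<epsilon>)))
        + (LINT y:{0..\<tau>} \<times> {0..<l}|lborel. d * F (b / (fst y + \<epsilon>)))" for b c d
    unfolding set_integral_mult_right by (rule distrib_right)
  have bulk: "(LINT (t, x):{0..\<tau>} \<times> Omega a l|lebesgue.
             (rho t x *\<^sub>R u t x) \<bullet> (fst (?G (t, x)), fst (0::real, 0::real, 0::real))
             + rho t x * (fst (u t x) * (u t x \<bullet> snd (?G (t, x)))
                        + snd (u t x) * (u t x \<bullet> snd (0::real, 0::real, 0::real)))
             + p (rho t x) * (fst (snd (?G (t, x))) + snd (snd (0::real, 0::real, 0::real))))
      = (LINT z:{0..\<tau>} \<times> Omega a l|lborel.
            (\<rho> z * (v1 z)^2 + p (\<rho> z) - ray \<epsilon> z * (\<rho> z * v1 z)) * ?q z)"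
  proof (rule set_integral_lebesgue_eq_lborel)
    show "AE z in lborel. z \<in> {0..\<tau>} \<times> Omega a l \<longrightarrow>
        (case z of (t, x) \<Rightarrow>
             (rho t x *\<^sub>R u t x) \<bullet> (fst (?G (t, x)), fst (0::real, 0::real, 0::real))
             + rho t x * (fst (u t x) * (u t x \<bullet> snd (?G (t, x)))
                        + snd (u t x) * (u t x \<bullet> snd (0::real, 0::real, 0::real)))
             + p (rho t x) * (fst (snd (?G (t, x))) + snd (snd (0::real, 0::real, 0::real))))
        = (\<rho> z * (v1 z)^2 + p (\<rho> z) - ray \<epsilon> z * (\<rho> z * v1 z)) * ?q z"
      using AE_slab_representative[OF \<tau>T(2)]
      by eventually_elim (auto simp: inner_prod_def algebra_simps power2_eq_square)
  qed measurable
  show ?thesis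
    unfolding balance_law_def split using law unfolding init flux wall bulk by linarith
qed

lemma riemann_data_bound: "\<bar>riemann_data b c s\<bar> \<le> \<bar>b\<bar> + \<bar>c::real\<bar>"
  by (simp add: riemann_data_def)

lemma density_bound: "\<bar>\<rho> z\<bar> \<le> C"
  using bounds(1,2)[of z] by simp

lemma momentum_bound: "\<bar>\<rho> z * v1 z\<bar> \<le> C * C"
  unfolding abs_mult by (intro mult_mono density_bound bounds C_nonneg) auto

lemma convective_bound: "\<bar>\<rho> z * (v1 z)^2\<bar> \<le> C * C^2"
proof -
  have "(v1 z)^2 \<le> C^2"
    using bounds(3)[of z] C_nonneg by (simp add: abs_le_square_iff[symmetric])
  then show ?thesis
    unfolding abs_mult using density_bound[of z] C_nonneg by (intro mult_mono) auto
qed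

lemma continuity_law_lipschitz:
  assumes \<tau>: "regular_time \<tau>" and pos: "\<epsilon> > 0"
    and F: "bounded_lipschitz F" "AE x in lborel. \<exists>D. (F has_real_derivative D) (at x)"
  shows "balance_law \<tau> a l \<epsilon> (\<lambda>x. \<rho> (\<tau>, x)) (\<lambda>x. riemann_data rhoL rhoR (fst x))
    (rhoL * uL) (rhoR * uR) \<rho> (\<lambda>z. \<rho> z * v1 z) F (slope F)"
proof (rule balance_law_lipschitz[OF pos _ borel_measurable_riemann_data _ _ _ _ _ _
      continuity_balance_law[OF \<tau> pos] F])
  let ?M = "C + C * C + (\<bar>rhoL\<bar> + \<bar>rhoR\<bar>)"
  have CC: "0 \<le> C * C"
    using C_nonneg by simp
  show "\<bar>\<rho> (\<tau>, x)\<bar> \<le> ?M" for x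
    using density_bound[of "(\<tau>, x)"] CC by linarith
  show "\<bar>riemann_data rhoL rhoR (fst x)\<bar> \<le> ?M" for x :: "real \<times> real"
    using riemann_data_bound[of rhoL rhoR "fst x"] CC C_nonneg by linarith
  show "\<bar>\<rho> z\<bar> \<le> ?M" for z
    using density_bound[of z] CC by linarith
  show "\<bar>\<rho> z * v1 z\<bar> \<le> ?M" for z
    using momentum_bound[of z] C_nonneg by linarith
qed measurable

lemma pressure_density_bounded:
  obtains P where "\<And>z. \<bar>p (\<rho> z)\<bar> \<le> P"
proof -
  have "continuous_on {0..C} p"
    by (rule continuous_on_subset[OF continuous_on_pressure]) simp
  then obtain P where "\<And>y. y \<in> {0..C} \<Longrightarrow> \<bar>p y\<bar> \<le> P"
    using continuous_on_Icc_bounded by blast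
  then have "\<bar>p (\<rho> z)\<bar> \<le> P" for z
    using bounds(1,2)[of z] by simp
  then show ?thesis ..
qed

lemma momentum_law_lipschitz:
  assumes \<tau>: "regular_time \<tau>" and pos: "\<epsilon> > 0"
    and F: "bounded_lipschitz F" "AE x in lborel. \<exists>D. (F has_real_derivative D) (at x)"
  shows "balance_law \<tau> a l \<epsilon> (\<lambda>x. \<rho> (\<tau>, x) * v1 (\<tau>, x))
    (\<lambda>x. riemann_data rhoL rhoR (fst x) * riemann_data uL uR (fst x))
    (rhoL * uL^2 + p rhoL) (rhoR * uR^2 + p rhoR)
    (\<lambda>z. \<rho> z * v1 z) (\<lambda>z. \<rho> z * (v1 z)^2 + p (\<rho> z)) F (slope F)"
proof -
  obtain P where P: "\<And>z. \<bar>p (\<rho> z)\<bar> \<le> P"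
    using pressure_density_bounded by blast
  have P0: "0 \<le> P"
    using order_trans[OF abs_ge_zero P] by blast
  let ?B = "(\<bar>rhoL\<bar> + \<bar>rhoR\<bar>) * (\<bar>uL\<bar> + \<bar>uR\<bar>)"
  let ?M = "C * C + C * C^2 + P + ?B"
  have nonneg: "0 \<le> C * C" "0 \<le> C * C^2" "0 \<le> ?B"
    using C_nonneg by simp_all
  note [measurable] = borel_measurable_pressure_density borel_measurable_riemann_data
  show ?thesis
  proof (rule balance_law_lipschitz[where C = ?M, OF pos _ _ _ _ _ _ _ _ momentum_balance_law[OF \<tau> pos] F])
    show "\<bar>\<rho> (\<tau>, x) * v1 (\<tau>, x)\<bar> \<le> ?M" for x
      using momentum_bound[of "(\<tau>, x)"] nonneg P0 by linarith
    have init: "\<bar>riemann_data rhoL rhoR (fst x) * riemann_data uL uR (fst x)\<bar> \<le> ?B" for x :: "real \<times> real"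
      unfolding abs_mult by (intro mult_mono riemann_data_bound) auto
    show "\<bar>riemann_data rhoL rhoR (fst x) * riemann_data uL uR (fst x)\<bar> \<le> ?M" for x :: "real \<times> real"
      using init[of x] nonneg P0 by linarith
    show "\<bar>\<rho> z * v1 z\<bar> \<le> ?M" for z
      using momentum_bound[of z] nonneg P0 by linarith
    show "\<bar>\<rho> z * (v1 z)^2 + p (\<rho> z)\<bar> \<le> ?M" for z
      using convective_bound[of z] P[of z] nonneg by linarith
  qed measurable
qed

section \<open>The relative energy inequality\<close>

lemma set_integrable_profile:
  assumes "A \<in> borel_measurable borel" "\<And>x. \<bar>A x\<bar> \<le> M" "bounded_lipschitz F"
  shows "set_integrable lborel (Omega a l) (\<lambda>x. A x * F (fst x / s))"
proof -
  obtain K where K: "\<And>x. \<bar>F x\<bar> \<le> K"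
    using assms(3) by (auto simp: bounded_lipschitz_def)
  have M: "0 \<le> M"
    using assms(2)[of undefined] by linarith
  note [measurable] = assms(1) borel_measurable_bounded_lipschitz[OF assms(3)]
  show ?thesis
  proof (rule set_integrable_lborel_bounded[OF Omega_borel bounded_Omega])
    show "\<bar>A x * F (fst x / s)\<bar> \<le> M * K" for x
      unfolding abs_mult by (intro mult_mono assms(2) K M) auto
  qed measurable
qed

lemma energy_bounded:
  obtains B where "\<And>f g h. 0 \<le> f \<Longrightarrow> f \<le> M \<Longrightarrow> \<bar>g\<bar> \<le> M \<Longrightarrow> \<bar>h\<bar> \<le> M \<Longrightarrow> \<bar>energy p f (g, h)\<bar> \<le> B"
proof -
  obtain K where K: "\<And>r. 0 \<le> r \<Longrightarrow> r \<le> M \<Longrightarrow> \<bar>H p r\<bar> \<le> K"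
    using H_bounded by blast
  show ?thesis
  proof (rule that[of "1/2 * M * (M^2 + M^2) + K"])
    fix f g h assume fgh: "0 \<le> f" "f \<le> M" "\<bar>g\<bar> \<le> M" "\<bar>h\<bar> \<le> M"
    have "g^2 \<le> M^2" "h^2 \<le> M^2"
      using fgh by (simp_all add: abs_le_square_iff[symmetric])
    then have "1/2 * f * (g^2 + h^2) \<le> 1/2 * M * (M^2 + M^2)"
      using fgh by (intro mult_mono add_mono) auto
    moreover have "0 \<le> 1/2 * f * (g^2 + h^2)"
      using fgh by simp
    moreover have "energy p f (g, h) = 1/2 * f * (g^2 + h^2) + H p f"
      by (simp add: energy_def norm_Pair)
    ultimately show "\<bar>energy p f (g, h)\<bar> \<le> 1/2 * M * (M^2 + M^2) + K"
      using K[OF fgh(1,2)] by linarith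
  qed
qed

lemma relative_energy_profile:
  "relative_energy p f (g, h) (R \<xi>) (U \<xi>) =
    energy p f (g, h) - f * g * U \<xi> + f * entropy_profile \<xi> + 1 * pressure_profile \<xi>"
  by (simp add: relative_energy_expand[OF density_pos] entropy_profile_def pressure_profile_def
      power2_eq_square)

text \<open>
  The relative energy with respect to a self-similar state is integrated term by term, so that each
  term can be matched with one of the balance laws.
\<close>

lemma relative_energy_integral:
  assumes [measurable]: "f \<in> borel_measurable borel" "g \<in> borel_measurable borel" "h \<in> borel_measurable borel"
    and fgh: "\<And>x. 0 \<le> f x" "\<And>x. f x \<le> M" "\<And>x. \<bar>g x\<bar> \<le> M" "\<And>x. \<bar>h x\<bar> \<le> M"
  shows "(LINT x:Omega a l|lborel. relative_energy p (f x) (g x, h x) (R (fst x / s)) (U (fst x / s)))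
    = (LINT x:Omega a l|lborel. energy p (f x) (g x, h x))
      - (LINT x:Omega a l|lborel. f x * g x * U (fst x / s))
      + (LINT x:Omega a l|lborel. f x * entropy_profile (fst x / s))
      + (LINT x:Omega a l|lborel. 1 * pressure_profile (fst x / s))"
proof -
  have M: "0 \<le> M"
    using fgh(1,2) order_trans by blast
  have f: "\<bar>f x\<bar> \<le> M" for x
    using fgh(1,2)[of x] by simp
  obtain B where B: "\<And>f g h. 0 \<le> f \<Longrightarrow> f \<le> M \<Longrightarrow> \<bar>g\<bar> \<le> M \<Longrightarrow> \<bar>h\<bar> \<le> M \<Longrightarrow> \<bar>energy p f (g, h)\<bar> \<le> B"
    using energy_bounded by blast
  have E: "set_integrable lborel (Omega a l) (\<lambda>x. energy p (f x) (g x, h x))"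
    by (rule set_integrable_lborel_bounded[OF Omega_borel bounded_Omega])
      (auto intro!: borel_measurable_energy B fgh)
  have 1: "set_integrable lborel (Omega a l) (\<lambda>x. f x * g x * U (fst x / s))"
  proof (rule set_integrable_profile[OF _ _ bounded_lipschitz_velocity])
    show "\<bar>f x * g x\<bar> \<le> M * M" for x
      unfolding abs_mult by (intro mult_mono f fgh M) auto
  qed measurable
  have 2: "set_integrable lborel (Omega a l) (\<lambda>x. f x * entropy_profile (fst x / s))"
    by (rule set_integrable_profile[OF _ f bounded_lipschitz_entropy_profile]) measurable
  have 3: "set_integrable lborel (Omega a l) (\<lambda>x. 1 * pressure_profile (fst x / s))"
    by (rule set_integrable_profile[OF _ _ bounded_lipschitz_pressure_profile, where M = 1]) auto
  note E1 = set_integral_diff[OF E 1]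
  note E2 = set_integral_add[OF E1(1) 2]
  note E3 = set_integral_add[OF E2(1) 3]
  show ?thesis
    unfolding relative_energy_profile E3(2) E2(2) E1(2) ..
qed

lemma wall_integral:
  fixes F :: "real \<Rightarrow> real"
  assumes "\<And>y. y \<in> {0..\<tau>} \<times> {0..<l} \<Longrightarrow> F (b / (fst y + \<epsilon>)) = k"
  shows "(LINT y:{0..\<tau>} \<times> {0..<l}|lborel. c * F (b / (fst y + \<epsilon>)))
    = c * k * (LINT y:{0..\<tau>} \<times> {0..<l}|lborel. 1)"
proof -
  have "(LINT y:{0..\<tau>} \<times> {0..<l}|lborel. c * F (b / (fst y + \<epsilon>)))
      = (LINT y:{0..\<tau>} \<times> {0..<l}|lborel. (c * k) * 1)"
  proof (rule set_lebesgue_integral_cong)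
    show "{0..\<tau>} \<times> {0..<l} \<in> sets lborel"
      using wall_borel by simp
    show "\<forall>y. y \<in> {0..\<tau>} \<times> {0..<l} \<longrightarrow> c * F (b / (fst y + \<epsilon>)) = c * k * 1"
      by (intro allI impI) (simp only: assms mult_1_right)
  qed
  then show ?thesis
    unfolding set_integral_mult_right .
qed

lemma far_field:
  assumes "s \<in> {0<..<T}"
  shows "R (- a / s) = rhoL" "U (- a / s) = uL" "R (a / s) = rhoR" "U (a / s) = uR"
  using far_left[rule_format, OF assms, of "- a"] far_right[rule_format, OF assms, of a]
  by (simp_all add: self_similar_def)

text \<open>
  The four contributions at a wall, namely the energy flux and the boundary terms of the laws tested
  with the entropy profile, the velocity profile and \<open>p(R) U\<close>, add up to zero: the far field states of
  the solution and of the wave are the same.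
\<close>

lemma boundary_flux_cancellation:
  assumes "d > 0"
  shows "(energy p d (w, 0) + p d) * w + (d * w) * (w * w / 2 - potential_slope p d)
    - (d * w^2 + p d) * w + p d * w = 0"
proof -
  have "d * potential_slope p d = H p d + p d"
    using assms by (simp add: potential_slope_def)
  moreover have "(d * w) * (w * w / 2 - potential_slope p d) = d * w^2 * w / 2 - (d * potential_slope p d) * w"
    by (simp add: algebra_simps power2_eq_square)
  ultimately have eq: "(d * w) * (w * w / 2 - potential_slope p d) = d * w^2 * w / 2 - (H p d + p d) * w"
    by simp
  show ?thesis
    unfolding eq energy_def by (simp add: norm_Pair algebra_simps power2_eq_square)
qed

lemma AE_differentiable_profiles:
  "AE x in lborel. \<exists>D. (U has_real_derivative D) (at x)"
  "AE x in lborel. \<exists>D. (entropy_profile has_real_derivative D) (at x)"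
  "AE x in lborel. \<exists>D. (pressure_profile has_real_derivative D) (at x)"
  "AE x in lborel. \<exists>D. (flux_profile has_real_derivative D) (at x)"
  using entropy_production by (eventually_elim, blast)+

text \<open>
  The energy inequality is added to the continuity law tested with the entropy profile, and the momentum
  law tested with the velocity profile is subtracted. The difference of the pressure terms at the times
  \<open>\<tau>\<close> and \<open>0\<close> and the remaining boundary terms are written as integrals over space-time by the two
  elementary laws. The sum of the space-time integrals is the entropy production, which is nonpositive,
  and the boundary terms cancel. The condition \<open>\<tau> + \<epsilon> < T\<close> keeps the shifted wave constant at the walls.
\<close>

lemma relative_energy_inequality:
  assumes \<tau>: "regular_time \<tau>" and pos: "\<epsilon> > 0" and small: "\<tau> + \<epsilon> < T"
  shows "(LINT x:Omega a l|lborel. relative_energy p (\<rho> (\<tau>, x)) (v1 (\<tau>, x), v2 (\<tau>, x))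
      (R (fst x / (\<tau> + \<epsilon>))) (U (fst x / (\<tau> + \<epsilon>))))
    \<le> (LINT x:Omega a l|lborel. relative_energy p (riemann_data rhoL rhoR (fst x))
      (riemann_data uL uR (fst x), 0) (R (fst x / \<epsilon>)) (U (fst x / \<epsilon>)))"
proof -
  let ?\<rho>0 = "\<lambda>x::real \<times> real. riemann_data rhoL rhoR (fst x)"
  let ?u0 = "\<lambda>x::real \<times> real. riemann_data uL uR (fst x)"
  let ?W = "LINT y:{0..\<tau>} \<times> {0..<l}|lborel. (1::real)"
  let ?S = "{0..\<tau>} \<times> Omega a l"
  let ?i = "\<lambda>w F. LINT z:?S|lborel. w z * (slope F (ray \<epsilon> z) / (fst z + \<epsilon>))"
  let ?w1 = "\<lambda>z. \<rho> z * v1 z - ray \<epsilon> z * \<rho> z"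
  let ?w2 = "\<lambda>z. \<rho> z * (v1 z)^2 + p (\<rho> z) - ray \<epsilon> z * (\<rho> z * v1 z)"
  let ?w3 = "\<lambda>z. 0 - ray \<epsilon> z * 1"
  let ?w4 = "\<lambda>z. 1 - ray \<epsilon> z * 0"
  have \<tau>T: "0 < \<tau>"
    using \<tau> by (simp add: regular_time_def)
  have s: "fst y + \<epsilon> \<in> {0<..<T}" if "y \<in> {0..\<tau>} \<times> {0..<l}" for y :: "real \<times> real"
    using that pos small by (auto simp: mem_Times_iff)
  note far = far_field[OF s]
  have M: "0 \<le> \<rho> z" "\<rho> z \<le> C" "\<bar>v1 z\<bar> \<le> C" "\<bar>v2 z\<bar> \<le> C" for z
    by (rule bounds)+
  let ?B = "\<bar>rhoL\<bar> + \<bar>rhoR\<bar> + \<bar>uL\<bar> + \<bar>uR\<bar>"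
  have M0: "0 \<le> ?\<rho>0 x" "?\<rho>0 x \<le> ?B" "\<bar>?u0 x\<bar> \<le> ?B" "\<bar>0\<bar> \<le> ?B" for x :: "real \<times> real"
    using densities_pos by (auto simp: riemann_data_def)
  obtain P where P: "\<And>z. \<bar>p (\<rho> z)\<bar> \<le> P"
    using pressure_density_bounded by blast
  have \<rho>0_meas: "?\<rho>0 \<in> borel_measurable borel" "?u0 \<in> borel_measurable borel"
    by (rule borel_measurable_riemann_data)+
  note [measurable] = \<rho>0_meas borel_measurable_pressure_density
  have rays: "\<bar>ray \<epsilon> z\<bar> \<le> a / \<epsilon>" "0 \<le> a / \<epsilon>" if "z \<in> ?S" for z
    using ray_bound[OF that pos] by linarith+
  have bulk1: "set_integrable lborel ?S (\<lambda>z. ?w1 z * (slope entropy_profile (ray \<epsilon> z) / (fst z + \<epsilon>)))"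
  proof (rule set_integrable_ray_slope[OF pos _ _ bounded_lipschitz_entropy_profile AE_differentiable_profiles(2)])
    fix z assume z: "z \<in> ?S"
    have "\<bar>ray \<epsilon> z * \<rho> z\<bar> \<le> a / \<epsilon> * C"
      unfolding abs_mult by (intro mult_mono rays[OF z] density_bound) auto
    then show "\<bar>?w1 z\<bar> \<le> C * C + a / \<epsilon> * C"
      using momentum_bound[of z] by linarith
  qed measurable
  have bulk2: "set_integrable lborel ?S (\<lambda>z. ?w2 z * (slope U (ray \<epsilon> z) / (fst z + \<epsilon>)))"
  proof (rule set_integrable_ray_slope[OF pos _ _ bounded_lipschitz_velocity AE_differentiable_profiles(1)])
    fix z assume z: "z \<in> ?S"
    have "\<bar>ray \<epsilon> z * (\<rho> z * v1 z)\<bar> \<le> a / \<epsilon> * (C * C)"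
      unfolding abs_mult[of "ray \<epsilon> z"] by (intro mult_mono rays[OF z] momentum_bound) auto
    then show "\<bar>?w2 z\<bar> \<le> C * C^2 + P + a / \<epsilon> * (C * C)"
      using convective_bound[of z] P[of z] by linarith
  qed measurable
  have bulk3: "set_integrable lborel ?S (\<lambda>z. ?w3 z * (slope pressure_profile (ray \<epsilon> z) / (fst z + \<epsilon>)))"
    by (rule set_integrable_ray_slope[OF pos _ _ bounded_lipschitz_pressure_profile AE_differentiable_profiles(3),
          where C = "a / \<epsilon>"])
      (use rays in simp_all)
  have bulk4: "set_integrable lborel ?S (\<lambda>z. ?w4 z * (slope flux_profile (ray \<epsilon> z) / (fst z + \<epsilon>)))"
    by (rule set_integrable_ray_slope[OF pos _ _ bounded_lipschitz_flux_profile AE_differentiable_profiles(4),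
          where C = 1])
      simp_all
  note sum2 = set_integral_diff[OF bulk1 bulk2]
  note sum3 = set_integral_add[OF sum2(1) bulk3]
  note sum4 = set_integral_add[OF sum3(1) bulk4]
  \<comment> \<open>The four integrands add up to the entropy production of the wave at the state of the solution.\<close>
  have production: "?i ?w1 entropy_profile - ?i ?w2 U + ?i ?w3 pressure_profile + ?i ?w4 flux_profile \<le> 0"
  proof -
    have "AE z in lborel. z \<in> ?S \<longrightarrow>
        ?w1 z * (slope entropy_profile (ray \<epsilon> z) / (fst z + \<epsilon>)) - ?w2 z * (slope U (ray \<epsilon> z) / (fst z + \<epsilon>))
        + ?w3 z * (slope pressure_profile (ray \<epsilon> z) / (fst z + \<epsilon>))
        + ?w4 z * (slope flux_profile (ray \<epsilon> z) / (fst z + \<epsilon>)) \<le> 0"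
      using AE_ray[OF entropy_production pos]
    proof (eventually_elim, intro impI)
      fix z
      let ?\<xi> = "ray \<epsilon> z"
      assume *: "0 \<le> fst z \<longrightarrow> (\<exists>D. (U has_real_derivative D) (at ?\<xi>)) \<and>
          (\<exists>D. (entropy_profile has_real_derivative D) (at ?\<xi>)) \<and>
          (\<exists>D. (pressure_profile has_real_derivative D) (at ?\<xi>)) \<and>
          (\<exists>D. (flux_profile has_real_derivative D) (at ?\<xi>)) \<and>
          (\<forall>r v. r \<ge> 0 \<longrightarrow>
            (r * v - ?\<xi> * r) * slope entropy_profile ?\<xi> - ((r * v^2 + p r) - ?\<xi> * (r * v)) * slope U ?\<xi>
              - ?\<xi> * slope pressure_profile ?\<xi> + slope flux_profile ?\<xi> \<le> 0)"
        and z: "z \<in> ?S"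
      have t: "0 \<le> fst z"
        using z by (auto simp: mem_Times_iff)
      have "?w1 z * slope entropy_profile ?\<xi> - ?w2 z * slope U ?\<xi> - ?\<xi> * slope pressure_profile ?\<xi>
          + slope flux_profile ?\<xi> \<le> 0"
        using * t bounds(1)[of z] by blast
      then have "(?w1 z * slope entropy_profile ?\<xi> - ?w2 z * slope U ?\<xi> - ?\<xi> * slope pressure_profile ?\<xi>
          + slope flux_profile ?\<xi>) / (fst z + \<epsilon>) \<le> 0"
        using t pos by (intro divide_nonpos_pos) auto
      then show "?w1 z * (slope entropy_profile ?\<xi> / (fst z + \<epsilon>)) - ?w2 z * (slope U ?\<xi> / (fst z + \<epsilon>))
        + ?w3 z * (slope pressure_profile ?\<xi> / (fst z + \<epsilon>))
        + ?w4 z * (slope flux_profile ?\<xi> / (fst z + \<epsilon>)) \<le> 0"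
        by (simp add: add_divide_distrib diff_divide_distrib)
    qed
    then have "(LINT z:?S|lborel.
        ?w1 z * (slope entropy_profile (ray \<epsilon> z) / (fst z + \<epsilon>)) - ?w2 z * (slope U (ray \<epsilon> z) / (fst z + \<epsilon>))
        + ?w3 z * (slope pressure_profile (ray \<epsilon> z) / (fst z + \<epsilon>))
        + ?w4 z * (slope flux_profile (ray \<epsilon> z) / (fst z + \<epsilon>))) \<le> (LINT z:?S|lborel. 0)"
      by (intro set_integral_mono_AE[OF sum4(1)]) (auto simp: set_integrable_def)
    then show ?thesis
      unfolding sum4(2) sum3(2) sum2(2) by (simp add: set_lebesgue_integral_def)
  qed
  define \<Phi>L \<Phi>R where "\<Phi>L = uL * uL / 2 - potential_slope p rhoL" and "\<Phi>R = uR * uR / 2 - potential_slope p rhoR"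
  \<comment> \<open>At the walls the profiles are constant, so every boundary term is a multiple of the area \<open>?W\<close>.\<close>
  define e1L e1R where "e1L = rhoL * uL * \<Phi>L" and "e1R = rhoR * uR * \<Phi>R"
  define e2L e2R where "e2L = (rhoL * uL^2 + p rhoL) * uL" and "e2R = (rhoR * uR^2 + p rhoR) * uR"
  define e4L e4R where "e4L = 1 * (p rhoL * uL)" and "e4R = 1 * (p rhoR * uR)"
  define eL eR where "eL = (energy p rhoL (uL, 0) + p rhoL) * uL" and "eR = (energy p rhoR (uR, 0) + p rhoR) * uR"
  have cancel: "eL + e1L - e2L + e4L = 0" "eR + e1R - e2R + e4R = 0"
    unfolding eL_def e1L_def e2L_def e4L_def eR_def e1R_def e2R_def e4R_def \<Phi>L_def \<Phi>R_def
    using boundary_flux_cancellation[OF densities_pos(1), of uL]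
      boundary_flux_cancellation[OF densities_pos(2), of uR] by simp_all
  have wall: "(LINT y:{0..\<tau>} \<times> {0..<l}|lborel. rhoL * uL * entropy_profile (- a / (fst y + \<epsilon>))) = e1L * ?W"
    "(LINT y:{0..\<tau>} \<times> {0..<l}|lborel. rhoR * uR * entropy_profile (a / (fst y + \<epsilon>))) = e1R * ?W"
    "(LINT y:{0..\<tau>} \<times> {0..<l}|lborel. (rhoL * uL^2 + p rhoL) * U (- a / (fst y + \<epsilon>))) = e2L * ?W"
    "(LINT y:{0..\<tau>} \<times> {0..<l}|lborel. (rhoR * uR^2 + p rhoR) * U (a / (fst y + \<epsilon>))) = e2R * ?W"
    "(LINT y:{0..\<tau>} \<times> {0..<l}|lborel. 1 * flux_profile (- a / (fst y + \<epsilon>))) = e4L * ?W"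
    "(LINT y:{0..\<tau>} \<times> {0..<l}|lborel. 1 * flux_profile (a / (fst y + \<epsilon>))) = e4R * ?W"
    unfolding e1L_def e1R_def e2L_def e2R_def e4L_def e4R_def
    by (rule wall_integral, simp only: entropy_profile_def flux_profile_def far \<Phi>L_def \<Phi>R_def)+
  have const: "(LINT y:{0..\<tau>} \<times> {0..<l}|lborel. c) = c * ?W" for c :: real
    using set_integral_mult_right[of lborel "{0..\<tau>} \<times> {0..<l}" c "\<lambda>_. 1"] by simp
  have A: "set_integrable lborel (Omega a l) (\<lambda>x. \<rho> (\<tau>, x) * entropy_profile (fst x / s))"
    "set_integrable lborel (Omega a l) (\<lambda>x. \<rho> (\<tau>, x) * v1 (\<tau>, x) * U (fst x / s))" for s
    by (rule set_integrable_profile[OF _ _ bounded_lipschitz_entropy_profile, where M = C],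
        measurable, rule density_bound)
      (rule set_integrable_profile[OF _ _ bounded_lipschitz_velocity, where M = "C * C"],
        measurable, rule momentum_bound)
  have B: "set_integrable lborel (Omega a l) (\<lambda>x. ?\<rho>0 x * entropy_profile (fst x / s))"
    "set_integrable lborel (Omega a l) (\<lambda>x. ?\<rho>0 x * ?u0 x * U (fst x / s))" for s
  proof -
    show "set_integrable lborel (Omega a l) (\<lambda>x. ?\<rho>0 x * entropy_profile (fst x / s))"
      by (rule set_integrable_profile[OF \<rho>0_meas(1) riemann_data_bound bounded_lipschitz_entropy_profile])
    have "\<bar>?\<rho>0 x * ?u0 x\<bar> \<le> (\<bar>rhoL\<bar> + \<bar>rhoR\<bar>) * (\<bar>uL\<bar> + \<bar>uR\<bar>)" for x :: "real \<times> real"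
      unfolding abs_mult by (intro mult_mono riemann_data_bound) auto
    then show "set_integrable lborel (Omega a l) (\<lambda>x. ?\<rho>0 x * ?u0 x * U (fst x / s))"
      by (intro set_integrable_profile[OF _ _ bounded_lipschitz_velocity]) measurable
  qed
  have P3: "set_integrable lborel (Omega a l) (\<lambda>x. 1 * pressure_profile (fst x / s))" for s
    by (rule set_integrable_profile[OF _ _ bounded_lipschitz_pressure_profile, where M = 1]) auto
  have law1: "(LINT x:Omega a l|lborel. \<rho> (\<tau>, x) * entropy_profile (fst x / (\<tau> + \<epsilon>)))
      - (LINT x:Omega a l|lborel. ?\<rho>0 x * entropy_profile (fst x / \<epsilon>)) + e1R * ?W - e1L * ?W
      = ?i ?w1 entropy_profile"
    using continuity_law_lipschitz[OF \<tau> pos bounded_lipschitz_entropy_profile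
      AE_differentiable_profiles(2)]
    unfolding balance_law_def wall set_integral_diff(2)[OF A(1) B(1)] .
  have law2: "(LINT x:Omega a l|lborel. \<rho> (\<tau>, x) * v1 (\<tau>, x) * U (fst x / (\<tau> + \<epsilon>)))
      - (LINT x:Omega a l|lborel. ?\<rho>0 x * ?u0 x * U (fst x / \<epsilon>)) + e2R * ?W - e2L * ?W
      = ?i ?w2 U"
    using momentum_law_lipschitz[OF \<tau> pos bounded_lipschitz_velocity
      AE_differentiable_profiles(1)]
    unfolding balance_law_def wall set_integral_diff(2)[OF A(2) B(2)] .
  have "balance_law \<tau> a l \<epsilon> (\<lambda>_. 1) (\<lambda>_. 1) 0 0 (\<lambda>_. 1) (\<lambda>_. 0) pressure_profile (slope pressure_profile)"
  proof (rule balance_law_lipschitz[where C = 1, OF pos _ _ _ _ _ _ _ _ _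
        bounded_lipschitz_pressure_profile AE_differentiable_profiles(3)])
    show "balance_law \<tau> a l \<epsilon> (\<lambda>_. 1) (\<lambda>_. 1) 0 0 (\<lambda>_. 1) (\<lambda>_. 0) F F'"
      if "\<And>x. (F has_real_derivative F' x) (at x)" "continuous_on UNIV F'" for F F'
      using that pos less_imp_le[OF \<tau>T] by (rule balance_law_time)
  qed simp_all
  then have law3: "(LINT x:Omega a l|lborel. 1 * pressure_profile (fst x / (\<tau> + \<epsilon>)))
      - (LINT x:Omega a l|lborel. 1 * pressure_profile (fst x / \<epsilon>)) = ?i ?w3 pressure_profile"
    unfolding balance_law_def set_integral_diff(2)[OF P3 P3] by (simp only: set_integral_mult_right mult_zero_left add_0_right diff_0_right)
  have "balance_law \<tau> a l \<epsilon> (\<lambda>_. 0) (\<lambda>_. 0) 1 1 (\<lambda>_. 0) (\<lambda>_. 1) flux_profile (slope flux_profile)"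
  proof (rule balance_law_lipschitz[where C = 1, OF pos _ _ _ _ _ _ _ _ _
        bounded_lipschitz_flux_profile AE_differentiable_profiles(4)])
    show "balance_law \<tau> a l \<epsilon> (\<lambda>_. 0) (\<lambda>_. 0) 1 1 (\<lambda>_. 0) (\<lambda>_. 1) F F'"
      if "\<And>x. (F has_real_derivative F' x) (at x)" "continuous_on UNIV F'" for F F'
      using that pos a by (rule balance_law_space)
  qed simp_all
  then have law4: "e4R * ?W - e4L * ?W = ?i ?w4 flux_profile"
    unfolding balance_law_def wall by (simp add: set_lebesgue_integral_def)
  have energy: "(LINT x:Omega a l|lborel. energy p (\<rho> (\<tau>, x)) (v1 (\<tau>, x), v2 (\<tau>, x)))
       - (LINT x:Omega a l|lborel. energy p (?\<rho>0 x) (?u0 x, 0)) + eR * ?W - eL * ?W \<le> 0"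
    using \<tau> unfolding regular_time_def riemann_velocity const[of "(energy p rhoL (uL, 0) + p rhoL) * uL"]
      const[of "(energy p rhoR (uR, 0) + p rhoR) * uR"] eL_def eR_def by (elim conjE)
  have "(eL + e1L - e2L + e4L) * ?W = 0" "(eR + e1R - e2R + e4R) * ?W = 0"
    unfolding cancel by simp_all
  then have boundary: "eL * ?W + e1L * ?W - e2L * ?W + e4L * ?W = 0"
    "eR * ?W + e1R * ?W - e2R * ?W + e4R * ?W = 0"
    by (simp_all only: distrib_right left_diff_distrib)
  have final: "(LINT x:Omega a l|lborel. relative_energy p (\<rho> (\<tau>, x)) (v1 (\<tau>, x), v2 (\<tau>, x)) (R (fst x / s)) (U (fst x / s)))
    = (LINT x:Omega a l|lborel. energy p (\<rho> (\<tau>, x)) (v1 (\<tau>, x), v2 (\<tau>, x)))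
      - (LINT x:Omega a l|lborel. \<rho> (\<tau>, x) * v1 (\<tau>, x) * U (fst x / s))
      + (LINT x:Omega a l|lborel. \<rho> (\<tau>, x) * entropy_profile (fst x / s))
      + (LINT x:Omega a l|lborel. 1 * pressure_profile (fst x / s))" for s
    by (rule relative_energy_integral[OF _ _ _ M]) measurable
  have init: "(LINT x:Omega a l|lborel. relative_energy p (?\<rho>0 x) (?u0 x, 0) (R (fst x / s)) (U (fst x / s)))
    = (LINT x:Omega a l|lborel. energy p (?\<rho>0 x) (?u0 x, 0))
      - (LINT x:Omega a l|lborel. ?\<rho>0 x * ?u0 x * U (fst x / s))
      + (LINT x:Omega a l|lborel. ?\<rho>0 x * entropy_profile (fst x / s))
      + (LINT x:Omega a l|lborel. 1 * pressure_profile (fst x / s))" for s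
    by (rule relative_energy_integral[OF \<rho>0_meas _ M0]) measurable
  \<comment> \<open>What remains is linear in the integrals, stated for real numbers to hide their integrands.\<close>
  have add_up: "E - A2 + A1 + A3 \<le> E0 - B2 + B1 + B3"
    if "A1 - B1 + x1R - x1L = I1" "A2 - B2 + x2R - x2L = I2" "A3 - B3 = I3" "x4R - x4L = I4"
      "E - E0 + xR - xL \<le> 0" "I1 - I2 + I3 + I4 \<le> 0"
      "xL + x1L - x2L + x4L = 0" "xR + x1R - x2R + x4R = 0"
    for E E0 A1 A2 A3 B1 B2 B3 I1 I2 I3 I4 x1L x1R x2L x2R x4L x4R xL xR :: real
    using that by linarith
  show ?thesis
    unfolding final init
    by (rule add_up[OF law1 law2 law3 law4 energy production boundary])
qed

section \<open>Weak-strong uniqueness\<close>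

lemma relative_energy_profile_bounded:
  obtains B where "\<And>f g h \<xi>. 0 \<le> f \<Longrightarrow> f \<le> M \<Longrightarrow> \<bar>g\<bar> \<le> M \<Longrightarrow> \<bar>h\<bar> \<le> M \<Longrightarrow>
    \<bar>relative_energy p f (g, h) (R \<xi>) (U \<xi>)\<bar> \<le> B"
proof -
  obtain E where E: "\<And>f g h. 0 \<le> f \<Longrightarrow> f \<le> M \<Longrightarrow> \<bar>g\<bar> \<le> M \<Longrightarrow> \<bar>h\<bar> \<le> M \<Longrightarrow> \<bar>energy p f (g, h)\<bar> \<le> E"
    using energy_bounded by blast
  obtain KU where KU: "\<And>\<xi>. \<bar>U \<xi>\<bar> \<le> KU"
    using bounded_lipschitz_velocity by (auto simp: bounded_lipschitz_def)
  obtain KE where KE: "\<And>\<xi>. \<bar>entropy_profile \<xi>\<bar> \<le> KE"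
    using bounded_lipschitz_entropy_profile by (auto simp: bounded_lipschitz_def)
  obtain KP where KP: "\<And>\<xi>. \<bar>pressure_profile \<xi>\<bar> \<le> KP"
    using bounded_lipschitz_pressure_profile by (auto simp: bounded_lipschitz_def)
  show ?thesis
  proof (rule that[of "E + M * M * KU + M * KE + KP"])
    fix f g h \<xi> assume fgh: "0 \<le> f" "f \<le> M" "\<bar>g\<bar> \<le> M" "\<bar>h\<bar> \<le> M"
    have f: "\<bar>f\<bar> \<le> M" "0 \<le> M"
      using fgh by auto
    have "\<bar>f * g * U \<xi>\<bar> \<le> M * M * KU"
      unfolding abs_mult by (intro mult_mono f fgh KU mult_nonneg_nonneg) auto
    moreover have "\<bar>f * entropy_profile \<xi>\<bar> \<le> M * KE"
      unfolding abs_mult by (intro mult_mono f KE) auto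
    ultimately show "\<bar>relative_energy p f (g, h) (R \<xi>) (U \<xi>)\<bar> \<le> E + M * M * KU + M * KE + KP"
      unfolding relative_energy_profile using E[OF fgh] KP[of \<xi>] by linarith
  qed
qed

lemma borel_measurable_relative_energy:
  assumes [measurable]: "f \<in> borel_measurable N" "g \<in> borel_measurable N" "h \<in> borel_measurable N"
      "\<xi> \<in> borel_measurable N"
    and nonneg: "\<And>x. 0 \<le> f x"
  shows "(\<lambda>x. relative_energy p (f x) (g x, h x) (R (\<xi> x)) (U (\<xi> x))) \<in> borel_measurable N"
proof -
  note [measurable] = borel_measurable_energy[OF assms(1-3) nonneg]
    borel_measurable_bounded_lipschitz[OF bounded_lipschitz_velocity]
    borel_measurable_bounded_lipschitz[OF bounded_lipschitz_entropy_profile]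
    borel_measurable_bounded_lipschitz[OF bounded_lipschitz_pressure_profile]
  show ?thesis
    unfolding relative_energy_profile by measurable
qed

lemma isCont_relative_energy_profile:
  "isCont (\<lambda>\<xi>. relative_energy p f (g, h) (R \<xi>) (U \<xi>)) \<xi>"
proof -
  have cont: "isCont F \<xi>" if "bounded_lipschitz F" for F
    using that unfolding bounded_lipschitz_def
    by (auto simp: continuous_on_eq_continuous_at dest!: lipschitz_on_continuous_on)
  show ?thesis
    unfolding relative_energy_profile
    by (intro continuous_intros cont[OF bounded_lipschitz_velocity]
        cont[OF bounded_lipschitz_entropy_profile] cont[OF bounded_lipschitz_pressure_profile])
qed

text \<open>
  The shifted wave does not attain the Riemann data exactly, but for fixed \<open>x1 \<noteq> 0\<close> its value at time
  \<open>0\<close> is the outer constant state as soon as \<open>\<epsilon>\<close> is small compared with \<open>\<bar>x1\<bar>\<close>.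
\<close>

lemma initial_relative_energy_tendsto:
  assumes \<epsilon>: "\<epsilon> \<longlonglongrightarrow> 0" "\<And>n. \<epsilon> n > 0"
  shows "(\<lambda>n. LINT x:Omega a l|lborel. relative_energy p (riemann_data rhoL rhoR (fst x))
      (riemann_data uL uR (fst x), 0) (R (fst x / \<epsilon> n)) (U (fst x / \<epsilon> n))) \<longlonglongrightarrow> 0"
proof -
  let ?E = "\<lambda>s x::real \<times> real. relative_energy p (riemann_data rhoL rhoR (fst x))
      (riemann_data uL uR (fst x), 0) (R (fst x / s)) (U (fst x / s))"
  let ?m = "\<bar>rhoL\<bar> + \<bar>rhoR\<bar> + \<bar>uL\<bar> + \<bar>uR\<bar>"
  obtain B where B: "\<And>f g h \<xi>. 0 \<le> f \<Longrightarrow> f \<le> ?m \<Longrightarrow> \<bar>g\<bar> \<le> ?m \<Longrightarrow> \<bar>h\<bar> \<le> ?m \<Longrightarrow>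
    \<bar>relative_energy p f (g, h) (R \<xi>) (U \<xi>)\<bar> \<le> B"
    using relative_energy_profile_bounded by blast
  have nonneg: "0 \<le> riemann_data rhoL rhoR (fst x)" for x :: "real \<times> real"
    using densities_pos by (simp add: riemann_data_def)
  have "(\<lambda>n. LINT x:Omega a l|lborel. ?E (\<epsilon> n) x) \<longlonglongrightarrow> (LINT x:Omega a l|lborel. 0)"
  proof (rule set_integral_tendsto_bounded)
    show "?E (\<epsilon> n) \<in> borel_measurable borel" for n
      by (rule borel_measurable_relative_energy[OF borel_measurable_riemann_data
            borel_measurable_riemann_data _ _ nonneg]) measurable
    show "\<bar>?E (\<epsilon> n) x\<bar> \<le> B" for n x
      by (rule B) (use densities_pos in \<open>auto simp: riemann_data_def\<close>)
    have "AE x in (lborel :: (real \<times> real) measure). fst x \<noteq> 0"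
      by (rule AE_lborel_fst_neq)
    then show "AE x in lborel. x \<in> Omega a l \<longrightarrow> (\<lambda>n. ?E (\<epsilon> n) x) \<longlonglongrightarrow> 0"
    proof (eventually_elim, intro impI)
      fix x :: "real \<times> real" assume x: "fst x \<noteq> 0"
      have far: "?E s x = 0" if s: "0 < s" "s < \<bar>fst x\<bar> * T / (2 * a)" for s
      proof -
        \<comment> \<open>The point lies on the ray that reaches the wall at time \<open>b\<close>.\<close>
        define b where "b = a * s / \<bar>fst x\<bar>"
        have b: "b \<in> {0<..<T}"
        proof -
          have "2 * (a * s) < \<bar>fst x\<bar> * T"
            using s(2) a by (simp add: pos_less_divide_eq algebra_simps)
          moreover have "0 < a * s"
            using s(1) a by simp
          ultimately have "a * s < \<bar>fst x\<bar> * T"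
            by linarith
          then show ?thesis
            using s(1) a x by (simp add: b_def pos_divide_less_eq mult.commute)
        qed
        have "fst x / s = (if fst x \<le> 0 then - a / b else a / b)"
          using x s a by (auto simp: b_def field_simps)
        then show ?thesis
          using far_field[OF b] by (auto simp: riemann_data_def relative_energy_def)
      qed
      have "0 < \<bar>fst x\<bar> * T / (2 * a)"
        using x T a by simp
      then have "\<forall>\<^sub>F n in sequentially. \<epsilon> n < \<bar>fst x\<bar> * T / (2 * a)"
        using \<epsilon>(1) by (rule order_tendstoD(2)[rotated])
      then have "\<forall>\<^sub>F n in sequentially. ?E (\<epsilon> n) x = 0"
        by eventually_elim (rule far[OF \<epsilon>(2)])
      then show "(\<lambda>n. ?E (\<epsilon> n) x) \<longlonglongrightarrow> 0"
        by (rule tendsto_eventually)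
    qed
  qed (measurable, rule bounded_Omega, measurable)
  then show ?thesis
    by (simp add: set_lebesgue_integral_def)
qed

text \<open>
  Letting the shift tend to zero, the relative energy with respect to the unshifted wave has a
  nonpositive integral. Since it is nonnegative and vanishes only for equal states, the states agree.
  Positivity of the density of the wave makes the velocities agree as well.
\<close>

lemma equality_at_regular_time:
  assumes \<tau>: "regular_time \<tau>"
  shows "AE x in lborel. x \<in> Omega a l \<longrightarrow>
    \<rho> (\<tau>, x) = R (fst x / \<tau>) \<and> v1 (\<tau>, x) = U (fst x / \<tau>) \<and> v2 (\<tau>, x) = 0"
proof -
  have \<tau>T: "0 < \<tau>" "\<tau> < T"
    using \<tau> by (auto simp: regular_time_def)
  let ?E = "\<lambda>s x. relative_energy p (\<rho> (\<tau>, x)) (v1 (\<tau>, x), v2 (\<tau>, x)) (R (fst x / s)) (U (fst x / s))"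
  obtain B where B: "\<And>f g h \<xi>. 0 \<le> f \<Longrightarrow> f \<le> C \<Longrightarrow> \<bar>g\<bar> \<le> C \<Longrightarrow> \<bar>h\<bar> \<le> C \<Longrightarrow>
    \<bar>relative_energy p f (g, h) (R \<xi>) (U \<xi>)\<bar> \<le> B"
    using relative_energy_profile_bounded by blast
  have meas: "?E s \<in> borel_measurable borel" for s
    by (rule borel_measurable_relative_energy[OF _ _ _ _ bounds(1)]) measurable
  have bound: "\<bar>?E s x\<bar> \<le> B" for s x
    by (rule B) (rule bounds)+
  define \<epsilon> where "\<epsilon> n = (T - \<tau>) / 2 * inverse (real (Suc n))" for n
  have \<epsilon>0: "\<epsilon> \<longlonglongrightarrow> 0"
    unfolding \<epsilon>_def by (rule tendsto_mult_right_zero[OF LIMSEQ_inverse_real_of_nat])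
  have \<epsilon>: "\<epsilon> n > 0" "\<tau> + \<epsilon> n < T" for n
  proof -
    show "\<epsilon> n > 0"
      unfolding \<epsilon>_def using \<tau>T by (intro mult_pos_pos) auto
    have "\<epsilon> n \<le> (T - \<tau>) / 2 * 1"
      unfolding \<epsilon>_def using \<tau>T by (intro mult_left_mono) (auto simp: inverse_le_1_iff)
    then show "\<tau> + \<epsilon> n < T"
      using \<tau>T by (simp add: field_simps)
  qed
  have "(\<lambda>n. LINT x:Omega a l|lborel. ?E (\<tau> + \<epsilon> n) x) \<longlonglongrightarrow> (LINT x:Omega a l|lborel. ?E \<tau> x)"
  proof (rule set_integral_tendsto_bounded[OF Omega_borel bounded_Omega meas meas _ bound])
    have lim: "(\<lambda>n. ?E (\<tau> + \<epsilon> n) x) \<longlonglongrightarrow> ?E \<tau> x" for x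
    proof (rule isCont_tendsto_compose[OF isCont_relative_energy_profile])
      have "(\<lambda>n. fst x / (\<tau> + \<epsilon> n)) \<longlonglongrightarrow> fst x / (\<tau> + 0)"
        using \<tau>T \<epsilon>0 by (intro tendsto_intros) auto
      then show "(\<lambda>n. fst x / (\<tau> + \<epsilon> n)) \<longlonglongrightarrow> fst x / \<tau>"
        by simp
    qed
    show "AE x in lborel. x \<in> Omega a l \<longrightarrow> (\<lambda>n. ?E (\<tau> + \<epsilon> n) x) \<longlonglongrightarrow> ?E \<tau> x"
      by (rule AE_I2) (rule impI, rule lim)
  qed
  then have le: "(LINT x:Omega a l|lborel. ?E \<tau> x) \<le> 0"
    by (rule LIMSEQ_le[OF _ initial_relative_energy_tendsto[OF \<epsilon>0 \<epsilon>(1)]])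
      (use relative_energy_inequality[OF \<tau> \<epsilon>] in blast)
  have nonneg: "0 \<le> ?E \<tau> x" for x
    by (rule relative_energy_nonneg[OF bounds(1) density_pos])
  have "set_integrable lborel (Omega a l) (?E \<tau>)"
    by (rule set_integrable_lborel_bounded[OF Omega_borel bounded_Omega meas bound])
  then have int: "integrable lborel (\<lambda>x. indicator (Omega a l) x *\<^sub>R ?E \<tau> x)"
    by (simp only: set_integrable_def)
  have nn: "AE x in lborel. 0 \<le> indicator (Omega a l) x *\<^sub>R ?E \<tau> x"
    using nonneg by (intro AE_I2) simp
  have "integral\<^sup>L lborel (\<lambda>x. indicator (Omega a l) x *\<^sub>R ?E \<tau> x) = 0"
    using le integral_nonneg_AE[OF nn] unfolding set_lebesgue_integral_def by (rule order_antisym)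
  then have "AE x in lborel. indicator (Omega a l) x *\<^sub>R ?E \<tau> x = 0"
    using integral_nonneg_eq_0_iff_AE[OF int nn] by blast
  then show ?thesis
  proof (eventually_elim, intro impI)
    fix x assume "indicator (Omega a l) x *\<^sub>R ?E \<tau> x = 0" and "x \<in> Omega a l"
    then have "?E \<tau> x = 0"
      by simp
    then show "\<rho> (\<tau>, x) = R (fst x / \<tau>) \<and> v1 (\<tau>, x) = U (fst x / \<tau>) \<and> v2 (\<tau>, x) = 0"
      unfolding relative_energy_eq_0_iff[OF bounds(1) density_pos] by simp
  qed
qed

text \<open>
  Since all functions are Borel, equality in almost every time slice gives equality almost everywhere
  in space-time.
\<close>

lemma equality_almost_everywhere:
  "AE z in lborel. z \<in> {0<..<T} \<times> Omega a l \<longrightarrow>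
    rho (fst z) (snd z) = R (fst (snd z) / fst z) \<and> u (fst z) (snd z) = (U (fst (snd z) / fst z), 0)"
proof -
  let ?Q = "\<lambda>z. \<rho> z = R (fst (snd z) / fst z) \<and> v1 z = U (fst (snd z) / fst z) \<and> v2 z = 0"
  have [measurable]: "R \<in> borel_measurable borel" "U \<in> borel_measurable borel"
    using continuous_profiles by (auto intro: borel_measurable_continuous_onI)
  have [measurable]: "{0<..<T} \<times> Omega a l \<in> sets borel"
    by (intro borel_Times) auto
  have "AE z in lborel. z \<in> {0<..<T} \<times> Omega a l \<longrightarrow> ?Q z"
  proof (rule AE_lborel_pairI)
    show "AE t in lborel. AE x in lborel. (t, x) \<in> {0<..<T} \<times> Omega a l \<longrightarrow> ?Q (t, x)"
      using AE_regular_time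
    proof eventually_elim
      case (elim t)
      show ?case
      proof (cases "t \<in> {0<..<T}")
        case True
        then show ?thesis
          using equality_at_regular_time[of t] elim by simp
      next
        case False
        then show ?thesis
          by (intro AE_I2) auto
      qed
    qed
    show "{z. z \<in> {0<..<T} \<times> Omega a l \<longrightarrow> ?Q z} \<in> sets borel"
      by measurable
  qed
  with rep show ?thesis
    by eventually_elim simp
qed

end

theorem theorem2p1:
  fixes p :: "real \<Rightarrow> real"
    and T a l rhoL rhoR uL uR :: real
    and R U :: "real \<Rightarrow> real"
    and rho :: "real \<Rightarrow> real \<times> real \<Rightarrow> real"
    and u :: "real \<Rightarrow> real \<times> real \<Rightarrow> real \<times> real"
  assumes "admissible_pressure p"
    and "T > 0" and "a > 0" and "l > 0"
    and "rarefaction_solution p rhoL rhoR uL uR R U"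
    and "essinf (lebesgue_on ({0<..<T} \<times> UNIV)) (\<lambda>(t, x1). self_similar R t x1) > 0"
    and "\<forall>t\<in>{0<..<T}. \<forall>x1. x1 \<le> -a \<longrightarrow> self_similar R t x1 = rhoL \<and> self_similar U t x1 = uL"
    and "\<forall>t\<in>{0<..<T}. \<forall>x1. x1 \<ge> a \<longrightarrow> self_similar R t x1 = rhoR \<and> self_similar U t x1 = uR"
    and "bounded_admissible_weak_solution p T a l rhoL rhoR uL uR rho u"
    and "AE (t, x) in lebesgue_on ({0<..<T} \<times> Omega a l). rho t x \<ge> 0"
  shows "AE (t, x) in lebesgue_on ({0<..<T} \<times> Omega a l).
           rho t x = self_similar R t (fst x) \<and> u t x = (self_similar U t (fst x), 0)"
proof -
  let ?S = "{0<..<T} \<times> Omega a l"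
  have S: "?S \<in> sets borel"
    by (intro borel_Times Omega_borel) auto
  note weak = assms(9)[unfolded bounded_admissible_weak_solution_def]
  have rho: "(\<lambda>z. rho (fst z) (snd z)) \<in> borel_measurable (lebesgue_on ?S)"
    and u: "(\<lambda>z. u (fst z) (snd z)) \<in> borel_measurable (lebesgue_on ?S)"
    using weak by (simp_all add: case_prod_unfold)
  obtain C0 where C0: "AE z in lebesgue_on ?S. \<bar>rho (fst z) (snd z)\<bar> \<le> C0 \<and> norm (u (fst z) (snd z)) \<le> C0"
    using weak by (simp only: case_prod_unfold) blast
  define C where "C = \<bar>C0\<bar>"
  have nonneg: "AE z in lebesgue_on ?S. rho (fst z) (snd z) \<ge> 0"
    using assms(10) by (simp add: case_prod_unfold)
  have "AE z in lebesgue_on ?S. 0 \<le> rho (fst z) (snd z) \<and> rho (fst z) (snd z) \<le> C"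
    using C0 nonneg by eventually_elim (simp add: C_def)
  then obtain \<rho> where \<rho>: "\<rho> \<in> borel_measurable borel" "\<And>z. 0 \<le> \<rho> z" "\<And>z. \<rho> z \<le> C"
    "AE z in lborel. z \<in> ?S \<longrightarrow> rho (fst z) (snd z) = \<rho> z"
    by (rule bounded_borel_representative[OF rho S]) (auto simp: C_def)
  have u1: "(\<lambda>z. fst (u (fst z) (snd z))) \<in> borel_measurable (lebesgue_on ?S)"
    and u2: "(\<lambda>z. snd (u (fst z) (snd z))) \<in> borel_measurable (lebesgue_on ?S)"
    using u by (rule borel_measurable_fst_borel, rule borel_measurable_snd_borel)
  have "AE z in lebesgue_on ?S. - C \<le> fst (u (fst z) (snd z)) \<and> fst (u (fst z) (snd z)) \<le> C"
    using C0
  proof eventually_elim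
    case (elim z)
    then have "\<bar>fst (u (fst z) (snd z))\<bar> \<le> C"
      using norm_fst_le[of "fst (u (fst z) (snd z))" "snd (u (fst z) (snd z))"]
      unfolding C_def prod.collapse real_norm_def by linarith
    then show ?case
      by (simp add: abs_le_iff)
  qed
  then obtain v1 where v1: "v1 \<in> borel_measurable borel" "\<And>z. - C \<le> v1 z" "\<And>z. v1 z \<le> C"
    "AE z in lborel. z \<in> ?S \<longrightarrow> fst (u (fst z) (snd z)) = v1 z"
    by (rule bounded_borel_representative[OF u1 S]) (auto simp: C_def)
  have "AE z in lebesgue_on ?S. - C \<le> snd (u (fst z) (snd z)) \<and> snd (u (fst z) (snd z)) \<le> C"
    using C0
  proof eventually_elim
    case (elim z)
    then have "\<bar>snd (u (fst z) (snd z))\<bar> \<le> C"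
      using norm_snd_le[of "snd (u (fst z) (snd z))" "fst (u (fst z) (snd z))"]
      unfolding C_def prod.collapse real_norm_def by linarith
    then show ?case
      by (simp add: abs_le_iff)
  qed
  then obtain v2 where v2: "v2 \<in> borel_measurable borel" "\<And>z. - C \<le> v2 z" "\<And>z. v2 z \<le> C"
    "AE z in lborel. z \<in> ?S \<longrightarrow> snd (u (fst z) (snd z)) = v2 z"
    by (rule bounded_borel_representative[OF u2 S]) (auto simp: C_def)
  obtain r m where rm: "weakly_continuous_rep T (Omega a l) rho r"
    "weakly_continuous_rep T (Omega a l) (\<lambda>t x. rho t x *\<^sub>R u t x) m"
    "weak_continuity_eq T a l rhoL rhoR uL uR rho u r" "weak_momentum_eq p T a l rhoL rhoR uL uR rho u m"
    using weak by blast
  interpret weak_solution p T a rhoL rhoR uL uR R U l C rho u r m \<rho> v1 v2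
  proof unfold_locales
    show "AE z in lborel. z \<in> ?S \<longrightarrow>
        rho (fst z) (snd z) = \<rho> z \<and> u (fst z) (snd z) = (v1 z, v2 z)"
      using \<rho>(4) v1(4) v2(4) by eventually_elim (auto simp: prod_eq_iff)
    show "energy_inequality p T a l rhoL rhoR uL uR rho u"
      using weak by blast
    show "\<bar>v1 z\<bar> \<le> C" "\<bar>v2 z\<bar> \<le> C" for z
      using v1(2,3)[of z] v2(2,3)[of z] by linarith+
  qed (fact assms \<rho> v1 v2 rm)+
  have "AE z in lebesgue_on ?S.
      rho (fst z) (snd z) = R (fst (snd z) / fst z) \<and> u (fst z) (snd z) = (U (fst (snd z) / fst z), 0)"
    using equality_almost_everywhere S
    by (subst AE_restrict_space_iff) (auto simp: AE_completion_iff)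
  then show ?thesis
    by (simp only: case_prod_unfold self_similar_def)
qed

end
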